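(* Suppose that $f\colon X_1\times Y_1\to X_{\gamma_X}$ and $g\colon X_1 \times Y_1\to Y_{\delta_Y}$ are continuously differentiable with $\|\mathrm{D} f(x,y)\|_{\mathcal{B}(X_1\times Y_1,X_{\gamma_X})}\leq L_f$ and $\|\mathrm{D} g(x,y)\|_{\mathcal{B}(X_1\times Y_1,Y_{\delta_Y})}\leq L_g$ for all $(x,y)\in X_1\times Y_1$. Let $(u^{\epsilon},v_F^{\epsilon},v_S^{\epsilon})$ be the solution of the split fast-slow system (see context) with initial value $(u_0,v_{0,F},v_{0,S})\in X_1\times (Y_F^\zeta\cap Y_1)\times (Y_S^\zeta\cap Y_1)$. If $\zeta$ and $\epsilon$ are small enough, then there are constants $C,c>0$ such that for all $t\ge0$ $$\left\|\begin{pmatrix} u^{\epsilon}(t)-h^{\epsilon,\zeta}_{X_1}(v^{\epsilon}_S(t))\\ v^{\epsilon}_F(t)-h^{\epsilon,\zeta}_{Y_F^{\zeta}}(v^{\epsilon}_S(t))\end{pmatrix}\right\|_{X_1\times Y_1}\leq Ce^{-ct}\left\|\begin{pmatrix} u_0-h^{\epsilon,\zeta}_{X_1}(v_{0,S})\\ v_{0,F}-h^{\epsilon,\zeta}_{Y_F^{\zeta}}(v_{0,S})\end{pmatrix}\right\|_{X_1\times Y_1}.$$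
   Context: **Setting.** $X,Y$ are Banach spaces and $\epsilon>0$ is a parameter. (i) $A\colon X\supset D(A)\to X$ is a closed linear operator generating an exponentially stable $C_0$-semigroup $(e^{tA})_{t\ge0}$ on $X$; $B\colon Y\supset D(B)\to Y$ is a closed linear operator generating a $C_0$-semigroup $(e^{tB})_{t\ge0}$ on $Y$. (ii) $(X_\alpha)_{\alpha\in[-1,\infty)}$ and $(Y_\alpha)_{\alpha\in[-1,\infty)}$ are, up to equivalence of norms for each fixed $\alpha$, the interpolation-extrapolation scales generated by $(X,A)$ and $(Y,B)$ (by $(Y,B-\lambda)$ for some $\lambda\in\rho(B)$ if $0\notin\rho(B)$). The interpolation-extrapolation scale of a densely defined closed operator $S$ on a Banach space $Z$ with $0\in\rho(S)$ is defined, after fixing for each $\theta\in(0,1)$ an exact interpolation functor $(\cdot,\cdot)_\theta$ such that $Z_1$ is dense in $(Z_0,Z_1)_\theta$ whenever $Z_1$ is densely embedded in $Z_0$, by: $Z_k=D(S^k)$ with norm $\|S^kz\|_Z$ for $k\in\mathbb N_0$; $Z_{-1}$ is the completion of $Z$ with respect to $\|S^{-1}z\|_Z$; $Z_{k+\theta}=(Z_k,Z_{k+1})_\theta$ for $k\in\mathbb N_0\cup\{-1\}$, $\theta\in(0,1)$. The operator and its semigroup are extended/restricted to the spaces of the scale and denoted by the same symbols. In particular $X_0=X$, $X_1=D(A)$, $Y_0=Y$, $Y_1=D(B)$. (iii) $\gamma_X\in(0,1]$ if $(e^{tA})_{t\ge0}$ is holomorphic and $\gamma_X=1$ otherwise;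 $\delta_X\in[1-\gamma_X,1]$; $\delta_Y\in(0,1]$ if $(e^{tB})_{t\ge0}$ is holomorphic and $\delta_Y=1$ otherwise. (iv) $f\colon X_{\delta_X}\times Y_{1-\delta_X}\to X$ and $g\colon X_1\times Y_1\to Y_{\delta_Y}$ are continuous, $f(0,0)=0$, $g(0,0)=0$; $f(x,y)\in X_{\gamma_X}$ and $g(x,y)\in Y_{\delta_Y}$ for $(x,y)\in X_1\times Y_1$; $f(u,v)\in C^1([0,t];X_{\delta_X-1})$ whenever $u\in C^1([0,t];X_{\delta_X})$ and $v\in C^1([0,t];Y)\cap C([0,t];Y_{1-\delta_X})$; and there are constants $L_f,L_g>0$ with $\|f(x_1,y_1)-f(x_2,y_2)\|_{X_{\gamma_X}}\le L_f(\|x_1-x_2\|_{X_1}+\|y_1-y_2\|_{Y_1})$, $\|f(u_1,v_1)-f(u_2,v_2)\|_{C^1([0,t];X_{\delta_X-1})}\le L_f(\|u_1-u_2\|_{C^1([0,t];X_{\delta_X})}+\|v_1-v_2\|_{C^1([0,t];Y)})$, $\|g(x_1,y_1)-g(x_2,y_2)\|_{Y_{\delta_Y}}\le L_g(\|x_1-x_2\|_{X_1}+\|y_1-y_2\|_{Y_1})$ for all $x_i\in X_1$, $y_i\in Y_1$, $u_i\in C^1([0,t];X_{\delta_X})$, $v_i\in C^1([0,t];Y)\cap C([0,t];Y_{1-\delta_X})$. (v) $M_A,M_B,C_A,C_B>0$, $\omega_A<0$, $\omega_B\in\mathbb R$ are constants with, for all $t>0$, $\|e^{tA}\|_{\mathcal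 B(X_1)}\le M_Ae^{\omega_At}$, $\|e^{tA}\|_{\mathcal B(X_{\gamma_X},X_1)}\le C_At^{\gamma_X-1}e^{\omega_At}$, $\|e^{tA}\|_{\mathcal B(X_{\delta_X},X_1)}\le C_At^{\delta_X-1}e^{\omega_At}$, $\|e^{tB}\|_{\mathcal B(Y_1)}\le M_Be^{\omega_Bt}$, $\|e^{tB}\|_{\mathcal B(Y_{\delta_Y},Y_1)}\le C_Bt^{\delta_Y-1}e^{\omega_Bt}$. (vi) $\omega_f:=\omega_A+(2C_AL_f)^{1/\gamma_X}(1/\gamma_X)^{(1-\gamma_X)/\gamma_X}$ if $\gamma_X\in(0,1)$; if $\gamma_X=1$, $\omega_f$ is a fixed number $>\omega_A+C_AL_f$. It is assumed that $\omega_f<0$ and $L_f\max\{\|A^{-1}\|_{\mathcal B(X_{\gamma_X},X_1)},\|A^{-1}\|_{\mathcal B(X_{\delta_X-1},X_{\delta_X})}\}<1$. **Splitting of the slow variable space.** For each small $\zeta>0$ there is a splitting $Y=Y_F^\zeta\oplus Y_S^\zeta$ such that: (1) $Y_F^\zeta,Y_S^\zeta$ are closed in $Y$ and the projections $\operatorname{pr}_{Y_F^\zeta},\operatorname{pr}_{Y_S^\zeta}$ commute with $B$ on $Y_1$. (2) $Y_F^\zeta\cap Y_1$ and $Y_S^\zeta\cap Y_1$ are closed subspaces of $Y_1$, endowed with $\|\cdot\|_{Y_1}$. (3) With the convention $f(x,y_F,y_S):=f(x,y_F+y_S)$, $g(x,y_F,y_S):=g(x,y_F+y_S)$: $\|\operatorname{pr}_{Y_S^\zeta}[g(x,y_F,y_S)-g(\tilde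 x,\tilde y_F,\tilde y_S)]\|_{Y_1}\le L_g\zeta^{\delta_Y-1}(\|x-\tilde x\|_{X_1}+\|y_F-\tilde y_F\|_{Y_1}+\|y_S-\tilde y_S\|_{Y_1})$ for $x,\tilde x\in X_1$, $y_F,\tilde y_F\in Y_F^\zeta\cap Y_1$, $y_S,\tilde y_S\in Y_S^\zeta\cap Y_1$. (4) The realization of $B$ in $Y_S^\zeta$, with domain $\{v\in Y_S^\zeta\cap D(B):Bv\in Y_S^\zeta\}$, generates a $C_0$-group on $(Y_S^\zeta,\|\cdot\|_Y)$ which coincides with $e^{tB}$ on $Y_S^\zeta$ for $t\ge0$ (it is also denoted $e^{tB}$ for $t<0$). (5) The realization $B_{Y_F^\zeta}$ of $B$ in $Y_F^\zeta$, with domain $\{v\in Y_F^\zeta\cap D(B):Bv\in Y_F^\zeta\}$, has $0$ in its resolvent set. (6) There are constants $C_B,M_B>0$ such that for all small enough $\zeta>0$ there are constants $0\le N_F^\zeta<N_S^\zeta$ with $\|e^{tB}y_F\|_{Y_1}\le C_Bt^{\delta_Y-1}e^{(N_F^\zeta+\zeta^{-1}\omega_A)t}\|y_F\|_{Y_{\delta_Y}}$ ($t>0$, $y_F\in Y_F^\zeta\cap Y_{\delta_Y}$) and $\|e^{-tB}y_S\|_{Y_1}\le M_Be^{-(N_S^\zeta+\zeta^{-1}\omega_A)t}\|y_S\|_{Y_1}$ ($t\ge0$, $y_S\in Y_S^\zeta\cap Y_1$). (7) (Gap condition) The pairs $(\epsilon,\zeta)$ under consideration satisfy $$\frac{2^{\gamma_X}L_fC_A\Gamma(\gamma_X)}{\big(2(\epsilon\zeta^{-1}-1)\omega_A+\epsilon(N_S^\zeta+N_F^\zeta)\big)^{\gamma_X}}+\frac{2^{\delta_Y}L_gC_B\Gamma(\delta_Y)}{(N_S^\zeta-N_F^\zeta)^{\delta_Y}}+\frac{2\zeta^{\delta_Y-1}L_gM_B\Gamma(\delta_Y)}{N_S^\zeta-N_F^\zeta}<1,$$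 where $\Gamma$ is the gamma function and the base of the first denominator is understood to be positive. **Split fast-slow system.** $\epsilon\partial_tu^\epsilon=Au^\epsilon+f(u^\epsilon,v_F^\epsilon,v_S^\epsilon)$, $\partial_tv_F^\epsilon=Bv_F^\epsilon+\operatorname{pr}_{Y_F^\zeta}g(u^\epsilon,v_F^\epsilon,v_S^\epsilon)$, $\partial_tv_S^\epsilon=Bv_S^\epsilon+\operatorname{pr}_{Y_S^\zeta}g(u^\epsilon,v_F^\epsilon,v_S^\epsilon)$, with $u^\epsilon(0)=u_0$, $v_F^\epsilon(0)=v_{0,F}$, $v_S^\epsilon(0)=v_{0,S}$; for every $T>0$ it has a unique strict solution on $[0,T]$ with $(u^\epsilon,v_F^\epsilon+v_S^\epsilon)\in C^1([0,T];X\times Y)\cap C([0,T];X_1\times Y_1)$. **The maps $h^{\epsilon,\zeta}$.** Let $\eta:=\zeta^{-1}\omega_A+\frac{N_S^\zeta+N_F^\zeta}{2}$ and let $C_\eta$ be the space of all $(u,v_F,v_S)\in C((-\infty,0];X_1\times(Y_F^\zeta\cap Y_1)\times(Y_S^\zeta\cap Y_1))$ with $\sup_{t\le0}e^{-\eta t}(\|u(t)\|_{X_1}+\|v_F(t)\|_{Y_1}+\|v_S(t)\|_{Y_1})<\infty$. For $v_0\in Y_S^\zeta\cap Y_1$ let $(u^{v_0},v_F^{v_0},v_S^{v_0})\in C_\eta$ be the unique fixed point of the operator $\mathscr L_{v_0,\epsilon,\zeta}$ on $C_\eta$ sending $(u,v_F,v_S)$ to the function whose components at $t\le0$ are $\epsilon^{-1}\int_{-\infty}^te^{\epsilon^{-1}(t-s)A}f(u(s),v_F(s),v_S(s))\,ds$,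 $\int_{-\infty}^te^{(t-s)B}\operatorname{pr}_{Y_F^\zeta}g(u(s),v_F(s),v_S(s))\,ds$, $e^{tB}v_0+\int_0^te^{(t-s)B}\operatorname{pr}_{Y_S^\zeta}g(u(s),v_F(s),v_S(s))\,ds$. Then $h^{\epsilon,\zeta}=(h^{\epsilon,\zeta}_{X_1},h^{\epsilon,\zeta}_{Y_F^\zeta})\colon Y_S^\zeta\cap Y_1\to X_1\times(Y_F^\zeta\cap Y_1)$, $h^{\epsilon,\zeta}(v_0):=(u^{v_0}(0),v_F^{v_0}(0))$. The slow manifold is $S_{\epsilon,\zeta}=\{(h^{\epsilon,\zeta}(v_0),v_0):v_0\in Y_S^\zeta\cap Y_1\}$.
   Formalization: Two conditions are added, without which the claim fails or h is undefined: "ζ small enough" includes η = ζ^{-1}ω_A + (N_S+N_F)/2 < 0, and L_g is also a Lipschitz constant of pr_{Y_F}g from X_1×Y_F×Y_S (Y_1 norms) into Y_{δ_Y}. *)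

theory Defs
  imports "HOL-Analysis.Analysis"
begin

text \<open>
  Banach spaces are real. \<^typ>\<open>'x\<close> and \<^typ>\<open>'y\<close> are the base spaces \<open>X\<close>, \<open>Y\<close>. Every other space of a scale
  is a linear subspace of a type with a norm of its own.
\<close>

subsection \<open>Normed subspaces of a vector space\<close>

record 'a nspace =
  carr :: "'a set"
  nrm :: "'a \<Rightarrow> real"

text \<open>The case distinction serves the locale \<^locale>\<open>Metric_space\<close>, whose distance is total.\<close>

definition ndist :: "'a::real_vector nspace \<Rightarrow> 'a \<Rightarrow> 'a \<Rightarrow> real" where
  "ndist Z x y = (if x \<in> carr Z \<and> y \<in> carr Z then nrm Z (x - y) else 0)"

definition ntop :: "'a::real_vector nspace \<Rightarrow> 'a topology" where
  "ntop Z = Metric_space.mtopology (carr Z) (ndist Z)"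

definition banach_space :: "'a::real_vector nspace \<Rightarrow> bool" where
  "banach_space Z \<longleftrightarrow>
     subspace (carr Z) \<and>
     (\<forall>x\<in>carr Z. 0 \<le> nrm Z x \<and> (nrm Z x = 0 \<longleftrightarrow> x = 0)) \<and>
     (\<forall>x\<in>carr Z. \<forall>c. nrm Z (c *\<^sub>R x) = \<bar>c\<bar> * nrm Z x) \<and>
     (\<forall>x\<in>carr Z. \<forall>y\<in>carr Z. nrm Z (x + y) \<le> nrm Z x + nrm Z y) \<and>
     Metric_space.mcomplete (carr Z) (ndist Z)"

definition whole :: "'a::real_normed_vector nspace" where
  "whole = \<lparr>carr = UNIV, nrm = norm\<rparr>"

definition nsub :: "'a nspace \<Rightarrow> 'a set \<Rightarrow> 'a nspace" where
  "nsub Z F = \<lparr>carr = F \<inter> carr Z, nrm = nrm Z\<rparr>"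

definition nprod :: "'a nspace \<Rightarrow> 'b nspace \<Rightarrow> ('a \<times> 'b) nspace" (infixr "\<times>\<^sub>n" 80) where
  "Z \<times>\<^sub>n W = \<lparr>carr = carr Z \<times> carr W, nrm = (\<lambda>(z, w). nrm Z z + nrm W w)\<rparr>"

definition npull :: "('a \<Rightarrow> 'b) \<Rightarrow> 'b nspace \<Rightarrow> 'a nspace" where
  "npull j Z = \<lparr>carr = j -` carr Z, nrm = (\<lambda>z. nrm Z (j z))\<rparr>"

definition op_bound :: "'a nspace \<Rightarrow> 'b nspace \<Rightarrow> ('a \<Rightarrow> 'b) \<Rightarrow> real \<Rightarrow> bool" where
  "op_bound Z W T K \<longleftrightarrow> (\<forall>z\<in>carr Z. T z \<in> carr W \<and> nrm W (T z) \<le> K * nrm Z z)"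

definition op_norm :: "'a nspace \<Rightarrow> 'b nspace \<Rightarrow> ('a \<Rightarrow> 'b) \<Rightarrow> real" where
  "op_norm Z W T = (SUP z\<in>carr Z. nrm W (T z) / nrm Z z)"

definition linear_between :: "'a::real_vector nspace \<Rightarrow> ('a \<Rightarrow> 'b::real_vector) \<Rightarrow> bool" where
  "linear_between Z T \<longleftrightarrow>
     (\<forall>x\<in>carr Z. \<forall>y\<in>carr Z. \<forall>a b. T (a *\<^sub>R x + b *\<^sub>R y) = a *\<^sub>R T x + b *\<^sub>R T y)"

definition embedded :: "'a nspace \<Rightarrow> 'a nspace \<Rightarrow> bool" where
  "embedded Z W \<longleftrightarrow> (\<exists>K. op_bound Z W (\<lambda>z. z) K)"

definition equivalent_spaces :: "'a nspace \<Rightarrow> 'a nspace \<Rightarrow> bool" where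
  "equivalent_spaces Z W \<longleftrightarrow> embedded Z W \<and> embedded W Z"

definition densely_embedded :: "'a::real_vector nspace \<Rightarrow> 'a nspace \<Rightarrow> bool" where
  "densely_embedded Z W \<longleftrightarrow> embedded Z W \<and> ntop W closure_of carr Z = carr W"

subsection \<open>Exact interpolation functors\<close>

text \<open>
  The category of Banach couples is the one of couples inside a given Banach space \<^typ>\<open>'e\<close>; all couples
  of neighbouring spaces of a scale lie in its largest space. A morphism is a linear map on the sum of a
  couple; it extends to a linear map on all of \<^typ>\<open>'e\<close>, so quantifying over \<^const>\<open>linear\<close> maps is no
  restriction.
\<close>

definition banach_couple :: "'e::banach nspace \<Rightarrow> 'e nspace \<Rightarrow> bool" where
  "banach_couple Z0 Z1 \<longleftrightarrow>
     banach_space Z0 \<and> banach_space Z1 \<and> embedded Z0 whole \<and> embedded Z1 whole"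

definition couple_inter :: "'e nspace \<Rightarrow> 'e nspace \<Rightarrow> 'e nspace" where
  "couple_inter Z0 Z1 =
     \<lparr>carr = carr Z0 \<inter> carr Z1, nrm = (\<lambda>z. max (nrm Z0 z) (nrm Z1 z))\<rparr>"

definition couple_sum :: "'e::real_vector nspace \<Rightarrow> 'e nspace \<Rightarrow> 'e nspace" where
  "couple_sum Z0 Z1 =
     \<lparr>carr = {a + b |a b. a \<in> carr Z0 \<and> b \<in> carr Z1},
      nrm = (\<lambda>z. Inf {nrm Z0 a + nrm Z1 b |a b. a \<in> carr Z0 \<and> b \<in> carr Z1 \<and> z = a + b})\<rparr>"

text \<open>A common bound \<open>K\<close> for both endpoints expresses \<open>\<parallel>T\<parallel> \<le> max \<parallel>T\<parallel>\<^sub>0 \<parallel>T\<parallel>\<^sub>1\<close>.\<close>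

definition exact_interpolation_functor :: "('e::banach nspace \<Rightarrow> 'e nspace \<Rightarrow> 'e nspace) \<Rightarrow> bool" where
  "exact_interpolation_functor \<Phi> \<longleftrightarrow>
     (\<forall>Z0 Z1. banach_couple Z0 Z1 \<longrightarrow>
        banach_space (\<Phi> Z0 Z1) \<and>
        embedded (couple_inter Z0 Z1) (\<Phi> Z0 Z1) \<and> embedded (\<Phi> Z0 Z1) (couple_sum Z0 Z1)) \<and>
     (\<forall>Z0 Z1 W0 W1 T K. banach_couple Z0 Z1 \<and> banach_couple W0 W1 \<and> linear T \<and> 0 \<le> K \<and>
        op_bound Z0 W0 T K \<and> op_bound Z1 W1 T K \<longrightarrow> op_bound (\<Phi> Z0 Z1) (\<Phi> W0 W1) T K)"

definition density_preserving :: "('e::banach nspace \<Rightarrow> 'e nspace \<Rightarrow> 'e nspace) \<Rightarrow> bool" where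
  "density_preserving \<Phi> \<longleftrightarrow>
     (\<forall>Z0 Z1. banach_couple Z0 Z1 \<and> densely_embedded Z1 Z0 \<longrightarrow> densely_embedded Z1 (\<Phi> Z0 Z1))"

subsection \<open>Unbounded operators and semigroups\<close>

text \<open>An unbounded operator is a domain together with a function that matters on the domain only.\<close>

definition closed_operator :: "'a::real_normed_vector set \<Rightarrow> ('a \<Rightarrow> 'a) \<Rightarrow> bool" where
  "closed_operator D S \<longleftrightarrow>
     subspace D \<and> linear_between \<lparr>carr = D, nrm = norm\<rparr> S \<and> closed {(x, S x) |x. x \<in> D}"

definition in_resolvent_set :: "'a::real_normed_vector set \<Rightarrow> 'a set \<Rightarrow> ('a \<Rightarrow> 'a) \<Rightarrow> real \<Rightarrow> bool" where
  "in_resolvent_set V D S \<mu> \<longleftrightarrow>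
     bij_betw (\<lambda>x. S x - \<mu> *\<^sub>R x) D V \<and> (\<exists>K. \<forall>x\<in>D. norm x \<le> K * norm (S x - \<mu> *\<^sub>R x))"

text \<open>Domain of the part (realization) of an operator in a subspace.\<close>

definition part_dom :: "'a set \<Rightarrow> 'a set \<Rightarrow> ('a \<Rightarrow> 'a) \<Rightarrow> 'a set" where
  "part_dom V D S = {v \<in> V \<inter> D. S v \<in> V}"

definition generates_semigroup ::
  "'a::real_normed_vector set \<Rightarrow> ('a \<Rightarrow> 'a) \<Rightarrow> (real \<Rightarrow> 'a \<Rightarrow> 'a) \<Rightarrow> bool" where
  "generates_semigroup D S T \<longleftrightarrow>
     (\<forall>t\<ge>0. bounded_linear (T t)) \<and> (\<forall>x. T 0 x = x) \<and>
     (\<forall>s\<ge>0. \<forall>t\<ge>0. \<forall>x. T (s + t) x = T s (T t x)) \<and>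
     (\<forall>x. ((\<lambda>t. T t x) \<longlongrightarrow> x) (at_right 0)) \<and>
     (\<forall>x y. x \<in> D \<and> S x = y \<longleftrightarrow> ((\<lambda>t. (T t x - x) /\<^sub>R t) \<longlongrightarrow> y) (at_right 0))"

definition generates_group_on ::
  "'a::real_normed_vector set \<Rightarrow> 'a set \<Rightarrow> ('a \<Rightarrow> 'a) \<Rightarrow> (real \<Rightarrow> 'a \<Rightarrow> 'a) \<Rightarrow> bool" where
  "generates_group_on V D S T \<longleftrightarrow>
     (\<forall>t. linear_between (nsub whole V) (T t) \<and> (\<exists>K. op_bound (nsub whole V) (nsub whole V) (T t) K)) \<and>
     (\<forall>x\<in>V. T 0 x = x) \<and> (\<forall>s t. \<forall>x\<in>V. T (s + t) x = T s (T t x)) \<and>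
     (\<forall>x\<in>V. ((\<lambda>t. T t x) \<longlongrightarrow> x) (at 0)) \<and>
     (\<forall>x\<in>V. \<forall>y\<in>V. x \<in> D \<and> S x = y \<longleftrightarrow> ((\<lambda>t. (T t x - x) /\<^sub>R t) \<longlongrightarrow> y) (at 0))"

definition exponentially_stable :: "(real \<Rightarrow> 'a::real_normed_vector \<Rightarrow> 'a) \<Rightarrow> bool" where
  "exponentially_stable T \<longleftrightarrow> (\<exists>K. \<exists>\<omega><0. \<forall>t\<ge>0. \<forall>x. norm (T t x) \<le> K * exp (\<omega> * t) * norm x)"

text \<open>
  The complexification of \<^typ>\<open>'a\<close> is \<^typ>\<open>'a \<times> 'a\<close>, the pair \<open>(x, y)\<close> standing for \<open>x + iy\<close>.
\<close>

definition cscale :: "complex \<Rightarrow> 'a::real_vector \<times> 'a \<Rightarrow> 'a \<times> 'a" where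
  "cscale c p = (Re c *\<^sub>R fst p - Im c *\<^sub>R snd p, Im c *\<^sub>R fst p + Re c *\<^sub>R snd p)"

definition sector :: "real \<Rightarrow> complex set" where
  "sector \<theta> = {z. z \<noteq> 0 \<and> \<bar>Arg z\<bar> < \<theta>}"

definition holomorphic_semigroup :: "(real \<Rightarrow> 'a::real_normed_vector \<Rightarrow> 'a) \<Rightarrow> bool" where
  "holomorphic_semigroup T \<longleftrightarrow>
     (\<exists>\<theta>>0. \<theta> \<le> pi / 2 \<and> (\<exists>H :: complex \<Rightarrow> 'a \<times> 'a \<Rightarrow> 'a \<times> 'a.
        (\<forall>z\<in>sector \<theta>. bounded_linear (H z) \<and> (\<forall>c p. H z (cscale c p) = cscale c (H z p))) \<and>
        (\<forall>t>0. \<forall>x y. H (complex_of_real t) (x, y) = (T t x, T t y)) \<and>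
        (\<forall>z\<in>sector \<theta>. \<forall>w\<in>sector \<theta>. \<forall>p. H (z + w) p = H z (H w p)) \<and>
        (\<forall>p. \<forall>z\<in>sector \<theta>. \<exists>d. ((\<lambda>z. H z p) has_derivative (\<lambda>h. cscale h d)) (at z)) \<and>
        (\<forall>\<theta>'. 0 < \<theta>' \<and> \<theta>' < \<theta> \<longrightarrow> (\<forall>p. ((\<lambda>z. H z p) \<longlongrightarrow> p) (at 0 within sector \<theta>')))))"

subsection \<open>Interpolation-extrapolation scales\<close>

primrec power_dom :: "'a set \<Rightarrow> ('a \<Rightarrow> 'a) \<Rightarrow> nat \<Rightarrow> 'a set" where
  "power_dom D S 0 = UNIV"
| "power_dom D S (Suc k) = {x \<in> D. S x \<in> power_dom D S k}"

text \<open>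
  \<^typ>\<open>'e\<close> is \<open>Z\<^bsub>-1\<^esub>\<close>, a completion of \<^typ>\<open>'z\<close> for the norm \<open>\<parallel>S\<^sup>-\<^sup>1 z\<parallel>\<close>, and \<open>j\<close> is the embedding of
  \<^typ>\<open>'z\<close>; it is injective by the norm condition.
\<close>

definition extrapolation_space ::
  "'z::banach set \<Rightarrow> ('z \<Rightarrow> 'z) \<Rightarrow> ('z \<Rightarrow> 'e::banach) \<Rightarrow> bool" where
  "extrapolation_space D S j \<longleftrightarrow>
     linear j \<and> (\<forall>z. norm (j z) = norm (the_inv_into D S z)) \<and> closure (range j) = UNIV"

definition integer_level :: "'z::banach set \<Rightarrow> ('z \<Rightarrow> 'z) \<Rightarrow> ('z \<Rightarrow> 'e::banach) \<Rightarrow> int \<Rightarrow> 'e nspace" where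
  "integer_level D S j k =
     (if k < 0 then whole
      else \<lparr>carr = j ` power_dom D S (nat k), nrm = (\<lambda>z. norm ((S ^^ nat k) (inv j z)))\<rparr>)"

definition generated_level ::
  "'z::banach set \<Rightarrow> ('z \<Rightarrow> 'z) \<Rightarrow> ('z \<Rightarrow> 'e::banach) \<Rightarrow>
   (real \<Rightarrow> 'e nspace \<Rightarrow> 'e nspace \<Rightarrow> 'e nspace) \<Rightarrow> real \<Rightarrow> 'e nspace" where
  "generated_level D S j \<Phi> \<alpha> =
     (if \<alpha> \<in> \<int> then integer_level D S j \<lfloor>\<alpha>\<rfloor>
      else \<Phi> (frac \<alpha>) (integer_level D S j \<lfloor>\<alpha>\<rfloor>) (integer_level D S j (\<lfloor>\<alpha>\<rfloor> + 1)))"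

definition interp_extrap_scale ::
  "'z::banach set \<Rightarrow> ('z \<Rightarrow> 'z) \<Rightarrow> ('z \<Rightarrow> 'e::banach) \<Rightarrow> (real \<Rightarrow> 'e nspace) \<Rightarrow> bool" where
  "interp_extrap_scale D S j Z \<longleftrightarrow>
     closed_operator D S \<and> closure D = UNIV \<and> in_resolvent_set UNIV D S 0 \<and>
     extrapolation_space D S j \<and>
     (\<exists>\<Phi>. (\<forall>\<theta>. 0 < \<theta> \<and> \<theta> < 1 \<longrightarrow>
             exact_interpolation_functor (\<Phi> \<theta>) \<and> density_preserving (\<Phi> \<theta>)) \<and>
          (\<forall>\<alpha>\<ge>-1. banach_space (Z \<alpha>) \<and> equivalent_spaces (Z \<alpha>) (generated_level D S j \<Phi> \<alpha>)))"

record ('z, 'e) scaled_semigroup =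
  opdom :: "'z set"
  oper :: "'z \<Rightarrow> 'z"
  semi :: "real \<Rightarrow> 'z \<Rightarrow> 'z"
  emb :: "'z \<Rightarrow> 'e"
  tower :: "real \<Rightarrow> 'e nspace"

text \<open>\<open>lev X \<alpha>\<close> is \<open>X\<^sub>\<alpha>\<close> as a subspace of \<open>X\<close> (for \<open>\<alpha> \<ge> 0\<close>); \<open>tower X \<alpha>\<close> is its copy in \<open>X\<^bsub>-1\<^esub>\<close>.\<close>

definition lev :: "('z, 'e) scaled_semigroup \<Rightarrow> real \<Rightarrow> 'z nspace" where
  "lev X \<alpha> = npull (emb X) (tower X \<alpha>)"

definition op_inverse :: "('z, 'e) scaled_semigroup \<Rightarrow> 'z \<Rightarrow> 'z" where
  "op_inverse X = the_inv_into (opdom X) (oper X)"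

text \<open>The extension of \<open>A\<^sup>-\<^sup>1\<close> to \<open>X\<^bsub>-1\<^esub> \<rightarrow> X\<^sub>0\<close>.\<close>

definition extended_inverse :: "('z::banach, 'e::banach) scaled_semigroup \<Rightarrow> 'e \<Rightarrow> 'z" where
  "extended_inverse X = (THE R. bounded_linear R \<and> (\<forall>x. R (emb X x) = op_inverse X x))"

subsection \<open>Curves and differentiable maps\<close>

definition C0_curve :: "'a::real_vector nspace \<Rightarrow> real \<Rightarrow> (real \<Rightarrow> 'a) \<Rightarrow> bool" where
  "C0_curve Z t u \<longleftrightarrow> continuous_map (top_of_set {0..t}) (ntop Z) u"

definition has_curve_deriv ::
  "'a::real_vector nspace \<Rightarrow> real \<Rightarrow> (real \<Rightarrow> 'a) \<Rightarrow> real \<Rightarrow> 'a \<Rightarrow> bool" where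
  "has_curve_deriv Z t u s d \<longleftrightarrow>
     limitin (ntop Z) (\<lambda>r. (u r - u s) /\<^sub>R (r - s)) d (at s within {0..t})"

definition C1_curve :: "'a::real_vector nspace \<Rightarrow> real \<Rightarrow> (real \<Rightarrow> 'a) \<Rightarrow> bool" where
  "C1_curve Z t u \<longleftrightarrow>
     C0_curve Z t u \<and> (\<exists>u'. C0_curve Z t u' \<and> (\<forall>s\<in>{0..t}. has_curve_deriv Z t u s (u' s)))"

definition C1_norm :: "'a::real_vector nspace \<Rightarrow> real \<Rightarrow> (real \<Rightarrow> 'a) \<Rightarrow> real" where
  "C1_norm Z t u =
     (SUP s\<in>{0..t}. nrm Z (u s)) + (SUP s\<in>{0..t}. nrm Z (THE d. has_curve_deriv Z t u s d))"

definition C1_map ::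
  "'a::real_vector nspace \<Rightarrow> 'b::real_vector nspace \<Rightarrow> ('a \<Rightarrow> 'b) \<Rightarrow> ('a \<Rightarrow> 'a \<Rightarrow> 'b) \<Rightarrow> bool" where
  "C1_map Z W F DF \<longleftrightarrow>
     (\<forall>z\<in>carr Z. F z \<in> carr W) \<and>
     (\<forall>z\<in>carr Z. linear_between Z (DF z) \<and> (\<exists>K. op_bound Z W (DF z) K)) \<and>
     (\<forall>z\<in>carr Z. \<forall>e>0. \<exists>d>0. \<forall>h\<in>carr Z. nrm Z h < d \<longrightarrow>
        nrm W (F (z + h) - F z - DF z h) \<le> e * nrm Z h) \<and>
     (\<forall>z\<in>carr Z. \<forall>e>0. \<exists>d>0. \<forall>w\<in>carr Z. nrm Z (w - z) < d \<longrightarrow>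
        op_bound Z W (\<lambda>h. DF w h - DF z h) e)"

subsection \<open>The fast-slow system\<close>

locale fast_slow =
  fixes X :: "('x::banach, 'xm::banach) scaled_semigroup"
    and Y :: "('y::banach, 'ym::banach) scaled_semigroup"
    and \<gamma>X \<delta>X \<delta>Y :: real
    and f :: "'x \<times> 'y \<Rightarrow> 'x" and g :: "'x \<times> 'y \<Rightarrow> 'y"
    and Lf Lg MA CA MB CB \<omega>A \<omega>B \<omega>f :: real
  assumes A_closed: "closed_operator (opdom X) (oper X)"
    and A_generates: "generates_semigroup (opdom X) (oper X) (semi X)"
    and A_stable: "exponentially_stable (semi X)"
    and B_closed: "closed_operator (opdom Y) (oper Y)"
    and B_generates: "generates_semigroup (opdom Y) (oper Y) (semi Y)"
    and X_scale: "interp_extrap_scale (opdom X) (oper X) (emb X) (tower X)"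
    and Y_scale: "\<exists>\<mu>. in_resolvent_set UNIV (opdom Y) (oper Y) \<mu> \<and>
        (in_resolvent_set UNIV (opdom Y) (oper Y) 0 \<longrightarrow> \<mu> = 0) \<and>
        interp_extrap_scale (opdom Y) (\<lambda>y. oper Y y - \<mu> *\<^sub>R y) (emb Y) (tower Y)"
    and \<gamma>X: "0 < \<gamma>X" "\<gamma>X \<le> 1" "\<not> holomorphic_semigroup (semi X) \<Longrightarrow> \<gamma>X = 1"
    and \<delta>X: "1 - \<gamma>X \<le> \<delta>X" "\<delta>X \<le> 1"
    and \<delta>Y: "0 < \<delta>Y" "\<delta>Y \<le> 1" "\<not> holomorphic_semigroup (semi Y) \<Longrightarrow> \<delta>Y = 1"
    and f_continuous: "continuous_map (ntop (lev X \<delta>X \<times>\<^sub>n lev Y (1 - \<delta>X))) (ntop whole) f"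
    and g_continuous: "continuous_map (ntop (lev X 1 \<times>\<^sub>n lev Y 1)) (ntop (lev Y \<delta>Y)) g"
    and f_zero: "f (0, 0) = 0"
    and g_zero: "g (0, 0) = 0"
    and f_range: "\<And>p. p \<in> carr (lev X 1 \<times>\<^sub>n lev Y 1) \<Longrightarrow> f p \<in> carr (lev X \<gamma>X)"
    and g_range: "\<And>p. p \<in> carr (lev X 1 \<times>\<^sub>n lev Y 1) \<Longrightarrow> g p \<in> carr (lev Y \<delta>Y)"
    and f_C1: "\<And>t u v. 0 < t \<Longrightarrow> C1_curve (lev X \<delta>X) t u \<Longrightarrow> C1_curve whole t v \<Longrightarrow>
        C0_curve (lev Y (1 - \<delta>X)) t v \<Longrightarrow>
        C1_curve (tower X (\<delta>X - 1)) t (\<lambda>s. emb X (f (u s, v s)))"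
    and Lf_pos: "0 < Lf" and Lg_pos: "0 < Lg"
    and f_Lipschitz: "\<And>p q. p \<in> carr (lev X 1 \<times>\<^sub>n lev Y 1) \<Longrightarrow> q \<in> carr (lev X 1 \<times>\<^sub>n lev Y 1) \<Longrightarrow>
        nrm (lev X \<gamma>X) (f p - f q) \<le> Lf * nrm (lev X 1 \<times>\<^sub>n lev Y 1) (p - q)"
    and f_C1_Lipschitz: "\<And>t u1 u2 v1 v2. 0 < t \<Longrightarrow>
        C1_curve (lev X \<delta>X) t u1 \<Longrightarrow> C1_curve whole t v1 \<Longrightarrow> C0_curve (lev Y (1 - \<delta>X)) t v1 \<Longrightarrow>
        C1_curve (lev X \<delta>X) t u2 \<Longrightarrow> C1_curve whole t v2 \<Longrightarrow> C0_curve (lev Y (1 - \<delta>X)) t v2 \<Longrightarrow>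
        C1_norm (tower X (\<delta>X - 1)) t (\<lambda>s. emb X (f (u1 s, v1 s) - f (u2 s, v2 s)))
          \<le> Lf * (C1_norm (lev X \<delta>X) t (\<lambda>s. u1 s - u2 s) + C1_norm whole t (\<lambda>s. v1 s - v2 s))"
    and g_Lipschitz: "\<And>p q. p \<in> carr (lev X 1 \<times>\<^sub>n lev Y 1) \<Longrightarrow> q \<in> carr (lev X 1 \<times>\<^sub>n lev Y 1) \<Longrightarrow>
        nrm (lev Y \<delta>Y) (g p - g q) \<le> Lg * nrm (lev X 1 \<times>\<^sub>n lev Y 1) (p - q)"
    and constants_pos: "0 < MA" "0 < CA" "0 < MB" "0 < CB" and \<omega>A_neg: "\<omega>A < 0"
    and A_bound: "\<And>t. 0 < t \<Longrightarrow> op_bound (lev X 1) (lev X 1) (semi X t) (MA * exp (\<omega>A * t))"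
    and A_smoothing_\<gamma>: "\<And>t. 0 < t \<Longrightarrow>
        op_bound (lev X \<gamma>X) (lev X 1) (semi X t) (CA * t powr (\<gamma>X - 1) * exp (\<omega>A * t))"
    and A_smoothing_\<delta>: "\<And>t. 0 < t \<Longrightarrow>
        op_bound (lev X \<delta>X) (lev X 1) (semi X t) (CA * t powr (\<delta>X - 1) * exp (\<omega>A * t))"
    and B_bound: "\<And>t. 0 < t \<Longrightarrow> op_bound (lev Y 1) (lev Y 1) (semi Y t) (MB * exp (\<omega>B * t))"
    and B_smoothing: "\<And>t. 0 < t \<Longrightarrow>
        op_bound (lev Y \<delta>Y) (lev Y 1) (semi Y t) (CB * t powr (\<delta>Y - 1) * exp (\<omega>B * t))"
    and \<omega>f_holomorphic: "\<gamma>X < 1 \<Longrightarrow>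
        \<omega>f = \<omega>A + (2 * CA * Lf) powr (1 / \<gamma>X) * (1 / \<gamma>X) powr ((1 - \<gamma>X) / \<gamma>X)"
    and \<omega>f_general: "\<gamma>X = 1 \<Longrightarrow> \<omega>f > \<omega>A + CA * Lf"
    and \<omega>f_neg: "\<omega>f < 0"
    and Lf_small: "Lf * max (op_norm (lev X \<gamma>X) (lev X 1) (op_inverse X))
        (op_norm (tower X (\<delta>X - 1)) (lev X \<delta>X) (extended_inverse X)) < 1"

subsection \<open>Splitting of the slow variable space\<close>

text \<open>Projection onto \<open>F\<close> along \<open>S\<close>.\<close>

definition proj :: "'a::ab_group_add set \<Rightarrow> 'a set \<Rightarrow> 'a \<Rightarrow> 'a" where
  "proj F S y = (THE a. a \<in> F \<and> y - a \<in> S)"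

definition split_space ::
  "('x, 'xm) scaled_semigroup \<Rightarrow> ('y, 'ym) scaled_semigroup \<Rightarrow> 'y set \<Rightarrow> 'y set \<Rightarrow> ('x \<times> 'y \<times> 'y) nspace" where
  "split_space X Y F S = lev X 1 \<times>\<^sub>n nsub (lev Y 1) F \<times>\<^sub>n nsub (lev Y 1) S"

definition joined :: "('x \<times> 'y::plus \<times> 'y \<Rightarrow> 'x \<times> 'y)" where
  "joined = (\<lambda>(x, yF, yS). (x, yF + yS))"

text \<open>The semigroup on \<open>S\<close> continued to negative times by inverses.\<close>

definition slow_group :: "('y, 'ym) scaled_semigroup \<Rightarrow> 'y set \<Rightarrow> real \<Rightarrow> 'y \<Rightarrow> 'y" where
  "slow_group Y S t = (if 0 \<le> t then semi Y t else the_inv_into S (semi Y (- t)))"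

text \<open>
  \<open>CF\<close> and \<open>Ms\<close> are the constants \<open>C\<^sub>B\<close> and \<open>M\<^sub>B\<close> of the splitting. They are not assumed to
  agree with the constants \<open>CB\<close> and \<open>MB\<close> of \<^locale>\<open>fast_slow\<close>.
\<close>

locale slow_splitting =
  fixes X :: "('x::banach, 'xm::banach) scaled_semigroup"
    and Y :: "('y::banach, 'ym::banach) scaled_semigroup"
    and \<delta>Y :: real and g :: "'x \<times> 'y \<Rightarrow> 'y"
    and Lg \<omega>A CF Ms \<zeta> :: real
    and F S :: "'y set"
    and NF NS :: real
  assumes subspaces: "subspace F" "subspace S" "closed F" "closed S"
    and direct_sum: "\<And>y. \<exists>!a. a \<in> F \<and> y - a \<in> S"
    and commute_F: "\<And>y. y \<in> opdom Y \<Longrightarrow>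
        proj F S y \<in> opdom Y \<and> oper Y (proj F S y) = proj F S (oper Y y)"
    and commute_S: "\<And>y. y \<in> opdom Y \<Longrightarrow>
        proj S F y \<in> opdom Y \<and> oper Y (proj S F y) = proj S F (oper Y y)"
    and closed_in_Y1: "closedin (ntop (lev Y 1)) (F \<inter> carr (lev Y 1))"
        "closedin (ntop (lev Y 1)) (S \<inter> carr (lev Y 1))"
    and slow_Lipschitz: "\<And>p q. p \<in> carr (split_space X Y F S) \<Longrightarrow> q \<in> carr (split_space X Y F S) \<Longrightarrow>
        proj S F (g (joined p) - g (joined q)) \<in> carr (lev Y 1) \<and>
        nrm (lev Y 1) (proj S F (g (joined p) - g (joined q)))
          \<le> Lg * \<zeta> powr (\<delta>Y - 1) * nrm (split_space X Y F S) (p - q)"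
    and slow_generates: "generates_group_on S (part_dom S (opdom Y) (oper Y)) (oper Y) (slow_group Y S)"
    and fast_resolvent: "in_resolvent_set F (part_dom F (opdom Y) (oper Y)) (oper Y) 0"
    and exponents: "0 \<le> NF" "NF < NS"
    and fast_bound: "\<And>t. 0 < t \<Longrightarrow> op_bound (nsub (lev Y \<delta>Y) F) (lev Y 1) (semi Y t)
        (CF * t powr (\<delta>Y - 1) * exp ((NF + \<omega>A / \<zeta>) * t))"
    and slow_bound: "\<And>t. 0 \<le> t \<Longrightarrow> op_bound (nsub (lev Y 1) S) (lev Y 1) (slow_group Y S (- t))
        (Ms * exp (- (NS + \<omega>A / \<zeta>) * t))"

definition gap_condition ::
  "real \<Rightarrow> real \<Rightarrow> real \<Rightarrow> real \<Rightarrow> real \<Rightarrow> real \<Rightarrow> real \<Rightarrow> real \<Rightarrow> real \<Rightarrow> real \<Rightarrow> real \<Rightarrow> real \<Rightarrow> bool" where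
  "gap_condition \<gamma>X \<delta>Y Lf Lg CA CF Ms \<omega>A NF NS \<epsilon> \<zeta> \<longleftrightarrow>
     0 < 2 * (\<epsilon> / \<zeta> - 1) * \<omega>A + \<epsilon> * (NS + NF) \<and>
     2 powr \<gamma>X * Lf * CA * Gamma \<gamma>X / (2 * (\<epsilon> / \<zeta> - 1) * \<omega>A + \<epsilon> * (NS + NF)) powr \<gamma>X
     + 2 powr \<delta>Y * Lg * CF * Gamma \<delta>Y / (NS - NF) powr \<delta>Y
     + 2 * \<zeta> powr (\<delta>Y - 1) * Lg * Ms * Gamma \<delta>Y / (NS - NF) < 1"

definition eta :: "real \<Rightarrow> real \<Rightarrow> real \<Rightarrow> real \<Rightarrow> real" where
  "eta \<omega>A \<zeta> NF NS = \<omega>A / \<zeta> + (NS + NF) / 2"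

subsection \<open>The split system and its slow manifold\<close>

text \<open>Strict solution on \<open>[0, \<infinity>)\<close>, that is, on \<open>[0, T]\<close> for every \<open>T > 0\<close>.\<close>

definition strict_split_solution ::
  "('x::banach, 'xm) scaled_semigroup \<Rightarrow> ('y::banach, 'ym) scaled_semigroup \<Rightarrow>
   ('x \<times> 'y \<Rightarrow> 'x) \<Rightarrow> ('x \<times> 'y \<Rightarrow> 'y) \<Rightarrow> 'y set \<Rightarrow> 'y set \<Rightarrow> real \<Rightarrow>
   (real \<Rightarrow> 'x) \<Rightarrow> (real \<Rightarrow> 'y) \<Rightarrow> (real \<Rightarrow> 'y) \<Rightarrow> bool" where
  "strict_split_solution X Y f g F S \<epsilon> u vF vS \<longleftrightarrow>
     (\<forall>t\<ge>0. (u t, vF t, vS t) \<in> carr (split_space X Y F S)) \<and>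
     continuous_map (top_of_set {0..}) (ntop (lev X 1 \<times>\<^sub>n lev Y 1)) (\<lambda>t. (u t, vF t + vS t)) \<and>
     (\<exists>u' vF' vS'. continuous_on {0..} u' \<and> continuous_on {0..} vF' \<and> continuous_on {0..} vS' \<and>
       (\<forall>t\<ge>0.
         (u has_vector_derivative u' t) (at t within {0..}) \<and>
         (vF has_vector_derivative vF' t) (at t within {0..}) \<and>
         (vS has_vector_derivative vS' t) (at t within {0..}) \<and>
         \<epsilon> *\<^sub>R u' t = oper X (u t) + f (u t, vF t + vS t) \<and>
         vF' t = oper Y (vF t) + proj F S (g (u t, vF t + vS t)) \<and>
         vS' t = oper Y (vS t) + proj S F (g (u t, vF t + vS t))))"

text \<open>Functions on \<open>(-\<infinity>, 0]\<close> are \<^const>\<open>extensional\<close>, so that they are equal iff they agree there.\<close>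

definition C_eta ::
  "('x::banach, 'xm) scaled_semigroup \<Rightarrow> ('y::banach, 'ym) scaled_semigroup \<Rightarrow> 'y set \<Rightarrow> 'y set \<Rightarrow>
   real \<Rightarrow> (real \<Rightarrow> 'x \<times> 'y \<times> 'y) set" where
  "C_eta X Y F S \<eta> =
     {w \<in> extensional {..0}.
        continuous_map (top_of_set {..0}) (ntop (split_space X Y F S)) w \<and>
        bdd_above ((\<lambda>t. exp (- \<eta> * t) * nrm (split_space X Y F S) (w t)) ` {..0})}"

definition LP_operator ::
  "('x::banach, 'xm) scaled_semigroup \<Rightarrow> ('y::banach, 'ym) scaled_semigroup \<Rightarrow>
   ('x \<times> 'y \<Rightarrow> 'x) \<Rightarrow> ('x \<times> 'y \<Rightarrow> 'y) \<Rightarrow> 'y set \<Rightarrow> 'y set \<Rightarrow> real \<Rightarrow> 'y \<Rightarrow>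
   (real \<Rightarrow> 'x \<times> 'y \<times> 'y) \<Rightarrow> (real \<Rightarrow> 'x \<times> 'y \<times> 'y)" where
  "LP_operator X Y f g F S \<epsilon> v0 w =
     (\<lambda>t\<in>{..0}.
        ((1 / \<epsilon>) *\<^sub>R integral {..t} (\<lambda>s. semi X ((t - s) / \<epsilon>) (f (joined (w s)))),
         integral {..t} (\<lambda>s. semi Y (t - s) (proj F S (g (joined (w s))))),
         slow_group Y S t v0
           - integral {t..0} (\<lambda>s. slow_group Y S (t - s) (proj S F (g (joined (w s)))))))"

definition slow_orbit ::
  "('x::banach, 'xm) scaled_semigroup \<Rightarrow> ('y::banach, 'ym) scaled_semigroup \<Rightarrow>
   ('x \<times> 'y \<Rightarrow> 'x) \<Rightarrow> ('x \<times> 'y \<Rightarrow> 'y) \<Rightarrow> 'y set \<Rightarrow> 'y set \<Rightarrow> real \<Rightarrow> real \<Rightarrow> 'y \<Rightarrow>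
   (real \<Rightarrow> 'x \<times> 'y \<times> 'y)" where
  "slow_orbit X Y f g F S \<epsilon> \<eta> v0 =
     (THE w. w \<in> C_eta X Y F S \<eta> \<and> LP_operator X Y f g F S \<epsilon> v0 w = w)"

definition slow_map ::
  "('x::banach, 'xm) scaled_semigroup \<Rightarrow> ('y::banach, 'ym) scaled_semigroup \<Rightarrow>
   ('x \<times> 'y \<Rightarrow> 'x) \<Rightarrow> ('x \<times> 'y \<Rightarrow> 'y) \<Rightarrow> 'y set \<Rightarrow> 'y set \<Rightarrow> real \<Rightarrow> real \<Rightarrow> 'y \<Rightarrow> 'x \<times> 'y" where
  "slow_map X Y f g F S \<epsilon> \<eta> v0 =
     (case slow_orbit X Y f g F S \<epsilon> \<eta> v0 0 of (x, yF, yS) \<Rightarrow> (x, yF))"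

end

theory Submission
  imports Defs
begin

text \<open>
  The slow manifold consists of the values at time \<open>0\<close> of those orbits on \<open>(-\<infinity>, 0]\<close> that grow at most like
  \<open>exp (\<eta> * s)\<close> as \<open>s \<rightarrow> -\<infinity>\<close>. They are the fixed points of the Lyapunov-Perron operator, which is a contraction for
  the norm \<open>sup exp (- \<eta> * s) * nrm (w s)\<close>: its constant \<open>\<kappa>\<close> is at most the left-hand side of the gap condition
  (\<open>contraction_gap\<close>).

  To estimate the distance of a solution from the manifold at a time \<open>t \<ge> 0\<close>, let \<open>W\<close> be the solution on
  \<open>[0, t]\<close>, preceded on \<open>(-\<infinity>, 0)\<close> by the slow orbit through \<open>vS 0\<close>, and shift time so that \<open>W\<close> lives on
  \<open>(-\<infinity>, 0]\<close>. At \<open>-t\<close> the path \<open>W\<close> jumps by \<open>j = (u 0, vF 0) - h (vS 0)\<close> in its first two components, and its slow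
  component does not jump. By variation of constants (\<open>conv_jump\<close>, \<open>conv_backward\<close>), \<open>W\<close> satisfies the
  Lyapunov-Perron equation with end value \<open>vS t\<close> up to the term \<open>(e\<^bsup>(t + s)A/\<epsilon>\<^esup> jX, e\<^bsup>(t + s)B\<^esup> jF, 0)\<close> for \<open>s \<ge> -t\<close>,
  and exactly for \<open>s < -t\<close>. Up to constants, both semigroups decay at least as fast as \<open>exp (\<eta> * r)\<close> on the
  respective spaces, so this term is at most \<open>K * exp (\<eta> * t) * nrm j * exp (\<eta> * s)\<close> (\<open>X_decay\<close>, \<open>fast_decay\<close>). The slow orbit through \<open>vS t\<close>
  satisfies the same equation without error. A contraction turns the error \<open>K\<close> in the equation into a
  distance of at most \<open>K / (1 - \<kappa>)\<close> (\<open>weighted_contraction_perturbation\<close>), and at \<open>s = 0\<close> this is the claim with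
  \<open>C = K / (1 - \<kappa>)\<close> and \<open>c = - \<eta>\<close>.

  The gap condition controls \<open>\<kappa>\<close> in terms of the given norms of \<open>X\<^sub>1\<close> and \<open>Y\<^sub>1\<close>, which are only equivalent to
  graph norms. The integrals therefore have to be estimated in these norms (\<open>graph_integral\<close>). That the
  operator maps into paths with values in \<open>F\<close> rests on the invariance of \<open>F\<close> under the semigroup
  (\<open>PF_semi\<close>), for which the projection has to be bounded (\<open>bounded_linear_proj\<close>).
\<close>

section \<open>Henstock-Kurzweil integrals in Banach spaces\<close>

text \<open>
  The integrals of the Lyapunov-Perron operator take values in arbitrary Banach spaces, which need not
  be separable, so that the Bochner integral does not apply. This part collects what is needed about the
  Henstock-Kurzweil integral: affine substitutions, integrals with values in a closed convex cone, and
  integrability of a function that is continuous off a few points and dominated by an integrable one.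
\<close>

lemma has_integral_UNIV_iff:
  fixes f :: "'n::euclidean_space \<Rightarrow> 'a::banach"
  shows "(f has_integral y) UNIV \<longleftrightarrow> (\<forall>e>0. \<exists>B>0. \<forall>a b. ball 0 B \<subseteq> cbox a b \<longrightarrow>
    (\<exists>z. (f has_integral z) (cbox a b) \<and> norm (z - y) < e))"
proof -
  have noti: "\<not> (\<exists>a b. (UNIV::'n set) = cbox a b)"
    by (metis bounded_cbox not_bounded_UNIV)
  show ?thesis
    by (subst has_integral_alt) (simp only: noti if_False UNIV_I if_True)
qed

lemma has_integral_UNIV_box:
  fixes f :: "'n::euclidean_space \<Rightarrow> 'a::banach"
  assumes "(f has_integral y) UNIV" "0 < e"
  shows "\<exists>B>0. \<forall>a b. ball 0 B \<subseteq> cbox a b \<longrightarrow>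
    (\<exists>z. (f has_integral z) (cbox a b) \<and> norm (z - y) < e)"
  using assms unfolding has_integral_UNIV_iff by blast

lemma has_integral_affine_UNIV:
  fixes f :: "real \<Rightarrow> 'a::banach"
  assumes f: "(f has_integral y) UNIV" and m: "m \<noteq> 0"
  shows "((\<lambda>x. f (m * x + c)) has_integral (1 / \<bar>m\<bar>) *\<^sub>R y) UNIV"
proof -
  have "\<exists>B>0. \<forall>a b. ball 0 B \<subseteq> cbox a b \<longrightarrow>
      (\<exists>z. ((\<lambda>x. f (m * x + c)) has_integral z) (cbox a b) \<and> norm (z - (1 / \<bar>m\<bar>) *\<^sub>R y) < e)"
    if "e > 0" for e
  proof -
    have em: "e * \<bar>m\<bar> > 0" using that m by simp
    obtain B where B: "B > 0" "\<forall>a b. ball 0 B \<subseteq> cbox a b \<longrightarrow>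
        (\<exists>z. (f has_integral z) (cbox a b) \<and> norm (z - y) < e * \<bar>m\<bar>)"
      using has_integral_UNIV_box[OF f em] by blast
    show ?thesis
    proof (intro exI[of _ "(B + \<bar>c\<bar>) / \<bar>m\<bar>"] conjI allI impI)
      show "(B + \<bar>c\<bar>) / \<bar>m\<bar> > 0" using B m by (simp add: add_pos_nonneg)
      fix a b :: real assume ab: "ball 0 ((B + \<bar>c\<bar>) / \<bar>m\<bar>) \<subseteq> cbox a b"
      have ne: "cbox a b \<noteq> {}"
        by (metis ab centre_in_ball empty_iff subsetD \<open>(B + \<bar>c\<bar>) / \<bar>m\<bar> > 0\<close>)
      obtain u v where uv: "(\<lambda>x. m * x + c) ` cbox a b = cbox u v"
        using interval_image_affinity_interval[of m c a b] by auto
      have "ball 0 B \<subseteq> cbox u v"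
      proof
        fix x :: real assume x: "x \<in> ball 0 B"
        have "\<bar>(x - c) / m\<bar> < (B + \<bar>c\<bar>) / \<bar>m\<bar>"
          using x m by (simp add: abs_divide divide_strict_right_mono)
        then have "(x - c) / m \<in> ball 0 ((B + \<bar>c\<bar>) / \<bar>m\<bar>)" by (simp add: dist_norm)
        then have "(x - c) / m \<in> cbox a b" using ab by blast
        then show "x \<in> cbox u v" using m unfolding uv[symmetric]
          by (auto intro!: image_eqI[of _ _ "(x - c) / m"] simp: field_simps)
      qed
      then obtain z where z: "(f has_integral z) (cbox u v)" "norm (z - y) < e * \<bar>m\<bar>"
        using B(2) by blast
      have im: "(\<lambda>x. (1 / m) *\<^sub>R x + -((1 / m) *\<^sub>R c)) ` cbox u v = cbox a b"
        unfolding uv[symmetric] image_image using m by (simp add: field_simps)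
      have "((\<lambda>x. f (m * x + c)) has_integral (1 / \<bar>m\<bar>) *\<^sub>R z) (cbox a b)"
        using has_integral_affinity[OF z(1) m, of c] unfolding im by simp
      moreover have "norm ((1 / \<bar>m\<bar>) *\<^sub>R z - (1 / \<bar>m\<bar>) *\<^sub>R y) < e"
        using z(2) m unfolding scaleR_diff_right[symmetric] norm_scaleR by (simp add: field_simps)
      ultimately show "\<exists>z. ((\<lambda>x. f (m * x + c)) has_integral z) (cbox a b) \<and> norm (z - (1 / \<bar>m\<bar>) *\<^sub>R y) < e"
        by blast
    qed
  qed
  then show ?thesis
    unfolding has_integral_UNIV_iff by blast
qed

lemma has_integral_affine_vimage:
  fixes f :: "real \<Rightarrow> 'a::banach"
  assumes f: "(f has_integral y) T" and m: "m \<noteq> 0"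
  shows "((\<lambda>x. f (m * x + c)) has_integral (1 / \<bar>m\<bar>) *\<^sub>R y) ((\<lambda>x. m * x + c) -` T)"
proof -
  have "((\<lambda>x. if x \<in> T then f x else 0) has_integral y) UNIV"
    using f by (simp add: has_integral_restrict_UNIV)
  from has_integral_affine_UNIV[OF this m, of c]
  have "((\<lambda>x. if x \<in> (\<lambda>x. m * x + c) -` T then f (m * x + c) else 0) has_integral (1 / \<bar>m\<bar>) *\<^sub>R y) UNIV"
    by simp
  then show ?thesis unfolding has_integral_restrict_UNIV .
qed

lemma integral_translate:
  fixes f :: "real \<Rightarrow> 'a::banach"
  shows "integral ((\<lambda>x. x + c) -` T) (\<lambda>x. f (x + c)) = integral T f"
proof -
  have 1: "((\<lambda>x. f (x + c)) has_integral y) ((\<lambda>x. x + c) -` T)" if "(f has_integral y) T" for y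
    using has_integral_affine_vimage[OF that, of 1 c] by simp
  have 2: "(f has_integral y) T" if "((\<lambda>x. f (x + c)) has_integral y) ((\<lambda>x. x + c) -` T)" for y
    using has_integral_affine_vimage[OF that, of 1 "- c"] by (simp add: vimage_def)
  show ?thesis
  proof (cases "f integrable_on T")
    case True
    then show ?thesis using 1 by (metis integrable_integral integral_unique)
  next
    case False
    moreover have "\<not> (\<lambda>x. f (x + c)) integrable_on ((\<lambda>x. x + c) -` T)"
      using False 2 by (auto simp: integrable_on_def)
    ultimately show ?thesis by (simp add: not_integrable_integral)
  qed
qed

text \<open>
  Tagged sums are conic combinations of values, so the integral stays in a closed convex cone that
  contains all values. Both closed subspaces and, in a product with the reals, the epigraphs of continuous
  sublinear functionals are such cones; the latter gives the norm estimate for a norm that differs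
  from the norm of the type.
\<close>

lemma has_integral_closed_convex_cone:
  fixes f :: "'n::euclidean_space \<Rightarrow> 'a::banach"
  assumes f: "(f has_integral y) T" and C: "closed C" "0 \<in> C"
    and add: "\<And>x y. x \<in> C \<Longrightarrow> y \<in> C \<Longrightarrow> x + y \<in> C"
    and scale: "\<And>x c. x \<in> C \<Longrightarrow> 0 \<le> c \<Longrightarrow> c *\<^sub>R x \<in> C"
    and fC: "\<And>x. x \<in> T \<Longrightarrow> f x \<in> C"
  shows "y \<in> C"
proof -
  have box: "z \<in> C" if g: "(g has_integral z) (cbox a b)" and gC: "\<And>x. g x \<in> C" for g :: "'n \<Rightarrow> 'a" and z a b
  proof -
    have "\<exists>w\<in>C. dist w z < e" if "e > 0" for e
    proof -
      obtain \<gamma> where \<gamma>: "gauge \<gamma>" "\<And>\<D>. \<D> tagged_division_of cbox a b \<Longrightarrow> \<gamma> fine \<D> \<Longrightarrow>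
          norm ((\<Sum>(x,K)\<in>\<D>. measure lborel K *\<^sub>R g x) - z) < e"
        using g \<open>e > 0\<close> unfolding has_integral by meson
      obtain \<D> where D: "\<D> tagged_division_of cbox a b" "\<gamma> fine \<D>"
        using fine_division_exists[OF \<gamma>(1)] by blast
      have "(\<Sum>(x,K)\<in>\<D>'. measure lborel K *\<^sub>R g x) \<in> C" if "finite \<D>'" for \<D>'
        using that by induction (auto intro!: add scale gC C simp: split_def)
      then show ?thesis using \<gamma>(2)[OF D] D by (auto simp: dist_norm)
    qed
    then show ?thesis using closure_approachable[of z C] C(1) by (simp add: closure_closed)
  qed
  have g: "((\<lambda>x. if x \<in> T then f x else 0) has_integral y) UNIV"
    using f by (simp add: has_integral_restrict_UNIV)
  have gC: "(if x \<in> T then f x else 0) \<in> C" for x using fC C by auto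
  have "\<exists>w\<in>C. dist w y < e" if e: "e > 0" for e
  proof -
    obtain B where B: "B > 0" "\<forall>a b. ball 0 B \<subseteq> cbox a b \<longrightarrow>
        (\<exists>z. ((\<lambda>x. if x \<in> T then f x else 0) has_integral z) (cbox a b) \<and> norm (z - y) < e)"
      using has_integral_UNIV_box[OF g e] by blast
    obtain a b :: 'n where "ball 0 B \<subseteq> cbox a b"
      using bounded_subset_cbox_symmetric[OF bounded_ball, of 0 B] by blast
    then obtain z where z: "((\<lambda>x. if x \<in> T then f x else 0) has_integral z) (cbox a b)" "norm (z - y) < e"
      using B by blast
    then show ?thesis using box[OF z(1) gC] by (auto simp: dist_norm)
  qed
  then show ?thesis using closure_approachable[of y C] C(1) by (simp add: closure_closed)
qed

lemma has_integral_Pair':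
  fixes f :: "'n::euclidean_space \<Rightarrow> 'a::banach" and g :: "'n \<Rightarrow> 'b::banach"
  assumes "(f has_integral y) T" "(g has_integral z) T"
  shows "((\<lambda>x. (f x, g x)) has_integral (y, z)) T"
proof -
  have "((\<lambda>x. (x, 0)) \<circ> f has_integral (y, 0::'b)) T"
    by (rule has_integral_linear[OF assms(1)])
       (auto intro!: bounded_linear_Pair bounded_linear_ident bounded_linear_zero)
  moreover have "((\<lambda>x. (0, x)) \<circ> g has_integral (0::'a, z)) T"
    by (rule has_integral_linear[OF assms(2)])
       (auto intro!: bounded_linear_Pair bounded_linear_ident bounded_linear_zero)
  ultimately have "((\<lambda>x. (f x, 0) + (0, g x)) has_integral ((y, 0) + (0, z))) T"
    unfolding o_def by (rule has_integral_add)
  then show ?thesis by simp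
qed

lemma sublinear_integral_bound:
  fixes f :: "'n::euclidean_space \<Rightarrow> 'a::banach"
  assumes f: "(f has_integral y) T" and b: "(b has_integral z) T"
    and cont: "continuous_on UNIV \<phi>"
    and add: "\<And>x y. \<phi> (x + y) \<le> \<phi> x + \<phi> y" and scale: "\<And>c x. 0 \<le> c \<Longrightarrow> \<phi> (c *\<^sub>R x) = c * \<phi> x"
    and le: "\<And>x. x \<in> T \<Longrightarrow> \<phi> (f x) \<le> b x"
  shows "\<phi> y \<le> (z::real)"
proof -
  have "(y, z) \<in> {p. \<phi> (fst p) \<le> snd p}"
  proof (rule has_integral_closed_convex_cone[OF has_integral_Pair'[OF f b]])
    show "closed {p. \<phi> (fst p) \<le> snd p}"
      by (intro closed_Collect_le continuous_on_compose2[OF cont] continuous_on_fst continuous_on_snd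
          continuous_on_id) auto
    show "0 \<in> {p. \<phi> (fst p) \<le> snd p}" using scale[of 0 0] by simp
  qed (auto intro: order_trans[OF add] add_mono simp: scale le mult_left_mono)
  then show ?thesis by simp
qed

text \<open>
  A limit in the sense of \<open>L\<^sup>1\<close> of integrable functions is integrable. The error is measured by integrable
  real majorants, so that no measurability of the limit is needed.
\<close>

lemma integrable_L1_approx:
  fixes f :: "real \<Rightarrow> 'a::banach"
  assumes approx: "\<And>e. e > 0 \<Longrightarrow> \<exists>g b. g integrable_on UNIV \<and> b integrable_on UNIV \<and>
      (\<forall>x. norm (f x - g x) \<le> b x) \<and> integral UNIV b < e"
  shows "f integrable_on UNIV"
proof -
  let ?sum = "\<lambda>(\<D> :: (real \<times> real set) set) f. \<Sum>(x,K)\<in>\<D>. measure lborel K *\<^sub>R f x"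
  have tri: "norm (p - q) < e" if "norm (p - p') < e/4" "norm (q - q') < e/4" "norm (p' - q') < e/4" "0 < e"
    for p q p' q' :: 'a and e :: real
  proof -
    have "p - q = (p - p') + (p' - q') - (q - q')" by simp
    then have "norm (p - q) \<le> norm (p - p') + norm (p' - q') + norm (q - q')"
      using norm_triangle_ineq4[of "(p - p') + (p' - q')" "q - q'"] norm_triangle_ineq[of "p - p'" "p' - q'"] by simp
    then show ?thesis using that by linarith
  qed
  have box: "f integrable_on cbox a b" for a b
  proof (subst integrable_Cauchy, intro allI impI)
    fix e :: real assume "e > 0"
    then obtain g h where g: "g integrable_on UNIV" and h: "h integrable_on UNIV"
      and le: "\<And>x. norm (f x - g x) \<le> h x" and small: "integral UNIV h < e/8"
      using approx[of "e/8"] by auto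
    have h0: "0 \<le> h x" for x using le[of x] norm_ge_zero order_trans by blast
    have gi: "g integrable_on cbox a b" and hi: "h integrable_on cbox a b"
      using integrable_on_subcbox[OF g subset_UNIV] integrable_on_subcbox[OF h subset_UNIV] by blast+
    have hs: "integral (cbox a b) h < e/8"
      using integral_subset_le[OF _ hi h] h0 small by fastforce
    have "\<exists>\<gamma>. gauge \<gamma> \<and> (\<forall>\<D>1 \<D>2. \<D>1 tagged_division_of (cbox a b) \<and> \<gamma> fine \<D>1 \<and>
            \<D>2 tagged_division_of (cbox a b) \<and> \<gamma> fine \<D>2 \<longrightarrow>
            norm (?sum \<D>1 g - ?sum \<D>2 g) < e/4)"
      using gi[unfolded integrable_Cauchy, THEN spec, THEN mp, OF divide_pos_pos[OF \<open>e > 0\<close> zero_less_numeral]] .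
    then obtain \<gamma>1 where \<gamma>1: "gauge \<gamma>1 \<and> (\<forall>\<D>1 \<D>2. \<D>1 tagged_division_of (cbox a b) \<and> \<gamma>1 fine \<D>1 \<and>
            \<D>2 tagged_division_of (cbox a b) \<and> \<gamma>1 fine \<D>2 \<longrightarrow>
            norm (?sum \<D>1 g - ?sum \<D>2 g) < e/4)"
      by (rule exE)
    have "e/8 > 0" using \<open>e > 0\<close> by simp
    then obtain \<gamma>2 where \<gamma>2: "gauge \<gamma>2" "\<And>\<D>. \<D> tagged_division_of (cbox a b) \<Longrightarrow> \<gamma>2 fine \<D> \<Longrightarrow>
            norm (?sum \<D> h - integral (cbox a b) h) < e/8"
      using integrable_integral[OF hi] unfolding has_integral by meson
    have err: "norm (?sum \<D> f - ?sum \<D> g) < e/4"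
      if D: "\<D> tagged_division_of (cbox a b)" "\<gamma>2 fine \<D>" for \<D>
    proof -
      have "norm (?sum \<D> f - ?sum \<D> g)
          = norm (\<Sum>(x,K)\<in>\<D>. measure lborel K *\<^sub>R (f x - g x))"
        by (simp add: split_def scaleR_diff_right sum_subtractf)
      also have "\<dots> \<le> ?sum \<D> h"
        by (rule sum_norm_le) (auto simp: split_def intro!: mult_left_mono le)
      also have "\<dots> < e/4" using \<gamma>2(2)[OF D] hs unfolding real_norm_def by linarith
      finally show ?thesis .
    qed
    show "\<exists>\<gamma>. gauge \<gamma> \<and> (\<forall>\<D>1 \<D>2. \<D>1 tagged_division_of (cbox a b) \<and> \<gamma> fine \<D>1 \<and>
            \<D>2 tagged_division_of (cbox a b) \<and> \<gamma> fine \<D>2 \<longrightarrow>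
            norm (?sum \<D>1 f - ?sum \<D>2 f) < e)"
    proof (intro exI[of _ "\<lambda>x. \<gamma>1 x \<inter> \<gamma>2 x"] conjI allI impI)
      show "gauge (\<lambda>x. \<gamma>1 x \<inter> \<gamma>2 x)" using gauge_Int[OF conjunct1[OF \<gamma>1] \<gamma>2(1)] .
      fix \<D>1 \<D>2 assume a: "\<D>1 tagged_division_of (cbox a b) \<and> (\<lambda>x. \<gamma>1 x \<inter> \<gamma>2 x) fine \<D>1 \<and>
            \<D>2 tagged_division_of (cbox a b) \<and> (\<lambda>x. \<gamma>1 x \<inter> \<gamma>2 x) fine \<D>2"
      from a have D: "\<D>1 tagged_division_of (cbox a b)" "\<D>2 tagged_division_of (cbox a b)"
        "\<gamma>1 fine \<D>1" "\<gamma>2 fine \<D>1" "\<gamma>1 fine \<D>2" "\<gamma>2 fine \<D>2" by (simp_all add: fine_Int)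
      from tri[OF err[OF D(1,4)] err[OF D(2,6)] \<gamma>1[THEN conjunct2, THEN spec, THEN spec, THEN mp, OF conjI[OF D(1) conjI[OF D(3) conjI[OF D(2,5)]]]] \<open>e > 0\<close>]
      show "norm (?sum \<D>1 f - ?sum \<D>2 f) < e" .
    qed
  qed
  show ?thesis
  proof (subst integrable_alt, intro conjI allI impI)
    show "(\<lambda>x. if x \<in> UNIV then f x else 0) integrable_on cbox a b" for a b
      using box by (simp only: UNIV_I if_True)
    fix e :: real assume "e > 0"
    then obtain g h where g: "g integrable_on UNIV" and h: "h integrable_on UNIV"
      and le: "\<And>x. norm (f x - g x) \<le> h x" and small: "integral UNIV h < e/4"
      using approx[of "e/4"] by auto
    have h0: "0 \<le> h x" for x using le[of x] norm_ge_zero order_trans by blast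
    have err: "norm (integral (cbox a b) f - integral (cbox a b) g) < e/4" for a b
    proof -
      have gi: "g integrable_on cbox a b" and hi: "h integrable_on cbox a b"
        using integrable_on_subcbox[OF g subset_UNIV] integrable_on_subcbox[OF h subset_UNIV] by blast+
      have hs: "integral (cbox a b) h < e/4"
        using integral_subset_le[OF _ hi h] h0 small by fastforce
      have "norm (integral (cbox a b) (\<lambda>x. f x - g x)) \<le> integral (cbox a b) h"
        using integral_norm_bound_integral[OF integrable_diff[OF box gi] hi] le by blast
      then show ?thesis using hs unfolding integral_diff[OF box gi] by linarith
    qed
    have "\<exists>B>0. \<forall>a b c d. ball 0 B \<subseteq> cbox a b \<and> ball 0 B \<subseteq> cbox c d \<longrightarrow>
        norm (integral (cbox a b) g - integral (cbox c d) g) < e/4"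
      using integrable_altD(2)[OF g divide_pos_pos[OF \<open>e > 0\<close> zero_less_numeral]] by (simp only: UNIV_I if_True)
    then obtain B where "B>0" and B: "\<forall>a b c d. ball 0 B \<subseteq> cbox a b \<and> ball 0 B \<subseteq> cbox c d \<longrightarrow>
        norm (integral (cbox a b) g - integral (cbox c d) g) < e/4"
      by blast
    show "\<exists>B>0. \<forall>a b c d. ball 0 B \<subseteq> cbox a b \<and> ball 0 B \<subseteq> cbox c d \<longrightarrow>
        norm (integral (cbox a b) (\<lambda>x. if x \<in> UNIV then f x else 0) -
          integral (cbox c d) (\<lambda>x. if x \<in> UNIV then f x else 0)) < e"
      using \<open>B > 0\<close> tri[OF err err _ \<open>e > 0\<close>] B by (simp only: UNIV_I if_True) meson
  qed
qed

lemma nonneg_integrable_subset: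
  fixes b :: "real \<Rightarrow> real"
  assumes "b integrable_on T" "\<And>s. s \<in> T \<Longrightarrow> 0 \<le> b s" "U \<subseteq> T" "U \<in> sets lebesgue"
  shows "b integrable_on U"
proof -
  have "b absolutely_integrable_on T" using assms by (intro nonnegative_absolutely_integrable_1)
  then have "b absolutely_integrable_on U" by (rule set_integrable_subset) (use assms in auto)
  then show ?thesis by (rule set_lebesgue_integral_eq_integral)
qed

text \<open>
  The truncations to the intervals \<open>{l n..r n}\<close> are integrable by continuity, and they approximate
  \<open>k\<close> up to the part of the majorant \<open>b\<close> outside these intervals, which tends to \<open>0\<close> in mean.
\<close>

lemma dominated_integrable_exhaustion:
  fixes k :: "real \<Rightarrow> 'a::banach"
  assumes cont: "\<And>n::nat. continuous_on {l n..r n} k"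
    and mono: "\<And>m n. m \<le> n \<Longrightarrow> {l m..r m} \<subseteq> {l n..r n}"
    and U: "U = (\<Union>n. {l n..r n})"
    and b: "b integrable_on U" and le: "\<And>x. x \<in> U \<Longrightarrow> norm (k x) \<le> b x"
  shows "k integrable_on U"
proof -
  define bU where "bU x = (if x \<in> U then b x else 0)" for x
  define h where "h n x = (if x \<in> {l n..r n} then 0 else bU x)" for n x
  have bU: "bU integrable_on UNIV" unfolding bU_def using b by (simp add: integrable_restrict_UNIV)
  have bU0: "0 \<le> bU x" for x using order_trans[OF norm_ge_zero le] by (simp add: bU_def)
  have sub: "{l n..r n} \<subseteq> U" for n using U by auto
  have h: "h n integrable_on UNIV" for n
  proof -
    have "bU integrable_on {l n..r n}"
      using integrable_on_subcbox[OF bU subset_UNIV, of "l n" "r n"] by simp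
    then have "(\<lambda>x. if x \<in> {l n..r n} then bU x else 0) integrable_on UNIV"
      by (simp only: integrable_restrict_UNIV)
    from integrable_diff[OF bU this]
    show ?thesis by (rule integrable_eq) (auto simp: h_def)
  qed
  have "(\<lambda>n. integral UNIV (h n)) \<longlonglongrightarrow> integral UNIV (\<lambda>x::real. 0)"
  proof (rule dominated_convergence(2)[where f = h and h = bU, OF h bU])
    show "norm (h n x) \<le> bU x" for n x using bU0 by (auto simp: h_def)
    show "(\<lambda>n. h n x) \<longlonglongrightarrow> 0" for x
    proof (cases "x \<in> U")
      case True
      then obtain m where "x \<in> {l m..r m}" using U by auto
      then have "h n x = 0" if "n \<ge> m" for n using mono[OF that] by (auto simp: h_def)
      then show ?thesis by (intro tendsto_eventually) (auto simp: eventually_sequentially)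
    next
      case False
      then have "h n x = 0" for n by (simp add: h_def bU_def)
      then show ?thesis by simp
    qed
  qed
  then have lim: "(\<lambda>n. integral UNIV (h n)) \<longlonglongrightarrow> 0" by simp
  have "(\<lambda>x. if x \<in> U then k x else 0) integrable_on UNIV"
  proof (rule integrable_L1_approx)
    fix e :: real assume "e > 0"
    then obtain n where n: "integral UNIV (h n) < e"
      using order_tendstoD(2)[OF lim] by (auto simp: eventually_sequentially)
    have "(\<lambda>x. if x \<in> {l n..r n} then k x else 0) integrable_on UNIV"
      using integrable_continuous_real[OF cont[of n]] by (simp only: integrable_restrict_UNIV)
    moreover have "norm ((if x \<in> U then k x else 0) - (if x \<in> {l n..r n} then k x else 0)) \<le> h n x" for x
      using sub[of n] le by (auto simp: h_def bU_def)
    ultimately show "\<exists>g b. g integrable_on UNIV \<and> b integrable_on UNIV \<and>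
      (\<forall>x. norm ((if x \<in> U then k x else 0) - g x) \<le> b x) \<and> integral UNIV b < e"
      using h n by blast
  qed
  then show ?thesis by (simp only: integrable_restrict_UNIV)
qed

lemma dominated_integrable_einterval:
  fixes k :: "real \<Rightarrow> 'a::banach"
  assumes cont: "continuous_on (einterval a c) k" and b: "b integrable_on einterval a c"
    and le: "\<And>x. x \<in> einterval a c \<Longrightarrow> norm (k x) \<le> b x"
  shows "k integrable_on einterval a c"
proof (cases "a < c")
  case True
  obtain r l :: "nat \<Rightarrow> real" where rl: "einterval a c = (\<Union>i. {l i..r i})" "incseq r" "decseq l"
    using einterval_Icc_approximation[OF True] by metis
  show ?thesis
  proof (rule dominated_integrable_exhaustion[OF _ _ rl(1) b le])
    show "continuous_on {l n..r n} k" for n by (rule continuous_on_subset[OF cont]) (use rl(1) in auto)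
    show "{l m..r m} \<subseteq> {l n..r n}" if "m \<le> n" for m n
      using incseqD[OF rl(2) that] decseqD[OF rl(3) that] by auto
  qed
next
  case False
  then have "einterval a c = {}" by (auto simp: einterval_def dest: less_trans)
  then show ?thesis by (simp add: integrable_on_empty)
qed

lemma dominated_integrable_ray:
  fixes k :: "real \<Rightarrow> 'a::banach"
  assumes "continuous_on {..<c} k" "b integrable_on {..<c}" "\<And>x. x < c \<Longrightarrow> norm (k x) \<le> b x"
  shows "k integrable_on {..<c}"
proof -
  have "einterval (-\<infinity>) (ereal c) = {..<c}" by (auto simp: einterval_def)
  then show ?thesis using dominated_integrable_einterval[of "-\<infinity>" "ereal c" k b] assms by simp
qed

lemma dominated_integrable_open_interval:
  fixes k :: "real \<Rightarrow> 'a::banach"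
  assumes "continuous_on {a<..<c} k" "b integrable_on {a<..<c}" "\<And>x. a < x \<Longrightarrow> x < c \<Longrightarrow> norm (k x) \<le> b x"
  shows "k integrable_on {a<..<c}"
proof -
  have "einterval (ereal a) (ereal c) = {a<..<c}" by (auto simp: einterval_def)
  then show ?thesis using dominated_integrable_einterval[of "ereal a" "ereal c" k b] assms by simp
qed

text \<open>
  The point \<open>p\<close> is allowed since the paths compared later have one jump. At the end point \<open>c\<close> nothing is
  required; there the integrands may be singular.
\<close>

lemma dominated_integrable_ray_except:
  fixes k :: "real \<Rightarrow> 'a::banach"
  assumes cont: "continuous_on ({..<c} - {p}) k" and b: "b integrable_on {..c}"
    and le: "\<And>x. x < c \<Longrightarrow> x \<noteq> p \<Longrightarrow> norm (k x) \<le> b x" and b0: "\<And>x. 0 \<le> b x"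
  shows "k integrable_on {..c}"
proof -
  have "k integrable_on {..<c}"
  proof (cases "p < c")
    case False
    then have eq: "{..<c} - {p} = {..<c}" by auto
    show ?thesis
      by (rule dominated_integrable_ray[OF cont[unfolded eq] nonneg_integrable_subset[OF b b0]])
        (use False in \<open>auto intro!: le\<close>)
  next
    case True
    have 1: "k integrable_on {..<p}"
      by (rule dominated_integrable_ray[OF continuous_on_subset[OF cont] nonneg_integrable_subset[OF b b0]])
        (use True in \<open>auto intro!: le\<close>)
    have 2: "k integrable_on {p<..<c}"
      by (rule dominated_integrable_open_interval[OF continuous_on_subset[OF cont] nonneg_integrable_subset[OF b b0]])
        (use True in \<open>auto intro!: le\<close>)
    have "{..<p} \<inter> {p<..<c} = {}" by auto
    then have "k integrable_on ({..<p} \<union> {p<..<c})" using integrable_Un[OF _ 1 2] by simp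
    then show ?thesis
      by (rule integrable_spike_set[OF _ negligible_subset[of "{p}"] negligible_subset[of "{p}"]])
        (use True in auto)
  qed
  then show ?thesis
    by (rule integrable_spike_set[OF _ negligible_subset[of "{c}"] negligible_subset[of "{c}"]]) auto
qed

lemma dominated_integrable_interval_except:
  fixes k :: "real \<Rightarrow> 'a::banach"
  assumes cont: "continuous_on ({a..c} - {p}) k" and b: "b integrable_on {a..c}"
    and le: "\<And>x. a \<le> x \<Longrightarrow> x \<le> c \<Longrightarrow> norm (k x) \<le> b x"
  shows "k integrable_on {a..c}"
proof -
  have b0: "0 \<le> b x" if "x \<in> {a..c}" for x
    using order_trans[OF norm_ge_zero le, of x] that by simp
  have piece: "k integrable_on {l<..<r}" if "{l<..<r} \<subseteq> {a..c} - {p}" for l r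
    by (rule dominated_integrable_open_interval[OF continuous_on_subset[OF cont that]
          nonneg_integrable_subset[OF b b0]]) (use that in \<open>auto intro!: le\<close>)
  show ?thesis
  proof (cases "a < p \<and> p < c")
    case False
    then have "k integrable_on {a<..<c}" by (intro piece) auto
    then show ?thesis
      by (rule integrable_spike_set[OF _ negligible_subset[of "{a, c}"] negligible_subset[of "{a, c}"]]) auto
  next
    case True
    have "{a<..<p} \<inter> {p<..<c} = {}" by auto
    then have "k integrable_on ({a<..<p} \<union> {p<..<c})"
      using integrable_Un[OF _ piece[of a p] piece[of p c]] True by fastforce
    then show ?thesis
      by (rule integrable_spike_set[OF _ negligible_subset[of "{a, p, c}"] negligible_subset[of "{a, p, c}"]])
        (use True in auto)
  qed
qed

lemma Gamma_kernel_integral: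
  fixes l \<theta> t :: real
  assumes "0 < \<theta>" "0 < l"
  shows "((\<lambda>s. (t - s) powr (\<theta> - 1) * exp (- l * (t - s))) has_integral Gamma \<theta> / l powr \<theta>) {..t}"
proof -
  have vim: "(\<lambda>s. - l * s + l * t) -` {0..} = {..t}"
    using \<open>0 < l\<close> by (auto simp: mult_le_cancel_left)
  have h: "((\<lambda>s. (- l * s + l * t) powr (\<theta> - 1) / exp (- l * s + l * t)) has_integral (1 / l) *\<^sub>R Gamma \<theta>) {..t}"
    using has_integral_affine_vimage[OF Gamma_integral_real[OF assms(1)], of "- l" "l * t"] assms
    unfolding vim by simp
  have int: "((\<lambda>s. l powr (1 - \<theta>) * ((- l * s + l * t) powr (\<theta> - 1) / exp (- l * s + l * t)))
      has_integral l powr (1 - \<theta>) * ((1 / l) *\<^sub>R Gamma \<theta>)) {..t}"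
    by (rule has_integral_mult_right[OF h])
  have eq: "l powr (1 - \<theta>) * ((- l * s + l * t) powr (\<theta> - 1) / exp (- l * s + l * t))
      = (t - s) powr (\<theta> - 1) * exp (- l * (t - s))" if "s \<in> {..t}" for s
  proof -
    have 1: "- l * s + l * t = l * (t - s)" by (simp add: algebra_simps)
    have 2: "(l * (t - s)) powr (\<theta> - 1) = l powr (\<theta> - 1) * (t - s) powr (\<theta> - 1)"
      using that assms by (simp add: powr_mult)
    have 3: "l powr (1 - \<theta>) * (l powr (\<theta> - 1) * z) = z" for z
      using assms by (simp flip: powr_add mult.assoc)
    show ?thesis unfolding 1 2 times_divide_eq_right 3 by (simp add: exp_minus divide_inverse)
  qed
  have "l powr (1 - \<theta>) * ((1 / l) *\<^sub>R Gamma \<theta>) = Gamma \<theta> / l powr \<theta>"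
    using assms by (simp add: powr_diff)
  then show ?thesis using has_integral_eq[OF eq int] by simp
qed

lemma Gamma_ge_1:
  fixes x :: real
  assumes "0 < x" "x \<le> 1"
  shows "1 \<le> Gamma x"
proof -
  define u where "u = 1 / (2 - x)"
  have u: "0 \<le> 1 - u" "0 \<le> u" "0 < u" using assms by (auto simp: u_def field_simps)
  have "(ln \<circ> Gamma) ((1 - u) *\<^sub>R 2 + u *\<^sub>R x) \<le> (1 - u) * (ln \<circ> Gamma) 2 + u * (ln \<circ> Gamma) x"
    using u assms by (intro convex_onD[OF log_convex_Gamma_real]) auto
  moreover have "(1 - u) *\<^sub>R 2 + u *\<^sub>R x = 1"
  proof -
    have "u * (2 - x) = 1" using assms by (simp add: u_def)
    then show ?thesis by (simp add: algebra_simps)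
  qed
  moreover have "Gamma (2::real) = 1" using Gamma_fact[of 1] by simp
  ultimately have "0 \<le> u * ln (Gamma x)" by (simp only: o_apply Gamma_1 ln_one mult_zero_right add_0_left)
  then have "0 \<le> ln (Gamma x)" using u by (simp add: zero_le_mult_iff)
  then show ?thesis using assms Gamma_real_pos[of x] by (metis ln_ge_zero_iff)
qed

section \<open>Projections along closed direct sums\<close>

lemma proj_eqI:
  assumes "\<And>y. \<exists>!a. a \<in> F \<and> y - a \<in> S" "a \<in> F" "y - a \<in> S"
  shows "proj F S y = a"
  unfolding proj_def by (rule the1_equality[OF assms(1)]) (use assms in blast)

lemma proj_mem:
  assumes "\<And>y. \<exists>!a. a \<in> F \<and> y - a \<in> S"
  shows "proj F S y \<in> F" "y - proj F S y \<in> S"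
  unfolding proj_def
  by (rule theI'[OF assms[of y], THEN conjunct1], rule theI'[OF assms[of y], THEN conjunct2])

text \<open>
  The projection along a closed direct sum of a Banach space is bounded. By the Baire category theorem the
  closure of some sublevel set of \<open>norm (proj F S y)\<close> has an interior point; by scaling, each \<open>x\<close> is then
  approximated up to \<open>norm x / 2\<close> by some \<open>y\<close> with \<open>norm (proj F S y) \<le> K * norm x\<close>. Iterating on the
  remainders writes \<open>x\<close> as a series along which the projections are summable.
\<close>

lemma bounded_linear_proj:
  fixes F S :: "'a::banach set"
  assumes sub: "subspace F" "subspace S" and cl: "closed F" "closed S"
    and dir: "\<And>y. \<exists>!a. a \<in> F \<and> y - a \<in> S"
  shows "bounded_linear (proj F S)"
proof -
  let ?P = "proj F S"
  have lin: "linear ?P"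
  proof (rule linearI)
    fix x y :: 'a and c :: real
    show "?P (x + y) = ?P x + ?P y"
    proof (rule proj_eqI[OF dir])
      have "x + y - (?P x + ?P y) = (x - ?P x) + (y - ?P y)" by simp
      then show "x + y - (?P x + ?P y) \<in> S" using proj_mem[OF dir] subspace_add[OF sub(2)] by metis
    qed (use proj_mem[OF dir] subspace_add[OF sub(1)] in auto)
    show "?P (c *\<^sub>R x) = c *\<^sub>R ?P x"
    proof (rule proj_eqI[OF dir])
      show "c *\<^sub>R x - c *\<^sub>R ?P x \<in> S" unfolding scaleR_diff_right[symmetric]
        using proj_mem[OF dir] subspace_scale[OF sub(2)] by metis
    qed (use proj_mem[OF dir] subspace_scale[OF sub(1)] in auto)
  qed
  define A where "A n = closure {y. norm (?P y) \<le> real n}" for n :: nat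
  have "\<exists>n. interior (A n) \<noteq> {}"
  proof (rule ccontr)
    assume "\<nexists>n. interior (A n) \<noteq> {}"
    then have "Met_TC.mtopology interior_of \<Union>(range A) = {}"
      by (intro Met_TC.metric_Baire_category_alt)
         (auto simp: A_def mcomplete_iff_complete complete_UNIV)
    moreover have "\<Union>(range A) = UNIV"
    proof -
      have "y \<in> A (nat \<lceil>norm (?P y)\<rceil>)" for y
        unfolding A_def by (rule subsetD[OF closure_subset]) (auto simp: of_nat_ceiling)
      then show ?thesis by blast
    qed
    ultimately show False by simp
  qed
  then obtain n y0 where "y0 \<in> interior (A n)" by blast
  then obtain r where r: "r > 0" "ball y0 r \<subseteq> A n"
    by (meson interior_subset mem_interior order_trans)
  have ball: "\<exists>y. norm (y - x) < e \<and> norm (?P y) \<le> 2 * real n" if x: "norm x < r" and e: "e > 0" for x e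
  proof -
    have "y0 + x \<in> A n" "y0 \<in> A n" using r x by (auto simp: dist_norm)
    then obtain a b where a: "norm (?P a) \<le> n" "dist a (y0 + x) < e/2" and b: "norm (?P b) \<le> n" "dist b y0 < e/2"
      using e unfolding A_def closure_approachable
      by (metis (no_types, lifting) half_gt_zero mem_Collect_eq)
    have "(a - b) - x = (a - (y0 + x)) - (b - y0)" by simp
    then have "norm ((a - b) - x) < e"
      using norm_triangle_ineq4[of "a - (y0 + x)" "b - y0"] a b
      unfolding dist_norm diff_diff_eq by (simp add: add.commute)
    moreover have "norm (?P (a - b)) \<le> 2 * real n"
      using norm_triangle_ineq4[of "?P a" "?P b"] a b by (simp add: linear_diff[OF lin])
    ultimately show ?thesis by blast
  qed
  define K where "K = 4 * real n / r"
  have K0: "0 \<le> K" using r by (simp add: K_def)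
  \<comment> \<open>Rescale \<open>x\<close> to norm \<open>r / 2\<close> and approximate it up to \<open>r / 4\<close>.\<close>
  have step: "\<exists>y. norm (x - y) \<le> norm x / 2 \<and> norm (?P y) \<le> K * norm x" for x
  proof (cases "x = 0")
    case True
    then show ?thesis using linear_0[OF lin] by (intro exI[of _ 0]) auto
  next
    case False
    define c where "c = r / (2 * norm x)"
    have c: "c > 0" using False r by (simp add: c_def)
    have "norm (c *\<^sub>R x) < r" using False r by (simp add: c_def)
    then obtain y where y: "norm (y - c *\<^sub>R x) < r / 4" "norm (?P y) \<le> 2 * real n"
      using ball[of "c *\<^sub>R x" "r/4"] r by auto
    have "x - (1 / c) *\<^sub>R y = - (1 / c) *\<^sub>R (y - c *\<^sub>R x)" using c by (simp add: scaleR_diff_right)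
    then have "norm (x - (1 / c) *\<^sub>R y) = (1 / c) * norm (y - c *\<^sub>R x)" using c by simp
    also have "\<dots> \<le> (1 / c) * (r / 4)" using y c by (intro mult_left_mono) auto
    also have "\<dots> = norm x / 2" using r False by (simp add: c_def field_simps)
    finally have 1: "norm (x - (1 / c) *\<^sub>R y) \<le> norm x / 2" .
    have "norm (?P ((1 / c) *\<^sub>R y)) = (1 / c) * norm (?P y)" using c by (simp add: linear_scale[OF lin])
    also have "\<dots> \<le> (1 / c) * (2 * real n)" using y c by (intro mult_left_mono) auto
    also have "\<dots> = K * norm x" using r False by (simp add: c_def K_def field_simps)
    finally show ?thesis using 1 by blast
  qed
  then obtain Y where Y: "\<And>x. norm (x - Y x) \<le> norm x / 2" "\<And>x. norm (?P (Y x)) \<le> K * norm x"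
    using choice[of "\<lambda>x y. norm (x - y) \<le> norm x / 2 \<and> norm (?P y) \<le> K * norm x"] by blast
  have bound: "norm (?P x) \<le> norm x * (2 * K)" for x
  proof -
    define X where "X k = ((\<lambda>z. z - Y z) ^^ k) x" for k
    have Xs: "X (Suc k) = X k - Y (X k)" for k by (simp add: X_def)
    have X0: "X 0 = x" by (simp add: X_def)
    have Xb: "norm (X k) \<le> norm x * (1/2) ^ k" for k
    proof (induction k)
      case (Suc k) then show ?case using Y(1)[of "X k"] by (simp add: Xs)
    qed (simp add: X0)
    have Xlim: "X \<longlonglongrightarrow> 0"
    proof (rule Lim_null_comparison)
      show "\<forall>\<^sub>F k in sequentially. norm (X k) \<le> norm x * (1/2) ^ k" using Xb by simp
      show "(\<lambda>k. norm x * (1/2) ^ k) \<longlonglongrightarrow> 0" by (intro tendsto_mult_right_zero LIMSEQ_power_zero) simp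
    qed
    have tele: "(\<Sum>k<m. Y (X k)) = x - X m" for m
      by (induction m) (simp_all add: X0 Xs)
    have Pb: "norm (?P (Y (X k))) \<le> K * norm x * (1/2) ^ k" for k
      using Y(2)[of "X k"] mult_left_mono[OF Xb[of k] K0] by (simp add: mult.assoc)
    have geo: "(\<lambda>k. K * norm x * (1/2) ^ k) sums (K * norm x * 2)"
      using sums_mult[OF geometric_sums[of "1/2::real"], of "K * norm x"] by simp
    have sumP: "summable (\<lambda>k. ?P (Y (X k)))"
      by (rule summable_comparison_test'[OF sums_summable[OF geo]]) (use Pb in auto)
    define a where "a = (\<Sum>k. ?P (Y (X k)))"
    have alim: "(\<lambda>m. \<Sum>k<m. ?P (Y (X k))) \<longlonglongrightarrow> a" unfolding a_def using sumP by (rule summable_LIMSEQ)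
    have aF: "a \<in> F"
      by (rule closed_sequentially[OF cl(1) _ alim]) (rule subspace_sum[OF sub(1) proj_mem(1)[OF dir]])
    have "x - a \<in> S"
    proof (rule closed_sequentially[OF cl(2)])
      show "(\<lambda>m. \<Sum>k<m. Y (X k) - ?P (Y (X k))) \<longlonglongrightarrow> x - a"
        unfolding sum_subtractf tele using tendsto_diff[OF tendsto_diff[OF tendsto_const Xlim] alim] by simp
      show "(\<Sum>k<m. Y (X k) - ?P (Y (X k))) \<in> S" for m
        by (rule subspace_sum[OF sub(2) proj_mem(2)[OF dir]])
    qed
    then have "?P x = a" using aF by (intro proj_eqI[OF dir])
    moreover have "norm a \<le> K * norm x * 2"
      unfolding a_def sums_unique[OF geo]
      by (rule norm_suminf_le[OF Pb sums_summable[OF geo]])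
    ultimately show ?thesis by (simp add: mult_ac)
  qed
  show ?thesis
  proof (rule bounded_linear_intro[where K = "2 * K"])
    show "?P (x + y) = ?P x + ?P y" for x y by (rule linear_add[OF lin])
    show "?P (r *\<^sub>R x) = r *\<^sub>R ?P x" for r x by (rule linear_scale[OF lin])
  qed (rule bound)
qed

section \<open>Normed subspaces and graph norms\<close>

text \<open>
  The axioms of a normed space, that is, \<^const>\<open>banach_space\<close> without completeness.
\<close>

definition normed_nspace :: "'a::real_vector nspace \<Rightarrow> bool" where
  "normed_nspace Z \<longleftrightarrow> subspace (carr Z) \<and>
     (\<forall>x\<in>carr Z. 0 \<le> nrm Z x \<and> (nrm Z x = 0 \<longleftrightarrow> x = 0)) \<and>
     (\<forall>x\<in>carr Z. \<forall>c. nrm Z (c *\<^sub>R x) = \<bar>c\<bar> * nrm Z x) \<and>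
     (\<forall>x\<in>carr Z. \<forall>y\<in>carr Z. nrm Z (x + y) \<le> nrm Z x + nrm Z y)"

lemma banach_space_normed: "banach_space Z \<Longrightarrow> normed_nspace Z"
  by (simp add: banach_space_def normed_nspace_def)

lemma normed_nspaceD:
  assumes "normed_nspace Z"
  shows "subspace (carr Z)" "0 \<in> carr Z" "nrm Z 0 = 0"
    "\<And>x. x \<in> carr Z \<Longrightarrow> 0 \<le> nrm Z x" "\<And>x. x \<in> carr Z \<Longrightarrow> nrm Z x = 0 \<Longrightarrow> x = 0"
    "\<And>x c. x \<in> carr Z \<Longrightarrow> nrm Z (c *\<^sub>R x) = \<bar>c\<bar> * nrm Z x"
    "\<And>x y. x \<in> carr Z \<Longrightarrow> y \<in> carr Z \<Longrightarrow> nrm Z (x + y) \<le> nrm Z x + nrm Z y"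
    "\<And>x y. x \<in> carr Z \<Longrightarrow> y \<in> carr Z \<Longrightarrow> x + y \<in> carr Z"
    "\<And>x y. x \<in> carr Z \<Longrightarrow> y \<in> carr Z \<Longrightarrow> x - y \<in> carr Z"
    "\<And>x c. x \<in> carr Z \<Longrightarrow> c *\<^sub>R x \<in> carr Z"
proof -
  show s: "subspace (carr Z)" using assms by (simp add: normed_nspace_def)
  show z: "0 \<in> carr Z" by (rule subspace_0[OF s])
  show "nrm Z 0 = 0" using assms z by (simp add: normed_nspace_def)
qed (use assms in \<open>auto simp: normed_nspace_def subspace_add subspace_diff subspace_scale\<close>)

lemma nrm_minus_commute:
  assumes "normed_nspace Z" "x \<in> carr Z" "y \<in> carr Z"
  shows "nrm Z (x - y) = nrm Z (y - x)"
  using normed_nspaceD(6)[OF assms(1) normed_nspaceD(9)[OF assms(1,3,2)], of "-1"] by simp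

lemma nrm_triangle:
  assumes "normed_nspace Z" "x \<in> carr Z" "y \<in> carr Z" "z \<in> carr Z"
  shows "nrm Z (x - z) \<le> nrm Z (x - y) + nrm Z (y - z)"
  using normed_nspaceD(7)[OF assms(1), of "x - y" "y - z"] normed_nspaceD(9)[OF assms(1)] assms(2-4) by simp

lemma nrm_diff_le:
  assumes "normed_nspace Z" "x \<in> carr Z" "y \<in> carr Z"
  shows "nrm Z (x - y) \<le> nrm Z x + nrm Z y"
  using nrm_triangle[OF assms(1,2) normed_nspaceD(2)[OF assms(1)] assms(3)]
    nrm_minus_commute[OF assms(1) normed_nspaceD(2)[OF assms(1)] assms(3)] by simp

lemma Metric_space_ndist:
  assumes "normed_nspace Z"
  shows "Metric_space (carr Z) (ndist Z)"
proof
  show "0 \<le> ndist Z x y" for x y using normed_nspaceD[OF assms] by (simp add: ndist_def)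
  show "ndist Z x y = ndist Z y x" for x y using nrm_minus_commute[OF assms] by (simp add: ndist_def)
  show "ndist Z x y = 0 \<longleftrightarrow> x = y" if "x \<in> carr Z" "y \<in> carr Z" for x y
    using normed_nspaceD(3)[OF assms] normed_nspaceD(5)[OF assms normed_nspaceD(9)[OF assms]] that
    by (auto simp: ndist_def)
  show "ndist Z x z \<le> ndist Z x y + ndist Z y z" if "x \<in> carr Z" "y \<in> carr Z" "z \<in> carr Z" for x y z
    using nrm_triangle[OF assms that] that by (simp add: ndist_def)
qed

lemma normed_nprod:
  assumes "normed_nspace Z" "normed_nspace W"
  shows "normed_nspace (Z \<times>\<^sub>n W)"
proof -
  note Z = normed_nspaceD[OF assms(1)] and W = normed_nspaceD[OF assms(2)]
  show ?thesis
    unfolding normed_nspace_def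
  proof (intro conjI ballI allI)
    show "subspace (carr (Z \<times>\<^sub>n W))" by (simp add: nprod_def subspace_Times Z W)
    fix p assume p: "p \<in> carr (Z \<times>\<^sub>n W)"
    show "0 \<le> nrm (Z \<times>\<^sub>n W) p" using p by (auto simp: nprod_def Z W)
    show "nrm (Z \<times>\<^sub>n W) p = 0 \<longleftrightarrow> p = 0"
      using p Z(3-5) W(3-5) by (auto simp: nprod_def add_nonneg_eq_0_iff zero_prod_def)
    show "nrm (Z \<times>\<^sub>n W) (c *\<^sub>R p) = \<bar>c\<bar> * nrm (Z \<times>\<^sub>n W) p" for c
      using p by (auto simp: nprod_def Z W algebra_simps)
    show "nrm (Z \<times>\<^sub>n W) (p + q) \<le> nrm (Z \<times>\<^sub>n W) p + nrm (Z \<times>\<^sub>n W) q" if q: "q \<in> carr (Z \<times>\<^sub>n W)" for q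
    proof -
      have "nrm Z (fst p + fst q) \<le> nrm Z (fst p) + nrm Z (fst q)"
           "nrm W (snd p + snd q) \<le> nrm W (snd p) + nrm W (snd q)"
        using p q by (auto simp: nprod_def intro: Z W)
      then show ?thesis by (simp add: nprod_def split_def)
    qed
  qed
qed

lemma normed_nsub:
  assumes "normed_nspace Z" "subspace F"
  shows "normed_nspace (nsub Z F)"
  using assms unfolding normed_nspace_def nsub_def by (auto intro: subspace_inter)

lemma continuous_map_ntop_iff:
  fixes T :: "'t::metric_space set"
  assumes Z: "normed_nspace Z"
  shows "continuous_map (top_of_set T) (ntop Z) w \<longleftrightarrow>
    (\<forall>s\<in>T. w s \<in> carr Z) \<and> (\<forall>s\<in>T. \<forall>e>0. \<exists>d>0. \<forall>r\<in>T. dist r s < d \<longrightarrow> nrm Z (w r - w s) < e)"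
proof -
  interpret M: Metric_space "carr Z" "ndist Z" by (rule Metric_space_ndist[OF Z])
  show ?thesis
  proof
    assume L: "continuous_map (top_of_set T) (ntop Z) w"
    then have mem: "w s \<in> carr Z" if "s \<in> T" for s
      using that continuous_map_image_subset_topspace[OF L] by (auto simp: ntop_def)
    have "\<exists>d>0. \<forall>r\<in>T. dist r s < d \<longrightarrow> nrm Z (w r - w s) < e" if s: "s \<in> T" and e: "e > 0" for s e
    proof -
      obtain U where U: "openin (top_of_set T) U" "s \<in> U" "\<forall>y\<in>U. w y \<in> M.mball (w s) e"
        using L[unfolded ntop_def M.continuous_map_to_metric topspace_euclidean_subtopology] s e by blast
      obtain d where d: "d > 0" "\<forall>r\<in>T. dist r s < d \<longrightarrow> r \<in> U"
        using U(1)[unfolded openin_euclidean_subtopology_iff] U(2) by blast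
      have "nrm Z (w r - w s) < e" if "r \<in> T" "dist r s < d" for r
      proof -
        have "w r \<in> M.mball (w s) e" using U(3) d(2) that by blast
        then show ?thesis
          using mem[OF s] mem[OF that(1)] nrm_minus_commute[OF Z mem[OF s] mem[OF that(1)]]
          by (simp add: M.in_mball ndist_def)
      qed
      then show ?thesis using d(1) by blast
    qed
    then show "(\<forall>s\<in>T. w s \<in> carr Z) \<and> (\<forall>s\<in>T. \<forall>e>0. \<exists>d>0. \<forall>r\<in>T. dist r s < d \<longrightarrow> nrm Z (w r - w s) < e)"
      using mem by blast
  next
    assume R: "(\<forall>s\<in>T. w s \<in> carr Z) \<and> (\<forall>s\<in>T. \<forall>e>0. \<exists>d>0. \<forall>r\<in>T. dist r s < d \<longrightarrow> nrm Z (w r - w s) < e)"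
    show "continuous_map (top_of_set T) (ntop Z) w"
      unfolding ntop_def M.continuous_map_to_metric
    proof (intro ballI allI impI)
      fix s and e :: real assume "s \<in> topspace (top_of_set T)" and e: "e > 0"
      then have s: "s \<in> T" by simp
      then obtain d where d: "d > 0" "\<forall>r\<in>T. dist r s < d \<longrightarrow> nrm Z (w r - w s) < e" using R e by blast
      show "\<exists>U. openin (top_of_set T) U \<and> s \<in> U \<and> (\<forall>y\<in>U. w y \<in> M.mball (w s) e)"
      proof (intro exI conjI)
        show "openin (top_of_set T) (T \<inter> ball s d)" by (simp add: openin_open_Int)
        show "s \<in> T \<inter> ball s d" using s d by simp
        show "\<forall>y\<in>T \<inter> ball s d. w y \<in> M.mball (w s) e"
        proof
          fix r assume r: "r \<in> T \<inter> ball s d"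
          then have "nrm Z (w r - w s) < e" using d by (simp add: dist_commute)
          moreover have "w r \<in> carr Z" "w s \<in> carr Z" using R r s by auto
          ultimately show "w r \<in> M.mball (w s) e"
            using nrm_minus_commute[OF Z] by (simp add: M.in_mball ndist_def)
        qed
      qed
    qed
  qed
qed

lemma continuous_map_ntop_nprod:
  fixes T :: "'t::metric_space set"
  assumes Z: "normed_nspace Z" and W: "normed_nspace W"
  shows "continuous_map (top_of_set T) (ntop (Z \<times>\<^sub>n W)) w \<longleftrightarrow>
    continuous_map (top_of_set T) (ntop Z) (\<lambda>s. fst (w s)) \<and> continuous_map (top_of_set T) (ntop W) (\<lambda>s. snd (w s))"
    (is "?L \<longleftrightarrow> ?R1 \<and> ?R2")
proof -
  have car: "p \<in> carr (Z \<times>\<^sub>n W) \<longleftrightarrow> fst p \<in> carr Z \<and> snd p \<in> carr W" for p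
    by (cases p) (simp add: nprod_def)
  have nr: "nrm (Z \<times>\<^sub>n W) (p - q) = nrm Z (fst p - fst q) + nrm W (snd p - snd q)" for p q
    by (simp add: nprod_def split_def)
  note iff = continuous_map_ntop_iff[OF Z] continuous_map_ntop_iff[OF W] continuous_map_ntop_iff[OF normed_nprod[OF Z W]]
  show ?thesis
  proof
    assume L: ?L
    then have mem: "\<And>s. s \<in> T \<Longrightarrow> fst (w s) \<in> carr Z" "\<And>s. s \<in> T \<Longrightarrow> snd (w s) \<in> carr W"
      and ex: "\<And>s e. s \<in> T \<Longrightarrow> e > 0 \<Longrightarrow> \<exists>d>0. \<forall>r\<in>T. dist r s < d \<longrightarrow>
         nrm Z (fst (w r) - fst (w s)) + nrm W (snd (w r) - snd (w s)) < e"
      unfolding iff car nr by auto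
    have pos: "0 \<le> nrm Z (fst (w r) - fst (w s))" "0 \<le> nrm W (snd (w r) - snd (w s))" if "r \<in> T" "s \<in> T" for r s
      using normed_nspaceD(4)[OF Z normed_nspaceD(9)[OF Z]] normed_nspaceD(4)[OF W normed_nspaceD(9)[OF W]] mem that
      by simp_all
    show "?R1 \<and> ?R2" unfolding iff
    proof (intro conjI ballI allI impI)
      fix s e assume "s \<in> T" "(e::real) > 0"
      then obtain d where d: "d > 0" "\<forall>r\<in>T. dist r s < d \<longrightarrow>
         nrm Z (fst (w r) - fst (w s)) + nrm W (snd (w r) - snd (w s)) < e" using ex by blast
      show "\<exists>d>0. \<forall>r\<in>T. dist r s < d \<longrightarrow> nrm Z (fst (w r) - fst (w s)) < e"
        using d pos[OF _ \<open>s \<in> T\<close>] by (intro exI[of _ d]) fastforce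
      show "\<exists>d>0. \<forall>r\<in>T. dist r s < d \<longrightarrow> nrm W (snd (w r) - snd (w s)) < e"
        using d pos[OF _ \<open>s \<in> T\<close>] by (intro exI[of _ d]) fastforce
    qed (use mem in auto)
  next
    assume R: "?R1 \<and> ?R2"
    show ?L unfolding iff(3)
    proof (intro conjI ballI allI impI)
      fix s e assume s: "s \<in> T" and e: "(e::real) > 0"
      obtain d1 where d1: "d1 > 0" "\<And>r. r \<in> T \<Longrightarrow> dist r s < d1 \<Longrightarrow> nrm Z (fst (w r) - fst (w s)) < e/2"
        using R[unfolded iff] s e by (metis half_gt_zero)
      obtain d2 where d2: "d2 > 0" "\<And>r. r \<in> T \<Longrightarrow> dist r s < d2 \<Longrightarrow> nrm W (snd (w r) - snd (w s)) < e/2"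
        using R[unfolded iff] s e by (metis half_gt_zero)
      show "\<exists>d>0. \<forall>r\<in>T. dist r s < d \<longrightarrow> nrm (Z \<times>\<^sub>n W) (w r - w s) < e"
        unfolding nr using d1 d2 by (intro exI[of _ "min d1 d2"]) fastforce
    qed (use R[unfolded iff] car in auto)
  qed
qed

lemma continuous_map_ntop_nsub:
  fixes T :: "'t::metric_space set"
  assumes Z: "normed_nspace Z" and F: "subspace F"
  shows "continuous_map (top_of_set T) (ntop (nsub Z F)) w \<longleftrightarrow>
    (\<forall>s\<in>T. w s \<in> F) \<and> continuous_map (top_of_set T) (ntop Z) w"
  unfolding continuous_map_ntop_iff[OF Z] continuous_map_ntop_iff[OF normed_nsub[OF Z F]]
  by (auto simp: nsub_def)

text \<open>
  A normed space \<open>Z\<close> inside a Banach space whose norm is equivalent to the graph norm of a bijection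
  \<open>Q\<close> with bounded inverse. Continuity and integrability of \<open>Z\<close>-valued curves \<open>w\<close> are those of
  \<open>\<lambda>s. Q (w s)\<close>, a curve in the norm of the type; only the constants in estimates refer to \<open>nrm Z\<close>.
\<close>

locale graph_space =
  fixes Z :: "'a::banach nspace" and Q :: "'a \<Rightarrow> 'a"
  assumes normed: "normed_nspace Z"
    and Q_lin: "linear_between Z Q"
    and Q_bij: "bij_betw Q (carr Z) UNIV"
    and Q_below: "\<exists>K. \<forall>x\<in>carr Z. norm x \<le> K * norm (Q x)"
    and nrm_le_Q: "\<exists>K. \<forall>x\<in>carr Z. nrm Z x \<le> K * norm (Q x)"
    and Q_le_nrm: "\<exists>K. \<forall>x\<in>carr Z. norm (Q x) \<le> K * nrm Z x"
begin

lemmas nD = normed_nspaceD[OF normed]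

text \<open>
  The inverse of \<open>Q\<close>.
\<close>

definition R :: "'a \<Rightarrow> 'a" where "R = the_inv_into (carr Z) Q"

lemma R_mem [simp]: "R x \<in> carr Z"
  unfolding R_def using Q_bij by (metis UNIV_I bij_betw_def order_refl the_inv_into_into)

lemma Q_R [simp]: "Q (R x) = x"
  unfolding R_def using Q_bij by (simp add: bij_betw_def f_the_inv_into_f)

lemma R_Q [simp]: "x \<in> carr Z \<Longrightarrow> R (Q x) = x"
  unfolding R_def using Q_bij by (simp add: bij_betw_def the_inv_into_f_f)

lemma Q_inj: "x \<in> carr Z \<Longrightarrow> y \<in> carr Z \<Longrightarrow> Q x = Q y \<Longrightarrow> x = y"
  using R_Q by metis

lemma Q_add: "x \<in> carr Z \<Longrightarrow> y \<in> carr Z \<Longrightarrow> Q (x + y) = Q x + Q y"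
  using Q_lin[unfolded linear_between_def, THEN bspec, THEN bspec, of x y, THEN spec, THEN spec, of 1 1] by simp

lemma Q_scale: "x \<in> carr Z \<Longrightarrow> Q (c *\<^sub>R x) = c *\<^sub>R Q x"
  using Q_lin[unfolded linear_between_def, THEN bspec, THEN bspec, of x x, THEN spec, THEN spec, of c 0] by simp

lemma Q_diff: "x \<in> carr Z \<Longrightarrow> y \<in> carr Z \<Longrightarrow> Q (x - y) = Q x - Q y"
  using Q_lin[unfolded linear_between_def, THEN bspec, THEN bspec, of x y, THEN spec, THEN spec, of 1 "-1"] by simp

lemma Q_0 [simp]: "Q 0 = 0"
  using Q_scale[of 0 0] nD by simp

lemma bounded_linear_R: "bounded_linear R"
proof -
  obtain K where K: "\<And>x. x \<in> carr Z \<Longrightarrow> norm x \<le> K * norm (Q x)" using Q_below by blast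
  show ?thesis
  proof (rule bounded_linear_intro[where K = K])
    show "R (x + y) = R x + R y" for x y by (rule Q_inj) (simp_all add: Q_add nD)
    show "R (c *\<^sub>R x) = c *\<^sub>R R x" for x c by (rule Q_inj) (simp_all add: Q_scale nD)
    show "norm (R x) \<le> norm x * K" for x using K[of "R x"] by (simp add: mult.commute)
  qed
qed

lemma nrm_bound: obtains K where "K > 0" "\<And>x. x \<in> carr Z \<Longrightarrow> nrm Z x \<le> K * norm (Q x)"
proof -
  obtain K where K: "\<And>x. x \<in> carr Z \<Longrightarrow> nrm Z x \<le> K * norm (Q x)" using nrm_le_Q by blast
  have "K * norm (Q x) \<le> max K 1 * norm (Q x)" for x by (simp add: mult_right_mono)
  then show ?thesis using K by (intro that[of "max K 1"]) (auto intro: order_trans)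
qed

lemma Q_bound: obtains K where "K > 0" "\<And>x. x \<in> carr Z \<Longrightarrow> norm (Q x) \<le> K * nrm Z x"
proof -
  obtain K where K: "\<And>x. x \<in> carr Z \<Longrightarrow> norm (Q x) \<le> K * nrm Z x" using Q_le_nrm by blast
  have "K * nrm Z x \<le> max K 1 * nrm Z x" if "x \<in> carr Z" for x by (simp add: mult_right_mono nD that)
  then show ?thesis using K by (intro that[of "max K 1"]) (auto intro: order_trans)
qed

lemma continuous_map_iff:
  fixes T :: "'t::metric_space set"
  shows "continuous_map (top_of_set T) (ntop Z) w \<longleftrightarrow> (\<forall>s\<in>T. w s \<in> carr Z) \<and> continuous_on T (\<lambda>s. Q (w s))"
  unfolding continuous_map_ntop_iff[OF normed] continuous_on_iff
proof (intro conj_cong refl)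
  assume mem: "\<forall>s\<in>T. w s \<in> carr Z"
  obtain K where K: "K > 0" "\<And>x. x \<in> carr Z \<Longrightarrow> nrm Z x \<le> K * norm (Q x)" using nrm_bound by blast
  obtain L where L: "L > 0" "\<And>x. x \<in> carr Z \<Longrightarrow> norm (Q x) \<le> L * nrm Z x" using Q_bound by blast
  have 1: "nrm Z (w r - w s) \<le> K * dist (Q (w r)) (Q (w s))" if "r \<in> T" "s \<in> T" for r s
    using K(2)[of "w r - w s"] mem that nD by (simp add: dist_norm Q_diff)
  have 2: "dist (Q (w r)) (Q (w s)) \<le> L * nrm Z (w r - w s)" if "r \<in> T" "s \<in> T" for r s
    using L(2)[of "w r - w s"] mem that nD by (simp add: dist_norm Q_diff)
  show "(\<forall>s\<in>T. \<forall>e>0. \<exists>d>0. \<forall>r\<in>T. dist r s < d \<longrightarrow> nrm Z (w r - w s) < e) \<longleftrightarrow>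
      (\<forall>x\<in>T. \<forall>e>0. \<exists>d>0. \<forall>x'\<in>T. dist x' x < d \<longrightarrow> dist (Q (w x')) (Q (w x)) < e)" (is "?A \<longleftrightarrow> ?B")
  proof
    assume A: ?A
    show ?B
    proof (intro ballI allI impI)
      fix s and e :: real assume s: "s \<in> T" and "e > 0"
      then obtain d where d: "d > 0" "\<And>r. r \<in> T \<Longrightarrow> dist r s < d \<Longrightarrow> nrm Z (w r - w s) < e / L"
        using A s divide_pos_pos[OF \<open>e > 0\<close> L(1)] by blast
      have "dist (Q (w r)) (Q (w s)) < e" if "r \<in> T" "dist r s < d" for r
        using 2[OF that(1) s] d(2)[OF that] L(1) by (simp add: pos_less_divide_eq mult.commute)
      then show "\<exists>d>0. \<forall>x'\<in>T. dist x' s < d \<longrightarrow> dist (Q (w x')) (Q (w s)) < e" using d(1) by blast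
    qed
  next
    assume B: ?B
    show ?A
    proof (intro ballI allI impI)
      fix s and e :: real assume s: "s \<in> T" and "e > 0"
      then obtain d where d: "d > 0" "\<And>r. r \<in> T \<Longrightarrow> dist r s < d \<Longrightarrow> dist (Q (w r)) (Q (w s)) < e / K"
        using B s divide_pos_pos[OF \<open>e > 0\<close> K(1)] by blast
      have "nrm Z (w r - w s) < e" if "r \<in> T" "dist r s < d" for r
        using 1[OF that(1) s] d(2)[OF that] K(1) by (simp add: pos_less_divide_eq mult.commute)
      then show "\<exists>d>0. \<forall>r\<in>T. dist r s < d \<longrightarrow> nrm Z (w r - w s) < e" using d(1) by blast
    qed
  qed
qed

lemma continuous_on_Q_iff:
  fixes T :: "'t::metric_space set"
  assumes "\<And>s. s \<in> T \<Longrightarrow> w s \<in> carr Z"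
  shows "continuous_on T (\<lambda>s. Q (w s)) \<longleftrightarrow>
    (\<forall>s\<in>T. \<forall>e>0. \<exists>d>0. \<forall>r\<in>T. dist r s < d \<longrightarrow> nrm Z (w r - w s) < e)"
  using continuous_map_iff[of T w] assms unfolding continuous_map_ntop_iff[OF normed] by blast

text \<open>
  The estimate is by the norm of \<open>Z\<close> itself, without the constants of the equivalence of norms; this
  matters since a contraction constant is to be controlled. Finitely many values of \<open>k\<close> may lie outside \<open>Z\<close>.
\<close>

lemma graph_integral:
  fixes T :: "real set"
  assumes N: "finite N" and mem: "\<And>s. s \<in> T - N \<Longrightarrow> k s \<in> carr Z"
    and le: "\<And>s. s \<in> T - N \<Longrightarrow> nrm Z (k s) \<le> b s"
    and Qk: "(\<lambda>s. Q (k s)) integrable_on T" and b: "b integrable_on T"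
  shows "k integrable_on T" "integral T k \<in> carr Z" "Q (integral T k) = integral T (\<lambda>s. Q (k s))"
    "nrm Z (integral T k) \<le> integral T b"
proof -
  have 1: "((\<lambda>s. R (Q (k s))) has_integral R (integral T (\<lambda>s. Q (k s)))) T"
    using has_integral_linear[OF integrable_integral[OF Qk] bounded_linear_R] by (simp add: o_def)
  have 2: "(k has_integral R (integral T (\<lambda>s. Q (k s)))) T"
    by (rule has_integral_spike_finite[OF N _ 1]) (simp add: mem)
  show "k integrable_on T" using 2 by (auto simp: integrable_on_def)
  have eq: "integral T k = R (integral T (\<lambda>s. Q (k s)))" using 2 by (rule integral_unique)
  show "integral T k \<in> carr Z" "Q (integral T k) = integral T (\<lambda>s. Q (k s))" by (simp_all add: eq)
  have i1: "((\<lambda>s. if s \<in> N then 0 else Q (k s)) has_integral integral T (\<lambda>s. Q (k s))) T"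
    by (rule has_integral_spike_finite[OF N _ integrable_integral[OF Qk]]) simp
  have i2: "((\<lambda>s. if s \<in> N then 0 else b s) has_integral integral T b) T"
    by (rule has_integral_spike_finite[OF N _ integrable_integral[OF b]]) simp
  interpret R: bounded_linear R by (rule bounded_linear_R)
  obtain K where K: "K > 0" "\<And>x. x \<in> carr Z \<Longrightarrow> nrm Z x \<le> K * norm (Q x)" using nrm_bound by blast
  have "nrm Z (R (integral T (\<lambda>s. Q (k s)))) \<le> integral T b"
  proof (rule sublinear_integral_bound[OF i1 i2, where \<phi> = "\<lambda>x. nrm Z (R x)"])
    have lip: "nrm Z (R x) - nrm Z (R y) \<le> K * norm (x - y)" for x y
      using nD(7)[of "R x - R y" "R y"] K(2)[of "R x - R y"] nD by (simp add: Q_diff)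
    have "K-lipschitz_on UNIV (\<lambda>x. nrm Z (R x))"
    proof (rule lipschitz_onI)
      show "dist (nrm Z (R x)) (nrm Z (R y)) \<le> K * dist x y" for x y
        using lip[of x y] lip[of y x] by (simp add: dist_norm norm_minus_commute abs_le_iff)
    qed (use K in simp)
    then show "continuous_on UNIV (\<lambda>x. nrm Z (R x))" by (rule lipschitz_on_continuous_on)
    show "nrm Z (R (x + y)) \<le> nrm Z (R x) + nrm Z (R y)" for x y by (simp add: R.add nD)
    show "nrm Z (R (c *\<^sub>R x)) = c * nrm Z (R x)" if "0 \<le> c" for c x using that by (simp add: R.scaleR nD)
    show "nrm Z (R (if s \<in> N then 0 else Q (k s))) \<le> (if s \<in> N then 0 else b s)" if "s \<in> T" for s
      using that mem le by (simp add: R.zero nD)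
  qed
  then show "nrm Z (integral T k) \<le> integral T b" by (simp add: eq)
qed

end

section \<open>Semigroups on the domain of an operator\<close>

text \<open>
  A strongly continuous one-parameter semigroup that commutes with \<open>Q\<close>. The value \<open>T 0\<close> need not be the
  identity, so that the locale covers a semigroup precomposed with an invariant projection.
\<close>

locale semigroup_graph = graph_space Z Q for Z :: "'a::banach nspace" and Q +
  fixes T :: "real \<Rightarrow> 'a \<Rightarrow> 'a"
  assumes T_bl: "\<And>t. 0 \<le> t \<Longrightarrow> bounded_linear (T t)"
    and T_add: "\<And>s t x. 0 \<le> s \<Longrightarrow> 0 \<le> t \<Longrightarrow> T (s + t) x = T s (T t x)"
    and T_growth: "\<exists>M \<omega>. \<forall>t\<ge>0. \<forall>x. norm (T t x) \<le> M * exp (\<omega> * t) * norm x"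
    and T_cont: "\<And>x. continuous_on {0..} (\<lambda>t. T t x)"
    and T_mem: "\<And>t x. 0 \<le> t \<Longrightarrow> x \<in> carr Z \<Longrightarrow> T t x \<in> carr Z"
    and Q_T: "\<And>t x. 0 \<le> t \<Longrightarrow> x \<in> carr Z \<Longrightarrow> Q (T t x) = T t (Q x)"
begin

lemma T_linear: "0 \<le> t \<Longrightarrow> linear (T t)"
  using T_bl bounded_linear.linear by blast

text \<open>
  Joint continuity, from strong continuity and local uniform boundedness.
\<close>

lemma T_tendsto:
  assumes \<tau>: "(\<tau> \<longlongrightarrow> t) Fl" and v: "(v \<longlongrightarrow> x) Fl" and pos: "\<forall>\<^sub>F r in Fl. 0 \<le> \<tau> r" "0 \<le> t"
  shows "((\<lambda>r. T (\<tau> r) (v r)) \<longlongrightarrow> T t x) Fl"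
proof -
  obtain M \<omega> where M: "\<And>t x. 0 \<le> t \<Longrightarrow> norm (T t x) \<le> M * exp (\<omega> * t) * norm x" using T_growth by blast
  have 1: "((\<lambda>r. T (\<tau> r) x) \<longlongrightarrow> T t x) Fl"
    by (rule continuous_on_tendsto_compose[OF T_cont \<tau>]) (use pos in auto)
  have 2: "((\<lambda>r. T (\<tau> r) (v r - x)) \<longlongrightarrow> 0) Fl"
  proof (rule Lim_null_comparison)
    show "\<forall>\<^sub>F r in Fl. norm (T (\<tau> r) (v r - x)) \<le> M * exp (\<omega> * \<tau> r) * norm (v r - x)"
      using pos(1) by eventually_elim (rule M)
    have "((\<lambda>r. M * exp (\<omega> * \<tau> r) * norm (v r - x)) \<longlongrightarrow> M * exp (\<omega> * t) * norm (x - x)) Fl"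
      by (intro tendsto_intros \<tau> v)
    then show "((\<lambda>r. M * exp (\<omega> * \<tau> r) * norm (v r - x)) \<longlongrightarrow> 0) Fl" by simp
  qed
  have "((\<lambda>r. T (\<tau> r) (v r - x) + T (\<tau> r) x) \<longlongrightarrow> 0 + T t x) Fl" by (intro tendsto_add 1 2)
  moreover have "\<forall>\<^sub>F r in Fl. T (\<tau> r) (v r - x) + T (\<tau> r) x = T (\<tau> r) (v r)"
    using pos(1) by eventually_elim (simp add: linear_diff[OF T_linear])
  ultimately show ?thesis by (simp add: filterlim_cong)
qed

lemma T_continuous_on:
  assumes "continuous_on A \<tau>" "continuous_on A v" "\<And>r. r \<in> A \<Longrightarrow> 0 \<le> \<tau> r"
  shows "continuous_on A (\<lambda>r. T (\<tau> r) (v r))"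
  using assms unfolding continuous_on_def
  by (auto intro!: T_tendsto simp: eventually_at_filter)

end

section \<open>Convolutions in weighted spaces of paths\<close>

text \<open>
  Paths on \<open>(-\<infinity>, 0]\<close> that grow at most like \<open>exp (\<eta> * s)\<close> as \<open>s \<rightarrow> -\<infinity>\<close> and are continuous except possibly at
  \<open>p\<close>. For \<open>p = 1\<close> they are continuous on all of \<open>(-\<infinity>, 0]\<close>.
\<close>

definition weighted_paths :: "'e::real_vector nspace \<Rightarrow> real \<Rightarrow> real \<Rightarrow> (real \<Rightarrow> 'e) set" where
  "weighted_paths E p \<eta> = {w. (\<forall>s\<le>0. w s \<in> carr E) \<and>
     continuous_map (top_of_set ({..0} - {p})) (ntop E) w \<and>
     (\<exists>M. \<forall>s\<le>0. nrm E (w s) \<le> M * exp (\<eta> * s))}"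

lemma weighted_paths_mem: "w \<in> weighted_paths E p \<eta> \<Longrightarrow> s \<le> 0 \<Longrightarrow> w s \<in> carr E"
  by (simp add: weighted_paths_def)

lemma weighted_paths_zero:
  assumes "normed_nspace E" shows "(\<lambda>s. 0) \<in> weighted_paths E p \<eta>"
  using normed_nspaceD[OF assms] by (auto simp: weighted_paths_def continuous_map_ntop_iff[OF assms] intro!: exI[of _ 0])

lemma weighted_paths_diff_bound:
  assumes E: "normed_nspace E" and w: "w \<in> weighted_paths E p \<eta>" and v: "v \<in> weighted_paths E p \<eta>"
  obtains M where "\<forall>s\<le>0. nrm E (w s - v s) \<le> M * exp (\<eta> * s)"
proof -
  obtain M1 M2 where M: "\<And>s. s \<le> 0 \<Longrightarrow> nrm E (w s) \<le> M1 * exp (\<eta> * s)" "\<And>s. s \<le> 0 \<Longrightarrow> nrm E (v s) \<le> M2 * exp (\<eta> * s)"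
    using w v unfolding weighted_paths_def by blast
  have "nrm E (w s - v s) \<le> (M1 + M2) * exp (\<eta> * s)" if "s \<le> 0" for s
    using nrm_diff_le[OF E weighted_paths_mem[OF w that] weighted_paths_mem[OF v that]] M[OF that]
    by (simp add: distrib_right)
  then show ?thesis using that by blast
qed

lemma weighted_paths_shift:
  assumes w: "w \<in> weighted_paths E p \<eta>" and t: "t \<le> 0"
  shows "(\<lambda>r. w (t + r)) \<in> weighted_paths E (p - t) \<eta>"
proof -
  have "continuous_map (top_of_set ({..0} - {p - t})) (top_of_set ({..0} - {p})) (\<lambda>r. t + r)"
    using t by (auto intro!: continuous_intros)
  moreover have "continuous_map (top_of_set ({..0} - {p})) (ntop E) w"
    using w by (simp add: weighted_paths_def)
  ultimately have "continuous_map (top_of_set ({..0} - {p - t})) (ntop E) (w \<circ> (\<lambda>r. t + r))"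
    by (rule continuous_map_compose)
  moreover obtain M where M: "\<And>s. s \<le> 0 \<Longrightarrow> nrm E (w s) \<le> M * exp (\<eta> * s)"
    using w unfolding weighted_paths_def by blast
  then have "\<And>r. r \<le> 0 \<Longrightarrow> nrm E (w (t + r)) \<le> M * exp (\<eta> * t) * exp (\<eta> * r)"
    using t by (simp add: mult.assoc flip: exp_add distrib_left)
  ultimately show ?thesis using t w by (auto simp: weighted_paths_def o_def)
qed

context graph_space begin

lemma ray_integral:
  fixes t p :: real
  assumes mem: "\<And>s. s < t \<Longrightarrow> s \<noteq> p \<Longrightarrow> k s \<in> carr Z"
    and cont: "continuous_on ({..<t} - {p}) (\<lambda>s. Q (k s))"
    and le: "\<And>s. s < t \<Longrightarrow> s \<noteq> p \<Longrightarrow> nrm Z (k s) \<le> b s"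
    and b: "(b has_integral I) {..t}" and b0: "\<And>s. 0 \<le> b s"
  shows "(\<lambda>s. Q (k s)) integrable_on {..t}" "k integrable_on {..t}" "integral {..t} k \<in> carr Z"
    "Q (integral {..t} k) = integral {..t} (\<lambda>s. Q (k s))" "nrm Z (integral {..t} k) \<le> I"
proof -
  obtain K where K: "K > 0" "\<And>x. x \<in> carr Z \<Longrightarrow> norm (Q x) \<le> K * nrm Z x" using Q_bound by blast
  have bi: "b integrable_on {..t}" using b by (auto simp: integrable_on_def)
  show 1: "(\<lambda>s. Q (k s)) integrable_on {..t}"
  proof (rule dominated_integrable_ray_except[OF cont])
    show "(\<lambda>s. K * b s) integrable_on {..t}" by (rule integrable_on_mult_right[OF bi])
    show "norm (Q (k s)) \<le> K * b s" if "s < t" "s \<noteq> p" for s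
      using K(2)[OF mem[OF that]] mult_left_mono[OF le[OF that], of K] K(1) by linarith
    show "0 \<le> K * b s" for s using K(1) b0 by simp
  qed
  have N: "finite {t, p}" by simp
  have m: "k s \<in> carr Z" "nrm Z (k s) \<le> b s" if "s \<in> {..t} - {t, p}" for s
    using that mem le by auto
  show "k integrable_on {..t}" "integral {..t} k \<in> carr Z"
    "Q (integral {..t} k) = integral {..t} (\<lambda>s. Q (k s))" "nrm Z (integral {..t} k) \<le> I"
    using graph_integral[OF N m 1 bi] integral_unique[OF b] by simp_all
qed

lemma Lipschitz_path_continuous:
  assumes E: "normed_nspace E" and w: "w \<in> weighted_paths E p \<eta>"
    and k: "\<And>q. q \<in> carr E \<Longrightarrow> k q \<in> carr Z"
    and le: "\<And>q r. q \<in> carr E \<Longrightarrow> r \<in> carr E \<Longrightarrow> nrm Z (k q - k r) \<le> C * nrm E (q - r)"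
  shows "continuous_on ({..0} - {p}) (\<lambda>s. Q (k (w s)))"
proof -
  have mem: "w s \<in> carr E" if "s \<in> {..0} - {p}" for s using w that by (simp add: weighted_paths_mem)
  show ?thesis
  proof (subst continuous_on_Q_iff)
    show "k (w s) \<in> carr Z" if "s \<in> {..0} - {p}" for s by (rule k[OF mem[OF that]])
    show "\<forall>s\<in>{..0} - {p}. \<forall>e>0. \<exists>d>0. \<forall>q\<in>{..0} - {p}. dist q s < d \<longrightarrow> nrm Z (k (w q) - k (w s)) < e"
    proof (intro ballI allI impI)
      fix s e :: real assume s: "s \<in> {..0} - {p}" and e: "e > 0"
      have e': "e / (\<bar>C\<bar> + 1) > 0" using e by (simp add: add_nonneg_pos)
      obtain d where d: "d > 0" "\<forall>q\<in>{..0} - {p}. dist q s < d \<longrightarrow> nrm E (w q - w s) < e / (\<bar>C\<bar> + 1)"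
        using w[unfolded weighted_paths_def continuous_map_ntop_iff[OF E]] s e' by blast
      have "nrm Z (k (w q) - k (w s)) < e" if q: "q \<in> {..0} - {p}" "dist q s < d" for q
      proof -
        have n: "0 \<le> nrm E (w q - w s)" "nrm E (w q - w s) < e / (\<bar>C\<bar> + 1)"
          using d q normed_nspaceD(4)[OF E normed_nspaceD(9)[OF E mem[OF q(1)] mem[OF s]]] by auto
        have "nrm Z (k (w q) - k (w s)) \<le> C * nrm E (w q - w s)" by (rule le[OF mem[OF q(1)] mem[OF s]])
        also have "\<dots> \<le> (\<bar>C\<bar> + 1) * nrm E (w q - w s)" by (rule mult_right_mono) (use n in auto)
        also have "\<dots> < (\<bar>C\<bar> + 1) * (e / (\<bar>C\<bar> + 1))" by (rule mult_strict_left_mono) (use n in auto)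
        also have "\<dots> = e" by simp
        finally show ?thesis .
      qed
      then show "\<exists>d>0. \<forall>q\<in>{..0} - {p}. dist q s < d \<longrightarrow> nrm Z (k (w q) - k (w s)) < e"
        using d(1) by blast
    qed
  qed
qed

end

text \<open>
  The setting of an integral of the form \<open>\<integral>\<^bsub>-\<infinity>\<^esub>\<^sup>t T (t - s) (\<phi> (w s)) ds\<close>. The semigroup smoothes the nonlinearity: the
  values \<open>\<phi> p\<close> need not lie in \<open>Z\<close>, but \<open>T r (\<phi> p)\<close> does for \<open>r > 0\<close>, and it depends on \<open>p\<close> in a Lipschitz way with
  the integrable constant \<open>c * r powr (\<theta> - 1) * exp (\<omega> * r)\<close>. The intermediate space through which this
  smoothing acts does not enter.
\<close>

locale smoothing_convolution = semigroup_graph Z Q T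
  for Z :: "'a::banach nspace" and Q T +
  fixes E :: "'e::real_vector nspace" and \<phi> :: "'e \<Rightarrow> 'a" and c \<theta> \<omega> \<eta> :: real
  assumes E: "normed_nspace E" and \<phi>_0: "\<phi> 0 = 0"
    and c_nonneg: "0 \<le> c" and \<theta>_pos: "0 < \<theta>" and \<omega>_less: "\<omega> < \<eta>"
    and smoothing_mem: "\<And>r p. 0 < r \<Longrightarrow> p \<in> carr E \<Longrightarrow> T r (\<phi> p) \<in> carr Z"
    and smoothing_le: "\<And>r p q. 0 < r \<Longrightarrow> p \<in> carr E \<Longrightarrow> q \<in> carr E \<Longrightarrow>
      nrm Z (T r (\<phi> p) - T r (\<phi> q)) \<le> c * r powr (\<theta> - 1) * exp (\<omega> * r) * nrm E (p - q)"
begin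

text \<open>
  The convolution of the semigroup with the nonlinearity along \<open>w\<close>.
\<close>

definition conv :: "(real \<Rightarrow> 'e) \<Rightarrow> real \<Rightarrow> 'a" where
  "conv w t = integral {..t} (\<lambda>s. T (t - s) (\<phi> (w s)))"

text \<open>
  The Lipschitz constant of \<open>conv\<close> for the norm \<open>sup exp (- \<eta> * s) * nrm (w s)\<close>. It is the Laplace
  transform of \<open>c * r powr (\<theta> - 1)\<close> at \<open>\<eta> - \<omega>\<close>.
\<close>

definition contraction :: real where
  "contraction = c * Gamma \<theta> / (\<eta> - \<omega>) powr \<theta>"

lemma contraction_nonneg: "0 \<le> contraction"
  using c_nonneg \<theta>_pos Gamma_real_pos[of \<theta>] by (auto simp: contraction_def)

lemma kernel_has_integral:
  "((\<lambda>s. C * ((t - s) powr (\<theta> - 1) * exp (- (\<eta> - \<omega>) * (t - s)))) has_integral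
     C * (Gamma \<theta> / (\<eta> - \<omega>) powr \<theta>)) {..t}"
  by (rule has_integral_mult_right[OF Gamma_kernel_integral]) (use \<theta>_pos \<omega>_less in auto)

lemma smoothed_continuous:
  assumes r: "0 < r" and w: "w \<in> weighted_paths E p \<eta>"
  shows "continuous_on ({..0} - {p}) (\<lambda>s. Q (T r (\<phi> (w s))))"
  by (rule Lipschitz_path_continuous[OF E w, where k = "\<lambda>q. T r (\<phi> q)"])
     (rule smoothing_mem[OF r] smoothing_le[OF r], assumption+)+

lemma integrand_continuous:
  assumes w: "w \<in> weighted_paths E p \<eta>" and t: "t \<le> 0"
  shows "continuous_on ({..<t} - {p}) (\<lambda>s. Q (T (t - s) (\<phi> (w s))))"
proof -
  have op: "open ({..<a} - {p})" for a :: real by (simp add: open_Diff)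
  have "isCont (\<lambda>s. Q (T (t - s) (\<phi> (w s)))) s0" if s0: "s0 \<in> {..<t} - {p}" for s0
  proof -
    \<comment> \<open>A fixed part \<open>d\<close> of the elapsed time is spent on smoothing; the rest acts continuously on \<open>Z\<close>.\<close>
    define d where "d = (t - s0) / 2"
    have d: "d > 0" "s0 < t - d" using s0 by (auto simp: d_def field_simps)
    have "continuous_on ({..<t - d} - {p}) (\<lambda>s. T (t - d - s) (Q (T d (\<phi> (w s)))))"
    proof (rule T_continuous_on)
      show "continuous_on ({..<t - d} - {p}) (\<lambda>s. t - d - s)" by (intro continuous_intros)
      show "continuous_on ({..<t - d} - {p}) (\<lambda>s. Q (T d (\<phi> (w s))))"
        by (rule continuous_on_subset[OF smoothed_continuous[OF d(1) w]]) (use t d in auto)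
    qed auto
    moreover have "T (t - d - s) (Q (T d (\<phi> (w s)))) = Q (T (t - s) (\<phi> (w s)))" if "s \<in> {..<t - d} - {p}" for s
    proof -
      have s: "0 \<le> t - d - s" "w s \<in> carr E" using that t d w by (auto simp: weighted_paths_mem)
      show ?thesis
        using Q_T[OF s(1) smoothing_mem[OF d(1) s(2)]] T_add[OF s(1), of d "\<phi> (w s)"] d by simp
    qed
    ultimately have "continuous_on ({..<t - d} - {p}) (\<lambda>s. Q (T (t - s) (\<phi> (w s))))"
      by (rule continuous_on_eq)
    then show ?thesis using s0 d unfolding continuous_on_eq_continuous_at[OF op] by blast
  qed
  then show ?thesis unfolding continuous_on_eq_continuous_at[OF op] by blast
qed

lemma weighted_kernel:
  fixes s t M :: real
  shows "c * (t - s) powr (\<theta> - 1) * exp (\<omega> * (t - s)) * (M * exp (\<eta> * s))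
    = c * M * exp (\<eta> * t) * ((t - s) powr (\<theta> - 1) * exp (- (\<eta> - \<omega>) * (t - s)))"
proof -
  have "exp (\<omega> * (t - s)) * exp (\<eta> * s) = exp (\<eta> * t) * exp (- (\<eta> - \<omega>) * (t - s))"
    by (simp add: algebra_simps flip: exp_add)
  then show ?thesis by (simp add: mult_ac)
qed

text \<open>
  The difference of two integrands is integrated first; comparison with the zero path then gives
  integrability of a single one.
\<close>

lemma conv_diff:
  assumes w: "w \<in> weighted_paths E p \<eta>" and v: "v \<in> weighted_paths E p \<eta>" and t: "t \<le> 0"
    and M: "\<forall>s\<le>0. nrm E (w s - v s) \<le> M * exp (\<eta> * s)"
  defines "D \<equiv> \<lambda>s. T (t - s) (\<phi> (w s)) - T (t - s) (\<phi> (v s))"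
  shows "(\<lambda>s. Q (D s)) integrable_on {..t}" "D integrable_on {..t}" "integral {..t} D \<in> carr Z"
    "Q (integral {..t} D) = integral {..t} (\<lambda>s. Q (D s))"
    "nrm Z (integral {..t} D) \<le> contraction * M * exp (\<eta> * t)"
proof -
  have mem: "w s \<in> carr E" "v s \<in> carr E" if "s \<le> 0" for s using w v that by (auto simp: weighted_paths_mem)
  have "0 \<le> nrm E (w 0 - v 0)" using mem[of 0] normed_nspaceD(4,9)[OF E] by simp
  also have "\<dots> \<le> M" using M[rule_format, of 0] by simp
  finally have M0: "0 \<le> M" .
  let ?C = "c * M * exp (\<eta> * t)"
  have DZ: "D s \<in> carr Z" if "s < t" for s
    unfolding D_def using that t by (intro nD smoothing_mem mem) auto
  have cont: "continuous_on ({..<t} - {p}) (\<lambda>s. Q (D s))"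
  proof -
    have "continuous_on ({..<t} - {p}) (\<lambda>s. Q (T (t - s) (\<phi> (w s))) - Q (T (t - s) (\<phi> (v s))))"
      by (intro continuous_on_diff integrand_continuous w v t)
    moreover have "Q (T (t - s) (\<phi> (w s))) - Q (T (t - s) (\<phi> (v s))) = Q (D s)" if "s \<in> {..<t} - {p}" for s
      unfolding D_def using that t by (subst Q_diff) (auto intro!: smoothing_mem mem)
    ultimately show ?thesis by (rule continuous_on_eq)
  qed
  have le: "nrm Z (D s) \<le> ?C * ((t - s) powr (\<theta> - 1) * exp (- (\<eta> - \<omega>) * (t - s)))" if "s < t" for s
  proof -
    have s: "s \<le> 0" "0 < t - s" using that t by auto
    have "nrm Z (D s) \<le> c * (t - s) powr (\<theta> - 1) * exp (\<omega> * (t - s)) * nrm E (w s - v s)"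
      unfolding D_def by (rule smoothing_le[OF s(2) mem[OF s(1)]])
    also have "\<dots> \<le> c * (t - s) powr (\<theta> - 1) * exp (\<omega> * (t - s)) * (M * exp (\<eta> * s))"
      by (rule mult_left_mono[OF M[rule_format, OF s(1)]]) (simp add: c_nonneg)
    finally show ?thesis unfolding weighted_kernel .
  qed
  have b0: "0 \<le> ?C * ((t - s) powr (\<theta> - 1) * exp (- (\<eta> - \<omega>) * (t - s)))" for s
    using c_nonneg M0 by simp
  note I = ray_integral[OF DZ cont le kernel_has_integral b0]
  show "(\<lambda>s. Q (D s)) integrable_on {..t}" "D integrable_on {..t}" "integral {..t} D \<in> carr Z"
    "Q (integral {..t} D) = integral {..t} (\<lambda>s. Q (D s))" using I(1-4) by simp_all
  show "nrm Z (integral {..t} D) \<le> contraction * M * exp (\<eta> * t)"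
    using I(5) by (simp add: contraction_def mult_ac)
qed

lemma conv_basic:
  assumes w: "w \<in> weighted_paths E p \<eta>" and t: "t \<le> 0"
  shows "(\<lambda>s. T (t - s) (\<phi> (w s))) integrable_on {..t}" "conv w t \<in> carr Z"
    "(\<lambda>s. Q (T (t - s) (\<phi> (w s)))) integrable_on {..t}"
    "Q (conv w t) = integral {..t} (\<lambda>s. Q (T (t - s) (\<phi> (w s))))"
proof -
  have z: "T (t - s) (\<phi> 0) = 0" if "s \<le> t" for s using that linear_0[OF T_linear, of "t - s"] by (simp add: \<phi>_0)
  obtain M where M: "\<forall>s\<le>0. nrm E (w s - (\<lambda>s. 0) s) \<le> M * exp (\<eta> * s)"
    using weighted_paths_diff_bound[OF E w weighted_paths_zero[OF E]] by blast
  note D = conv_diff[OF w weighted_paths_zero[OF E] t M]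
  have eq: "T (t - s) (\<phi> (w s)) - T (t - s) (\<phi> 0) = T (t - s) (\<phi> (w s))" if "s \<in> {..t}" for s
    using z that by simp
  have int_eq: "integral {..t} (\<lambda>s. T (t - s) (\<phi> (w s)) - T (t - s) (\<phi> 0)) = conv w t"
    unfolding conv_def by (rule integral_cong) (rule eq)
  have int_eq2: "integral {..t} (\<lambda>s. Q (T (t - s) (\<phi> (w s)) - T (t - s) (\<phi> 0)))
      = integral {..t} (\<lambda>s. Q (T (t - s) (\<phi> (w s))))"
    by (rule integral_cong) (simp only: eq)
  show "(\<lambda>s. T (t - s) (\<phi> (w s))) integrable_on {..t}" by (rule integrable_eq[OF D(2)]) (rule eq)
  show "(\<lambda>s. Q (T (t - s) (\<phi> (w s)))) integrable_on {..t}"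
    by (rule integrable_eq[OF D(1)]) (simp only: eq)
  show "conv w t \<in> carr Z" using D(3) unfolding int_eq .
  show "Q (conv w t) = integral {..t} (\<lambda>s. Q (T (t - s) (\<phi> (w s))))" using D(4) unfolding int_eq int_eq2 .
qed

lemma conv_contraction:
  assumes w: "w \<in> weighted_paths E p \<eta>" and v: "v \<in> weighted_paths E p \<eta>" and t: "t \<le> 0"
    and M: "\<forall>s\<le>0. nrm E (w s - v s) \<le> M * exp (\<eta> * s)"
  shows "nrm Z (conv w t - conv v t) \<le> contraction * M * exp (\<eta> * t)"
  using conv_diff(5)[OF w v t M]
  unfolding conv_def integral_diff[OF conv_basic(1)[OF w t] conv_basic(1)[OF v t]] .

lemma conv_in_subspace:
  assumes w: "w \<in> weighted_paths E p \<eta>" and t: "t \<le> 0"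
    and V: "subspace V" "closed V" "\<And>r p. 0 \<le> r \<Longrightarrow> p \<in> carr E \<Longrightarrow> T r (\<phi> p) \<in> V"
  shows "conv w t \<in> V"
  unfolding conv_def
proof (rule has_integral_closed_convex_cone[OF integrable_integral[OF conv_basic(1)[OF w t]] V(2)])
  show "T (t - s) (\<phi> (w s)) \<in> V" if "s \<in> {..t}" for s
    using that t w by (intro V) (auto simp: weighted_paths_mem)
qed (use V in \<open>auto simp: subspace_0 subspace_add subspace_scale\<close>)

lemma conv_shift: "conv w (t + r) = conv (\<lambda>s. w (t + s)) r"
proof -
  have "(\<lambda>x. x + t) -` {..t + r} = {..r}" by auto
  then show ?thesis
    using integral_translate[of t "{..t + r}" "\<lambda>s. T (t + r - s) (\<phi> (w s))"]
    by (simp add: conv_def add.commute)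
qed

text \<open>
  A shift of the variable of integration moves \<open>t\<close> into the path, where dominated convergence for the
  real functions \<open>\<lambda>r. norm (Q (D n r))\<close> applies.
\<close>

lemma conv_continuous:
  assumes w: "w \<in> weighted_paths E p \<eta>" and p: "p > 0"
  shows "continuous_on {..0} (\<lambda>t. Q (conv w t))"
proof (rule continuous_on_sequentiallyI)
  fix \<tau> t0 assume \<tau>: "\<forall>n. \<tau> n \<in> {..0::real}" and t0: "t0 \<in> {..0}" and lim: "\<tau> \<longlonglongrightarrow> t0"
  have set: "{..0} - {p} = {..0}" using p by auto
  have shift: "(\<lambda>r. w (t + r)) \<in> weighted_paths E 1 \<eta>" if "t \<le> 0" for t
  proof -
    have "{..0} - {p - t} = {..0}" "{..0} - {1} = {..0::real}" using p that by auto
    then show ?thesis using weighted_paths_shift[OF w that] by (simp add: weighted_paths_def)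
  qed
  obtain M where M: "\<And>s. s \<le> 0 \<Longrightarrow> nrm E (w s) \<le> M * exp (\<eta> * s)"
    using w unfolding weighted_paths_def by blast
  have "0 \<le> nrm E (w 0)" using normed_nspaceD(4)[OF E] w by (simp add: weighted_paths_mem)
  then have M0: "0 \<le> M" using M[of 0] by simp
  have "(\<lambda>n. exp (\<eta> * \<tau> n)) \<longlonglongrightarrow> exp (\<eta> * t0)" by (intro tendsto_intros lim)
  then have "Bseq (\<lambda>n. exp (\<eta> * \<tau> n))" using convergent_imp_Bseq convergentI by blast
  then obtain B where B: "B > 0" "\<And>n. exp (\<eta> * \<tau> n) \<le> B" by (auto simp: Bseq_def)
  define D where "D n r = T (0 - r) (\<phi> (w (\<tau> n + r))) - T (0 - r) (\<phi> (w (t0 + r)))" for n r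
  define C where "C = M * B + M * exp (\<eta> * t0)"
  have C: "nrm E (w (\<tau> n + r) - w (t0 + r)) \<le> C * exp (\<eta> * r)" if r: "r \<le> 0" for n r
  proof -
    have mem: "w (\<tau> n + r) \<in> carr E" "w (t0 + r) \<in> carr E" and neg: "\<tau> n + r \<le> 0" "t0 + r \<le> 0"
      using \<tau>[rule_format, of n] t0 r w by (auto simp: weighted_paths_mem)
    have "nrm E (w (\<tau> n + r) - w (t0 + r)) \<le> nrm E (w (\<tau> n + r)) + nrm E (w (t0 + r))"
      by (rule nrm_diff_le[OF E mem])
    also have "nrm E (w (\<tau> n + r)) \<le> M * B * exp (\<eta> * r)"
    proof -
      have "nrm E (w (\<tau> n + r)) \<le> M * (exp (\<eta> * \<tau> n) * exp (\<eta> * r))"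
        using M[OF neg(1)] by (simp add: exp_add distrib_left)
      also have "\<dots> \<le> M * (B * exp (\<eta> * r))" by (intro mult_left_mono mult_right_mono B M0) auto
      finally show ?thesis by (simp add: mult.assoc)
    qed
    also have "nrm E (w (t0 + r)) \<le> M * exp (\<eta> * t0) * exp (\<eta> * r)"
      using M[OF neg(2)] by (simp add: exp_add distrib_left mult.assoc)
    finally show ?thesis by (simp add: C_def algebra_simps)
  qed
  have conv0: "conv w t = conv (\<lambda>r. w (t + r)) 0" for t using conv_shift[of w t 0] by simp
  have t0': "t0 \<le> 0" and \<tau>': "\<tau> n \<le> 0" for n using t0 \<tau> by auto
  have C': "\<forall>r\<le>0. nrm E (w (\<tau> n + r) - w (t0 + r)) \<le> C * exp (\<eta> * r)" for n using C by blast
  note D = conv_diff[OF shift[OF \<tau>'] shift[OF t0'] order_refl C', folded D_def]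
  have D_eq: "Q (conv w (\<tau> n)) - Q (conv w t0) = integral {..0} (\<lambda>r. Q (D n r))" for n
  proof -
    have "integral {..0} (D n) = conv w (\<tau> n) - conv w t0"
      unfolding conv0[of "\<tau> n"] conv0[of t0] unfolding conv_def D_def
      by (rule integral_diff[OF conv_basic(1)[OF shift[OF \<tau>'] order_refl] conv_basic(1)[OF shift[OF t0'] order_refl]])
    then show ?thesis using D(4)[of n] Q_diff[OF conv_basic(2)[OF w \<tau>'] conv_basic(2)[OF w t0']] by simp
  qed
  have ray: "integral {..0} g = integral {..<0::real} g" "g integrable_on {..0} \<longleftrightarrow> g integrable_on {..<0}"
    for g :: "real \<Rightarrow> 'a"
    by (rule integral_spike_set integrable_spike_set_eq;
        rule negligible_subset[of "{0::real}"]; auto)+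
  obtain K where K: "K > 0" "\<And>x. x \<in> carr Z \<Longrightarrow> norm (Q x) \<le> K * nrm Z x" using Q_bound by blast
  define h where "h r = K * (c * C * ((0 - r) powr (\<theta> - 1) * exp (- (\<eta> - \<omega>) * (0 - r))))" for r
  have DZ: "D n r \<in> carr Z" if "r < 0" for n r
    unfolding D_def using that \<tau>'[of n] t0' w by (intro nD smoothing_mem) (auto simp: weighted_paths_mem)
  have D_le: "norm (Q (D n r)) \<le> h r" if r: "r < 0" for n r
  proof -
    have mem: "w (\<tau> n + r) \<in> carr E" "w (t0 + r) \<in> carr E" using \<tau>'[of n] t0' r w by (auto simp: weighted_paths_mem)
    have "nrm Z (D n r) \<le> c * (0 - r) powr (\<theta> - 1) * exp (\<omega> * (0 - r)) * nrm E (w (\<tau> n + r) - w (t0 + r))"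
      unfolding D_def by (rule smoothing_le[OF _ mem]) (use r in simp)
    also have "\<dots> \<le> c * (0 - r) powr (\<theta> - 1) * exp (\<omega> * (0 - r)) * (C * exp (\<eta> * r))"
      by (rule mult_left_mono[OF C]) (use r in \<open>auto simp: c_nonneg\<close>)
    finally have "nrm Z (D n r) \<le> c * C * ((0 - r) powr (\<theta> - 1) * exp (- (\<eta> - \<omega>) * (0 - r)))"
      unfolding weighted_kernel by simp
    then show ?thesis using K(2)[OF DZ[OF r]] mult_left_mono[of _ _ K] K(1) unfolding h_def
      by (smt (verit))
  qed
  have h_int: "h integrable_on {..<0}"
  proof (rule nonneg_integrable_subset)
    show "h integrable_on {..0}" unfolding h_def
      by (rule integrable_on_mult_right[OF has_integral_integrable[OF kernel_has_integral]])
    have "0 \<le> C" using M0 B by (simp add: C_def)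
    then show "0 \<le> h s" for s using K c_nonneg by (simp add: h_def)
  qed auto
  have shiftc: "continuous_on ({..<0} - {1}) (\<lambda>r. Q (T (0 - r) (\<phi> (w (t + r)))))" if "t \<le> 0" for t
    by (rule integrand_continuous[OF shift[OF that] order_refl])
  have nint: "(\<lambda>r. norm (Q (D n r))) integrable_on {..<0}" for n
  proof (rule dominated_integrable_ray[OF _ h_int])
    have s1: "{..<0} - {1} = {..<0::real}" by auto
    have "continuous_on {..<0} (\<lambda>r. Q (T (0 - r) (\<phi> (w (\<tau> n + r)))) - Q (T (0 - r) (\<phi> (w (t0 + r)))))"
      by (intro continuous_on_diff shiftc[unfolded s1] \<tau>' t0')
    moreover have "Q (T (0 - r) (\<phi> (w (\<tau> n + r)))) - Q (T (0 - r) (\<phi> (w (t0 + r)))) = Q (D n r)" if "r \<in> {..<0}" for r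
      unfolding D_def using that \<tau>'[of n] t0' w
      by (subst Q_diff) (auto intro!: smoothing_mem simp: weighted_paths_mem)
    ultimately have "continuous_on {..<0} (\<lambda>r. Q (D n r))" by (rule continuous_on_eq)
    then show "continuous_on {..<0} (\<lambda>r. norm (Q (D n r)))" by (rule continuous_on_norm)
  qed (use D_le in simp)
  have "(\<lambda>n. integral {..<0} (\<lambda>r. norm (Q (D n r)))) \<longlonglongrightarrow> integral {..<0} (\<lambda>r::real. 0)"
  proof (rule dominated_convergence(2)[where h = h, OF nint h_int])
    show "norm (norm (Q (D n r))) \<le> h r" if "r \<in> {..<0}" for n r using D_le that by simp
    show "(\<lambda>n. norm (Q (D n r))) \<longlonglongrightarrow> 0" if r: "r \<in> {..<0}" for r
    proof -
      have cr: "continuous_on {..0} (\<lambda>s. Q (T (0 - r) (\<phi> (w s))))"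
        using smoothed_continuous[of "0 - r", OF _ w] r unfolding set by simp
      have "(\<lambda>n. Q (T (0 - r) (\<phi> (w (\<tau> n + r))))) \<longlonglongrightarrow> Q (T (0 - r) (\<phi> (w (t0 + r))))"
      proof (rule continuous_on_tendsto_compose[OF cr])
        show "(\<lambda>n. \<tau> n + r) \<longlonglongrightarrow> t0 + r" by (intro tendsto_intros lim)
        show "t0 + r \<in> {..0}" "\<forall>\<^sub>F n in sequentially. \<tau> n + r \<in> {..0}"
          using t0' \<tau>' r by (auto intro!: always_eventually add_nonpos_nonpos)
      qed
      then have "(\<lambda>n. Q (T (0 - r) (\<phi> (w (\<tau> n + r)))) - Q (T (0 - r) (\<phi> (w (t0 + r))))) \<longlonglongrightarrow> 0"
        using LIM_zero by blast
      moreover have "Q (T (0 - r) (\<phi> (w (\<tau> n + r)))) - Q (T (0 - r) (\<phi> (w (t0 + r)))) = Q (D n r)" for n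
        unfolding D_def using r \<tau>'[of n] t0' w
        by (subst Q_diff) (auto intro!: smoothing_mem simp: weighted_paths_mem)
      ultimately show ?thesis using tendsto_norm_zero by simp
    qed
  qed
  then have lim0: "(\<lambda>n. integral {..<0} (\<lambda>r. norm (Q (D n r)))) \<longlonglongrightarrow> 0" by simp
  have "(\<lambda>n. Q (conv w (\<tau> n)) - Q (conv w t0)) \<longlonglongrightarrow> 0"
  proof (rule Lim_null_comparison[OF _ lim0], rule always_eventually, rule allI)
    fix n
    have "(\<lambda>r. Q (D n r)) integrable_on {..<0}" using D(1)[of n] unfolding ray by simp
    from integral_norm_bound_integral[OF this nint[of n]]
    show "norm (Q (conv w (\<tau> n)) - Q (conv w t0)) \<le> integral {..<0} (\<lambda>r. norm (Q (D n r)))"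
      unfolding D_eq ray by simp
  qed
  then show "(\<lambda>n. Q (conv w (\<tau> n))) \<longlonglongrightarrow> Q (conv w t0)" using LIM_zero_iff by blast
qed

end

text \<open>
  The setting of an integral of the form \<open>\<integral>\<^sub>t\<^sup>0 G (s - t) (\<psi> (w s)) ds\<close>, where \<open>G\<close> is the slow group run backwards in
  time. There is no smoothing here: \<open>\<psi>\<close> has its values in \<open>Z\<close>.
\<close>

locale slow_convolution = semigroup_graph Z Q G
  for Z :: "'a::banach nspace" and Q G +
  fixes E :: "'e::real_vector nspace" and \<psi> :: "'e \<Rightarrow> 'a" and c \<sigma> \<eta> :: real
  assumes E: "normed_nspace E" and c_nonneg: "0 \<le> c" and \<sigma>_greater: "\<eta> < \<sigma>"
    and \<psi>_0: "\<psi> 0 = 0"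
    and slow_mem: "\<And>p. p \<in> carr E \<Longrightarrow> \<psi> p \<in> carr Z"
    and slow_Lipschitz: "\<exists>C. \<forall>p\<in>carr E. \<forall>q\<in>carr E. nrm Z (\<psi> p - \<psi> q) \<le> C * nrm E (p - q)"
    and slow_le: "\<And>r p q. 0 \<le> r \<Longrightarrow> p \<in> carr E \<Longrightarrow> q \<in> carr E \<Longrightarrow>
      nrm Z (G r (\<psi> p) - G r (\<psi> q)) \<le> c * exp (- \<sigma> * r) * nrm E (p - q)"
begin

text \<open>
  The backward convolution of the slow group with the nonlinearity along \<open>w\<close>.
\<close>

definition conv :: "(real \<Rightarrow> 'e) \<Rightarrow> real \<Rightarrow> 'a" where
  "conv w t = integral {t..0} (\<lambda>s. G (s - t) (\<psi> (w s)))"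

text \<open>
  The Lipschitz constant of the backward \<open>conv\<close> for the norm \<open>sup exp (- \<eta> * s) * nrm (w s)\<close>.
\<close>

definition contraction :: real where "contraction = c / (\<sigma> - \<eta>)"

lemma contraction_nonneg: "0 \<le> contraction"
  using c_nonneg \<sigma>_greater by (simp add: contraction_def)

lemma Q_\<psi>_continuous:
  assumes w: "w \<in> weighted_paths E p \<eta>"
  shows "continuous_on ({..0} - {p}) (\<lambda>s. Q (\<psi> (w s)))"
proof -
  obtain C where C: "\<forall>p\<in>carr E. \<forall>q\<in>carr E. nrm Z (\<psi> p - \<psi> q) \<le> C * nrm E (p - q)"
    using slow_Lipschitz by blast
  show ?thesis by (rule Lipschitz_path_continuous[OF E w slow_mem, where C = C]) (use C in auto)
qed

lemma slow_kernel_integral: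
  assumes "t \<le> 0" "0 \<le> C"
  shows "(\<lambda>s. C * exp (- (\<sigma> - \<eta>) * (s - t))) integrable_on {t..0}"
    "integral {t..0} (\<lambda>s. C * exp (- (\<sigma> - \<eta>) * (s - t))) \<le> C / (\<sigma> - \<eta>)"
proof -
  define l where "l = \<sigma> - \<eta>"
  have l: "l > 0" using \<sigma>_greater by (simp add: l_def)
  have "((\<lambda>s. C * exp (- l * (s - t))) has_integral
      (- (C / l) * exp (- l * (0 - t))) - (- (C / l) * exp (- l * (t - t)))) {t..0}"
  proof (rule fundamental_theorem_of_calculus[OF assms(1)])
    show "((\<lambda>s. - (C / l) * exp (- l * (s - t))) has_vector_derivative C * exp (- l * (s - t))) (at s within {t..0})" for s
      unfolding has_real_derivative_iff_has_vector_derivative[symmetric]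
      using l by (auto intro!: derivative_eq_intros simp: field_simps)
  qed
  moreover have "(- (C / l) * exp (- l * (0 - t))) - (- (C / l) * exp (- l * (t - t))) \<le> C / l"
    using l assms by simp
  ultimately show "(\<lambda>s. C * exp (- (\<sigma> - \<eta>) * (s - t))) integrable_on {t..0}"
    "integral {t..0} (\<lambda>s. C * exp (- (\<sigma> - \<eta>) * (s - t))) \<le> C / (\<sigma> - \<eta>)"
    unfolding l_def[symmetric] using has_integral_integrable integral_unique by metis+
qed

lemma Q_integrand:
  assumes w: "w \<in> weighted_paths E p \<eta>" and s: "t \<le> s" "s \<le> 0"
  shows "G (s - t) (\<psi> (w s)) \<in> carr Z" "Q (G (s - t) (\<psi> (w s))) = G (s - t) (Q (\<psi> (w s)))"
  using s w by (auto intro!: T_mem Q_T slow_mem simp: weighted_paths_mem)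

lemma integrand_continuous:
  assumes w: "w \<in> weighted_paths E p \<eta>"
  shows "continuous_on ({t..0} - {p}) (\<lambda>s. Q (G (s - t) (\<psi> (w s))))"
proof -
  have "continuous_on ({t..0} - {p}) (\<lambda>s. G (s - t) (Q (\<psi> (w s))))"
    by (rule T_continuous_on)
       (auto intro!: continuous_intros continuous_on_subset[OF Q_\<psi>_continuous[OF w]])
  then show ?thesis by (rule continuous_on_eq) (simp add: Q_integrand[OF w])
qed

lemma conv_diff:
  assumes w: "w \<in> weighted_paths E p \<eta>" and v: "v \<in> weighted_paths E p \<eta>" and t: "t \<le> 0"
    and M: "\<forall>s\<le>0. nrm E (w s - v s) \<le> M * exp (\<eta> * s)"
  defines "D \<equiv> \<lambda>s. G (s - t) (\<psi> (w s)) - G (s - t) (\<psi> (v s))"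
  shows "(\<lambda>s. Q (D s)) integrable_on {t..0}" "D integrable_on {t..0}" "integral {t..0} D \<in> carr Z"
    "Q (integral {t..0} D) = integral {t..0} (\<lambda>s. Q (D s))"
    "nrm Z (integral {t..0} D) \<le> contraction * M * exp (\<eta> * t)"
proof -
  have mem: "w s \<in> carr E" "v s \<in> carr E" if "s \<le> 0" for s using w v that by (auto simp: weighted_paths_mem)
  have "0 \<le> nrm E (w 0 - v 0)" using mem[of 0] normed_nspaceD(4,9)[OF E] by simp
  also have "\<dots> \<le> M" using M[rule_format, of 0] by simp
  finally have M0: "0 \<le> M" .
  let ?C = "c * M * exp (\<eta> * t)"
  have C0: "0 \<le> ?C" using c_nonneg M0 by simp
  note b = slow_kernel_integral[OF t C0]
  have DZ: "D s \<in> carr Z" if "s \<in> {t..0}" for s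
    unfolding D_def using that by (intro nD Q_integrand[OF w] Q_integrand[OF v]) auto
  have QD: "Q (D s) = Q (G (s - t) (\<psi> (w s))) - Q (G (s - t) (\<psi> (v s)))" if "s \<in> {t..0}" for s
    unfolding D_def using that by (intro Q_diff Q_integrand[OF w] Q_integrand[OF v]) auto
  have cont: "continuous_on ({t..0} - {p}) (\<lambda>s. Q (D s))"
    by (rule continuous_on_eq[OF continuous_on_diff[OF integrand_continuous[OF w] integrand_continuous[OF v]]])
       (simp add: QD)
  have le: "nrm Z (D s) \<le> ?C * exp (- (\<sigma> - \<eta>) * (s - t))" if "s \<in> {t..0}" for s
  proof -
    have "nrm Z (D s) \<le> c * exp (- \<sigma> * (s - t)) * nrm E (w s - v s)"
      unfolding D_def using that by (intro slow_le mem) auto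
    also have "\<dots> \<le> c * exp (- \<sigma> * (s - t)) * (M * exp (\<eta> * s))"
      using that by (intro mult_left_mono M[rule_format]) (auto simp: c_nonneg)
    also have "\<dots> = c * M * (exp (- \<sigma> * (s - t)) * exp (\<eta> * s))" by simp
    also have "exp (- \<sigma> * (s - t)) * exp (\<eta> * s) = exp (\<eta> * t) * exp (- (\<sigma> - \<eta>) * (s - t))"
      by (simp add: algebra_simps flip: exp_add)
    finally show ?thesis by (simp add: mult.assoc)
  qed
  obtain K where K: "K > 0" "\<And>x. x \<in> carr Z \<Longrightarrow> norm (Q x) \<le> K * nrm Z x" using Q_bound by blast
  show 1: "(\<lambda>s. Q (D s)) integrable_on {t..0}"
  proof (rule dominated_integrable_interval_except[OF cont])
    show "(\<lambda>s. K * (?C * exp (- (\<sigma> - \<eta>) * (s - t)))) integrable_on {t..0}"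
      using b(1) by (rule integrable_on_mult_right)
    show "norm (Q (D s)) \<le> K * (?C * exp (- (\<sigma> - \<eta>) * (s - t)))" if "t \<le> s" "s \<le> 0" for s
      using order_trans[OF K(2)[OF DZ] mult_left_mono[OF le]] that K(1) by simp
  qed
  have DZ': "D s \<in> carr Z" if "s \<in> {t..0} - {}" for s using DZ that by simp
  have le': "nrm Z (D s) \<le> ?C * exp (- (\<sigma> - \<eta>) * (s - t))" if "s \<in> {t..0} - {}" for s using le that by simp
  note I = graph_integral[OF finite.emptyI DZ' le' 1 b(1)]
  show "D integrable_on {t..0}" "integral {t..0} D \<in> carr Z"
    "Q (integral {t..0} D) = integral {t..0} (\<lambda>s. Q (D s))" using I(1-3) by simp_all
  show "nrm Z (integral {t..0} D) \<le> contraction * M * exp (\<eta> * t)"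
    using order_trans[OF I(4) b(2)] by (simp add: contraction_def mult_ac)
qed

lemma conv_basic:
  assumes w: "w \<in> weighted_paths E p \<eta>" and t: "t \<le> 0"
  shows "(\<lambda>s. G (s - t) (\<psi> (w s))) integrable_on {t..0}" "conv w t \<in> carr Z"
    "(\<lambda>s. Q (G (s - t) (\<psi> (w s)))) integrable_on {t..0}"
    "Q (conv w t) = integral {t..0} (\<lambda>s. Q (G (s - t) (\<psi> (w s))))"
proof -
  obtain M where M: "\<forall>s\<le>0. nrm E (w s - (\<lambda>s. 0) s) \<le> M * exp (\<eta> * s)"
    using weighted_paths_diff_bound[OF E w weighted_paths_zero[OF E]] by blast
  note D = conv_diff[OF w weighted_paths_zero[OF E] t M]
  have eq: "G (s - t) (\<psi> (w s)) - G (s - t) (\<psi> 0) = G (s - t) (\<psi> (w s))" if "s \<in> {t..0}" for s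
    using that linear_0[OF T_linear, of "s - t"] by (simp add: \<psi>_0)
  have int_eq: "integral {t..0} (\<lambda>s. G (s - t) (\<psi> (w s)) - G (s - t) (\<psi> 0)) = conv w t"
    unfolding conv_def by (rule integral_cong) (rule eq)
  have int_eq2: "integral {t..0} (\<lambda>s. Q (G (s - t) (\<psi> (w s)) - G (s - t) (\<psi> 0)))
      = integral {t..0} (\<lambda>s. Q (G (s - t) (\<psi> (w s))))"
    by (rule integral_cong) (simp only: eq)
  show "(\<lambda>s. G (s - t) (\<psi> (w s))) integrable_on {t..0}" by (rule integrable_eq[OF D(2)]) (rule eq)
  show "(\<lambda>s. Q (G (s - t) (\<psi> (w s)))) integrable_on {t..0}"
    by (rule integrable_eq[OF D(1)]) (simp only: eq)
  show "conv w t \<in> carr Z" using D(3) unfolding int_eq .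
  show "Q (conv w t) = integral {t..0} (\<lambda>s. Q (G (s - t) (\<psi> (w s))))" using D(4) unfolding int_eq int_eq2 .
qed

lemma conv_contraction:
  assumes w: "w \<in> weighted_paths E p \<eta>" and v: "v \<in> weighted_paths E p \<eta>" and t: "t \<le> 0"
    and M: "\<forall>s\<le>0. nrm E (w s - v s) \<le> M * exp (\<eta> * s)"
  shows "nrm Z (conv w t - conv v t) \<le> contraction * M * exp (\<eta> * t)"
  using conv_diff(5)[OF w v t M]
  unfolding conv_def integral_diff[OF conv_basic(1)[OF w t] conv_basic(1)[OF v t]] .

lemma conv_in_subspace:
  assumes w: "w \<in> weighted_paths E p \<eta>" and t: "t \<le> 0"
    and V: "subspace V" "closed V" "\<And>r p. 0 \<le> r \<Longrightarrow> p \<in> carr E \<Longrightarrow> G r (\<psi> p) \<in> V"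
  shows "conv w t \<in> V"
  unfolding conv_def
proof (rule has_integral_closed_convex_cone[OF integrable_integral[OF conv_basic(1)[OF w t]] V(2)])
  show "G (s - t) (\<psi> (w s)) \<in> V" if "s \<in> {t..0}" for s
    using that t w by (intro V) (auto simp: weighted_paths_mem)
qed (use V in \<open>auto simp: subspace_0 subspace_add subspace_scale\<close>)

lemma conv_continuous:
  assumes w: "w \<in> weighted_paths E p \<eta>" and p: "p > 0"
  shows "continuous_on {..0} (\<lambda>t. Q (conv w t))"
proof -
  have set: "{..0} - {p} = {..0}" using p by auto
  have cont: "continuous_on {..0} (\<lambda>s. Q (\<psi> (w s)))" using Q_\<psi>_continuous[OF w] unfolding set .
  have eq: "Q (conv w t) = integral (cbox 0 1) (\<lambda>\<tau>. (- t) *\<^sub>R G (- t * \<tau>) (Q (\<psi> (w (t - t * \<tau>)))))" if t: "t \<in> {..0}" for t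
  proof (cases "t = 0")
    case True
    then show ?thesis using conv_basic(4)[OF w, of t] by simp
  next
    case False
    then have t0: "t < 0" using t by simp
    have vim: "(\<lambda>x. - t * x + t) -` {t..0} = cbox 0 1"
      using t0 by (auto simp: zero_le_mult_iff mult_le_cancel_left mult_le_0_iff algebra_simps)
    have "((\<lambda>s. Q (G (s - t) (\<psi> (w s)))) has_integral Q (conv w t)) {t..0}"
      using conv_basic(3,4)[OF w, of t] t by (simp add: has_integral_integrable_integral)
    from has_integral_affine_vimage[OF this, of "- t" t] t0
    have "((\<lambda>\<tau>. Q (G (- t * \<tau> + t - t) (\<psi> (w (- t * \<tau> + t))))) has_integral (1 / \<bar>- t\<bar>) *\<^sub>R Q (conv w t)) (cbox 0 1)"
      unfolding vim by simp
    from has_integral_cmul[OF this, of "- t"] t0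
    have "((\<lambda>\<tau>. (- t) *\<^sub>R Q (G (- t * \<tau> + t - t) (\<psi> (w (- t * \<tau> + t))))) has_integral Q (conv w t)) (cbox 0 1)"
      by simp
    moreover have "(- t) *\<^sub>R Q (G (- t * \<tau> + t - t) (\<psi> (w (- t * \<tau> + t)))) = (- t) *\<^sub>R G (- t * \<tau>) (Q (\<psi> (w (t - t * \<tau>))))"
      if "\<tau> \<in> cbox 0 1" for \<tau>
    proof -
      have "- t * \<tau> \<le> - t" using that t0 by (simp add: mult_left_le)
      moreover have "0 \<le> - t * \<tau>" using that t0 by (simp add: mult_nonpos_nonneg)
      ultimately show ?thesis using Q_integrand(2)[OF w, of t "t - t * \<tau>"] by (simp add: algebra_simps)
    qed
    ultimately have "((\<lambda>\<tau>. (- t) *\<^sub>R G (- t * \<tau>) (Q (\<psi> (w (t - t * \<tau>))))) has_integral Q (conv w t)) (cbox 0 1)"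
      by (rule has_integral_eq[rotated])
    then show ?thesis by (rule integral_unique[symmetric])
  qed
  have "continuous_on {..0} (\<lambda>t. integral (cbox 0 1) (\<lambda>\<tau>::real. (- t) *\<^sub>R G (- t * \<tau>) (Q (\<psi> (w (t - t * \<tau>))))))"
  proof (rule integral_continuous_on_param)
    have neg: "t - t * \<tau> \<le> 0" "0 \<le> - t * \<tau>" if "t \<le> 0" "0 \<le> \<tau>" "\<tau> \<le> 1" for t \<tau> :: real
    proof -
      have "t * (1 - \<tau>) \<le> 0" using that by (intro mult_nonpos_nonneg) auto
      then show "t - t * \<tau> \<le> 0" by (simp add: algebra_simps)
      show "0 \<le> - t * \<tau>" using that by (simp add: mult_nonpos_nonneg)
    qed
    have "continuous_on ({..0} \<times> cbox 0 1) (\<lambda>x. (- fst x) *\<^sub>R G (- fst x * snd x) (Q (\<psi> (w (fst x - fst x * snd x)))))"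
      by (intro continuous_on_scaleR T_continuous_on continuous_on_compose2[OF cont] continuous_intros)
         (auto dest: neg)
    then show "continuous_on ({..0} \<times> cbox 0 1) (\<lambda>(t, \<tau>). (- t) *\<^sub>R G (- t * \<tau>) (Q (\<psi> (w (t - t * \<tau>)))))"
      by (simp add: split_def)
  qed
  then show ?thesis by (rule continuous_on_eq) (rule eq[symmetric])
qed

end

section \<open>Fixed points in weighted spaces and the Lyapunov-Perron operator\<close>

lemma weighted_paths_continuous:
  assumes w: "w \<in> weighted_paths E 1 \<eta>"
  shows "w \<in> weighted_paths E p \<eta>"
proof -
  have "{..0} - {1} = {..0::real}" by auto
  then have "continuous_map (top_of_set {..0}) (ntop E) w" using w by (simp add: weighted_paths_def)
  then have "continuous_map (top_of_set ({..0} - {p})) (ntop E) w"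
    by (rule continuous_map_from_subtopology_mono) auto
  then show ?thesis using w by (simp add: weighted_paths_def)
qed

text \<open>
  Completeness in terms of sequences that are Cauchy for the norm.
\<close>

definition complete_nspace :: "'a::real_vector nspace \<Rightarrow> bool" where
  "complete_nspace Z \<longleftrightarrow> (\<forall>x. (\<forall>n. x n \<in> carr Z) \<and>
     (\<forall>e>0. \<exists>N. \<forall>m\<ge>N. \<forall>n\<ge>N. nrm Z (x m - x n) < e) \<longrightarrow>
     (\<exists>l\<in>carr Z. (\<lambda>n::nat. nrm Z (x n - l)) \<longlonglongrightarrow> 0))"

lemma complete_nspaceD:
  assumes "complete_nspace Z" "\<And>n. x n \<in> carr Z"
    "\<And>e. e > 0 \<Longrightarrow> \<exists>N. \<forall>m\<ge>N. \<forall>n\<ge>N. nrm Z (x m - x n) < e"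
  obtains l where "l \<in> carr Z" "(\<lambda>n::nat. nrm Z (x n - l)) \<longlonglongrightarrow> 0"
  using assms unfolding complete_nspace_def by blast

lemma complete_nprod:
  fixes Z :: "'a::real_vector nspace" and W :: "'b::real_vector nspace"
  assumes Z: "normed_nspace Z" "complete_nspace Z" and W: "normed_nspace W" "complete_nspace W"
  shows "complete_nspace (Z \<times>\<^sub>n W)"
  unfolding complete_nspace_def
proof (intro allI impI, elim conjE)
  fix x :: "nat \<Rightarrow> 'a \<times> 'b"
  assume mem: "\<forall>n. x n \<in> carr (Z \<times>\<^sub>n W)"
    and Cau: "\<forall>e>0. \<exists>N. \<forall>m\<ge>N. \<forall>n\<ge>N. nrm (Z \<times>\<^sub>n W) (x m - x n) < e"
  have m: "fst (x n) \<in> carr Z" "snd (x n) \<in> carr W" for n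
    using mem[rule_format, of n] by (auto simp: nprod_def)
  have nr: "nrm (Z \<times>\<^sub>n W) (p - q) = nrm Z (fst p - fst q) + nrm W (snd p - snd q)" for p q
    by (simp add: nprod_def split_def)
  have pos: "0 \<le> nrm Z (fst (x i) - fst (x j))" "0 \<le> nrm W (snd (x i) - snd (x j))" for i j
    using m normed_nspaceD(4,9)[OF Z(1)] normed_nspaceD(4,9)[OF W(1)] by auto
  obtain a where a: "a \<in> carr Z" "(\<lambda>n. nrm Z (fst (x n) - a)) \<longlonglongrightarrow> 0"
  proof (rule complete_nspaceD[OF Z(2), of "\<lambda>n. fst (x n)"])
    show "\<exists>N. \<forall>i\<ge>N. \<forall>j\<ge>N. nrm Z (fst (x i) - fst (x j)) < e" if e: "e > 0" for e
    proof -
      obtain N where "\<forall>i\<ge>N. \<forall>j\<ge>N. nrm (Z \<times>\<^sub>n W) (x i - x j) < e" using Cau e by blast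
      then show ?thesis using pos unfolding nr by (intro exI[of _ N]) (meson le_add_same_cancel1 le_less_trans)
    qed
  qed (rule m)
  obtain b where b: "b \<in> carr W" "(\<lambda>n. nrm W (snd (x n) - b)) \<longlonglongrightarrow> 0"
  proof (rule complete_nspaceD[OF W(2), of "\<lambda>n. snd (x n)"])
    show "\<exists>N. \<forall>i\<ge>N. \<forall>j\<ge>N. nrm W (snd (x i) - snd (x j)) < e" if e: "e > 0" for e
    proof -
      obtain N where "\<forall>i\<ge>N. \<forall>j\<ge>N. nrm (Z \<times>\<^sub>n W) (x i - x j) < e" using Cau e by blast
      then show ?thesis using pos unfolding nr by (intro exI[of _ N]) (meson le_add_same_cancel2 le_less_trans)
    qed
  qed (rule m)
  show "\<exists>l\<in>carr (Z \<times>\<^sub>n W). (\<lambda>n. nrm (Z \<times>\<^sub>n W) (x n - l)) \<longlonglongrightarrow> 0"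
  proof
    show "(a, b) \<in> carr (Z \<times>\<^sub>n W)" using a b by (simp add: nprod_def)
    show "(\<lambda>n. nrm (Z \<times>\<^sub>n W) (x n - (a, b))) \<longlonglongrightarrow> 0"
      using tendsto_add[OF a(2) b(2)] by (simp add: nr)
  qed
qed

context graph_space begin

lemma complete_nsub:
  assumes V: "subspace V" "closed V"
  shows "complete_nspace (nsub Z V)"
  unfolding complete_nspace_def
proof (intro allI impI, elim conjE)
  fix x :: "nat \<Rightarrow> 'a" assume mem: "\<forall>n. x n \<in> carr (nsub Z V)"
    and Cau: "\<forall>e>0. \<exists>N. \<forall>m\<ge>N. \<forall>n\<ge>N. nrm (nsub Z V) (x m - x n) < e"
  have m: "x n \<in> V" "x n \<in> carr Z" for n using mem by (auto simp: nsub_def)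
  obtain K where K: "K > 0" "\<And>x. x \<in> carr Z \<Longrightarrow> nrm Z x \<le> K * norm (Q x)" using nrm_bound by blast
  obtain L where L: "L > 0" "\<And>x. x \<in> carr Z \<Longrightarrow> norm (Q x) \<le> L * nrm Z x" using Q_bound by blast
  have "Cauchy (\<lambda>n. Q (x n))"
  proof (rule CauchyI)
    fix e :: real assume "e > 0"
    then obtain N where N: "\<forall>m\<ge>N. \<forall>n\<ge>N. nrm Z (x m - x n) < e / L"
      using Cau divide_pos_pos[OF \<open>e > 0\<close> L(1)] unfolding nsub_def by auto
    have "norm (Q (x i) - Q (x j)) < e" if "i \<ge> N" "j \<ge> N" for i j
    proof -
      have "norm (Q (x i) - Q (x j)) \<le> L * nrm Z (x i - x j)"
        using L(2)[of "x i - x j"] m nD by (simp add: Q_diff)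
      also have "\<dots> < L * (e / L)" using N that L(1) by (intro mult_strict_left_mono) auto
      finally show ?thesis using L(1) by simp
    qed
    then show "\<exists>M. \<forall>m\<ge>M. \<forall>n\<ge>M. norm (Q (x m) - Q (x n)) < e" by blast
  qed
  then obtain y where y: "(\<lambda>n. Q (x n)) \<longlonglongrightarrow> y" using Cauchy_convergent convergent_def by blast
  have "(\<lambda>n. R (Q (x n))) \<longlonglongrightarrow> R y" by (rule bounded_linear.tendsto[OF bounded_linear_R y])
  then have "x \<longlonglongrightarrow> R y" by (simp add: m)
  then have Vy: "R y \<in> V" using closed_sequentially[OF V(2), of x "R y"] m(1) by simp
  show "\<exists>l\<in>carr (nsub Z V). (\<lambda>n. nrm (nsub Z V) (x n - l)) \<longlonglongrightarrow> 0"
  proof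
    show "R y \<in> carr (nsub Z V)" using Vy by (simp add: nsub_def)
    show "(\<lambda>n. nrm (nsub Z V) (x n - R y)) \<longlonglongrightarrow> 0"
    proof (rule Lim_null_comparison)
      have "norm (nrm Z (x n - R y)) \<le> K * norm (Q (x n) - y)" for n
        using K(2)[of "x n - R y"] nD(4)[of "x n - R y"] m nD by (simp add: Q_diff)
      then show "\<forall>\<^sub>F n in sequentially. norm (nrm (nsub Z V) (x n - R y)) \<le> K * norm (Q (x n) - y)"
        by (simp add: nsub_def)
      show "(\<lambda>n. K * norm (Q (x n) - y)) \<longlonglongrightarrow> 0"
        by (intro tendsto_mult_right_zero tendsto_norm_zero) (use y LIM_zero in blast)
    qed
  qed
qed

lemma complete_carr: "complete_nspace Z"
proof -
  have "nsub Z UNIV = Z" by (simp add: nsub_def)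
  then show ?thesis using complete_nsub[of UNIV] by simp
qed

end

text \<open>
  If \<open>L\<close> is a contraction with constant \<open>\<kappa>\<close> for the weighted norm, \<open>u\<close> is a fixed point, and \<open>w\<close> is a fixed
  point up to the error \<open>K\<close>, then \<open>w\<close> is within \<open>K / (1 - \<kappa>)\<close> of \<open>u\<close>. With \<open>K = 0\<close> this is uniqueness.
\<close>

lemma weighted_contraction_perturbation:
  fixes L :: "(real \<Rightarrow> 'e::real_vector) \<Rightarrow> real \<Rightarrow> 'e"
  assumes E: "normed_nspace E" and w: "w \<in> weighted_paths E p \<eta>" and u: "u \<in> weighted_paths E p \<eta>"
    and contr: "\<And>M. \<forall>s\<le>0. nrm E (w s - u s) \<le> M * exp (\<eta> * s) \<Longrightarrow>
        \<forall>s\<le>0. L w s \<in> carr E \<and> L u s \<in> carr E \<and> nrm E (L w s - L u s) \<le> \<kappa> * M * exp (\<eta> * s)"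
    and \<kappa>: "0 \<le> \<kappa>" "\<kappa> < 1"
    and fixp: "\<forall>s\<le>0. L u s = u s"
    and near: "\<forall>s\<le>0. nrm E (w s - L w s) \<le> K * exp (\<eta> * s)"
    and t: "t \<le> 0"
  shows "nrm E (w t - u t) \<le> K / (1 - \<kappa>) * exp (\<eta> * t)"
proof -
  obtain M where M: "\<forall>s\<le>0. nrm E (w s - u s) \<le> M * exp (\<eta> * s)"
    using weighted_paths_diff_bound[OF E w u] by blast
  have it: "\<forall>s\<le>0. nrm E (w s - u s) \<le> (\<kappa> ^ n * M + K / (1 - \<kappa>)) * exp (\<eta> * s)" if "n > 0" for n :: nat
    using that
  proof (induction n)
    case (Suc n)
    define M' where "M' = (if n = 0 then M else \<kappa> ^ n * M + K / (1 - \<kappa>))"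
    have M': "\<forall>s\<le>0. nrm E (w s - u s) \<le> M' * exp (\<eta> * s)" using Suc M by (auto simp: M'_def)
    have K0: "0 \<le> K"
    proof -
      have "0 \<le> nrm E (w 0 - L w 0)"
        using normed_nspaceD(4,9)[OF E] w contr[OF M] by (simp add: weighted_paths_mem)
      then show ?thesis using near by force
    qed
    have step: "\<kappa> * M' + K \<le> \<kappa> ^ Suc n * M + K / (1 - \<kappa>)"
    proof (cases "n = 0")
      case True
      have "K * (1 - \<kappa>) \<le> K" using K0 \<kappa> by (simp add: mult_left_le)
      then have "K \<le> K / (1 - \<kappa>)" using \<kappa> by (simp add: field_simps)
      then show ?thesis using True by (simp add: M'_def)
    next
      case False
      have "\<kappa> * (K / (1 - \<kappa>)) + K = K / (1 - \<kappa>)" using \<kappa> by (simp add: field_simps)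
      then show ?thesis using False by (simp add: M'_def distrib_left)
    qed
    show ?case
    proof (intro allI impI)
      fix s :: real assume s: "s \<le> 0"
      have mem: "w s \<in> carr E" "u s \<in> carr E" "L w s \<in> carr E"
        using w u contr[OF M] s by (auto simp: weighted_paths_mem)
      have "nrm E (w s - u s) \<le> nrm E (w s - L w s) + nrm E (L w s - u s)"
        by (rule nrm_triangle[OF E mem(1,3,2)])
      also have "\<dots> \<le> K * exp (\<eta> * s) + \<kappa> * M' * exp (\<eta> * s)"
        using near contr[OF M'] fixp s by (intro add_mono) metis+
      also have "\<dots> = (\<kappa> * M' + K) * exp (\<eta> * s)" by (simp add: algebra_simps)
      also have "\<dots> \<le> (\<kappa> ^ Suc n * M + K / (1 - \<kappa>)) * exp (\<eta> * s)"
        by (rule mult_right_mono[OF step]) simp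
      finally show "nrm E (w s - u s) \<le> (\<kappa> ^ Suc n * M + K / (1 - \<kappa>)) * exp (\<eta> * s)" .
    qed
  qed simp
  have "(\<lambda>n. (\<kappa> ^ n * M + K / (1 - \<kappa>)) * exp (\<eta> * t)) \<longlonglongrightarrow> (0 * M + K / (1 - \<kappa>)) * exp (\<eta> * t)"
    by (intro tendsto_intros LIMSEQ_power_zero) (use \<kappa> in auto)
  then have "(\<lambda>n. (\<kappa> ^ n * M + K / (1 - \<kappa>)) * exp (\<eta> * t)) \<longlonglongrightarrow> K / (1 - \<kappa>) * exp (\<eta> * t)" by simp
  then show ?thesis
    by (rule LIMSEQ_le_const) (use it t in \<open>auto intro!: exI[of _ 1]\<close>)
qed

text \<open>
  Banach's fixed point theorem in the weighted space of continuous paths, by Picard iteration from the zero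
  path.
\<close>

lemma weighted_contraction_fixed_point:
  fixes L :: "(real \<Rightarrow> 'e::real_vector) \<Rightarrow> real \<Rightarrow> 'e"
  assumes E: "normed_nspace E" "complete_nspace E"
    and maps: "\<And>w. w \<in> weighted_paths E 1 \<eta> \<Longrightarrow> L w \<in> weighted_paths E 1 \<eta>"
    and contr: "\<And>w u M. w \<in> weighted_paths E 1 \<eta> \<Longrightarrow> u \<in> weighted_paths E 1 \<eta> \<Longrightarrow>
        \<forall>s\<le>0. nrm E (w s - u s) \<le> M * exp (\<eta> * s) \<Longrightarrow>
        \<forall>s\<le>0. nrm E (L w s - L u s) \<le> \<kappa> * M * exp (\<eta> * s)"
    and \<kappa>: "0 \<le> \<kappa>" "\<kappa> < 1"
  shows "\<exists>w\<in>weighted_paths E 1 \<eta>. \<forall>t\<le>0. L w t = w t"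
proof -
  have set: "{..0} - {1} = {..0::real}" by auto
  define W where "W n = (L ^^ n) (\<lambda>s. 0)" for n
  have W0: "W 0 = (\<lambda>s. 0)" and WS: "W (Suc n) = L (W n)" for n by (simp_all add: W_def)
  have W: "W n \<in> weighted_paths E 1 \<eta>" for n
    by (induction n) (simp_all add: W0 WS weighted_paths_zero[OF E(1)] maps)
  have Wm: "W n t \<in> carr E" if "t \<le> 0" for n t using W that by (rule weighted_paths_mem)
  obtain M where M: "\<forall>s\<le>0. nrm E (W 1 s - W 0 s) \<le> M * exp (\<eta> * s)"
    using weighted_paths_diff_bound[OF E(1) W W] by blast
  have M0: "0 \<le> M"
  proof -
    have "0 \<le> nrm E (W 1 0 - W 0 0)" using normed_nspaceD(4,9)[OF E(1)] Wm by simp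
    then show ?thesis using M by force
  qed
  have step: "\<forall>s\<le>0. nrm E (W (Suc n) s - W n s) \<le> \<kappa> ^ n * M * exp (\<eta> * s)" for n
  proof (induction n)
    case 0 then show ?case using M by simp
  next
    case (Suc n)
    show ?case using contr[OF W W Suc] by (simp add: WS mult.assoc)
  qed
  define C where "C = M / (1 - \<kappa>)"
  have C0: "0 \<le> C" using M0 \<kappa> by (simp add: C_def)
  have far: "nrm E (W (n + k) s - W n s) \<le> C * \<kappa> ^ n * exp (\<eta> * s)" if s: "s \<le> 0" for n k s
  proof -
    have "nrm E (W (n + k) s - W n s) \<le> (\<Sum>i<k. \<kappa> ^ (n + i) * M * exp (\<eta> * s))"
    proof (induction k)
      case 0 then show ?case using normed_nspaceD(3)[OF E(1)] by simp
    next
      case (Suc k)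
      have "nrm E (W (n + Suc k) s - W n s) \<le> nrm E (W (n + Suc k) s - W (n + k) s) + nrm E (W (n + k) s - W n s)"
        by (rule nrm_triangle[OF E(1) Wm[OF s] Wm[OF s] Wm[OF s]])
      then show ?case using Suc step[of "n + k"] s by force
    qed
    also have "\<dots> = \<kappa> ^ n * M * exp (\<eta> * s) * (\<Sum>i<k. \<kappa> ^ i)"
      by (simp add: power_add sum_distrib_left mult_ac)
    also have "\<dots> \<le> \<kappa> ^ n * M * exp (\<eta> * s) * (1 / (1 - \<kappa>))"
    proof (rule mult_left_mono)
      show "(\<Sum>i<k. \<kappa> ^ i) \<le> 1 / (1 - \<kappa>)" using \<kappa> by (simp add: sum_gp_strict divide_right_mono)
      show "0 \<le> \<kappa> ^ n * M * exp (\<eta> * s)" using \<kappa> M0 by simp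
    qed
    finally show ?thesis by (simp add: C_def mult_ac)
  qed
  have plim: "(\<lambda>n. B * \<kappa> ^ n) \<longlonglongrightarrow> 0" for B
    using \<kappa> by (intro tendsto_mult_right_zero LIMSEQ_power_zero) auto
  have lim: "\<exists>l\<in>carr E. (\<lambda>n. nrm E (W n s - l)) \<longlonglongrightarrow> 0" if s: "s \<le> 0" for s
  proof (rule complete_nspaceD[OF E(2), of "\<lambda>n. W n s"])
    show "\<exists>N. \<forall>i\<ge>N. \<forall>j\<ge>N. nrm E (W i s - W j s) < e" if e: "e > 0" for e
    proof -
      obtain N where N: "C * exp (\<eta> * s) * \<kappa> ^ N < e / 2"
        using order_tendstoD(2)[OF plim, of "e/2"] e by (auto simp: eventually_sequentially)
      have "nrm E (W i s - W j s) < e" if "i \<ge> N" "j \<ge> N" for i j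
      proof -
        have "nrm E (W i s - W j s) \<le> nrm E (W i s - W N s) + nrm E (W N s - W j s)"
          by (rule nrm_triangle[OF E(1) Wm[OF s] Wm[OF s] Wm[OF s]])
        also have "nrm E (W N s - W j s) = nrm E (W j s - W N s)"
          by (rule nrm_minus_commute[OF E(1) Wm[OF s] Wm[OF s]])
        finally show ?thesis using far[OF s, of N "i - N"] far[OF s, of N "j - N"] that N by (simp add: mult_ac)
      qed
      then show ?thesis by blast
    qed
  qed (use Wm s in auto)
  then obtain l where l: "\<And>s. s \<le> 0 \<Longrightarrow> l s \<in> carr E" "\<And>s. s \<le> 0 \<Longrightarrow> (\<lambda>n. nrm E (W n s - l s)) \<longlonglongrightarrow> 0"
    by metis
  have near: "nrm E (l s - W n s) \<le> C * \<kappa> ^ n * exp (\<eta> * s)" if s: "s \<le> 0" for n s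
  proof (rule field_le_epsilon)
    fix e :: real assume "e > 0"
    then obtain N where N: "\<And>i. i \<ge> N \<Longrightarrow> nrm E (W i s - l s) < e"
      using order_tendstoD(2)[OF l(2)[OF s]] by (auto simp: eventually_sequentially)
    have "nrm E (l s - W n s) \<le> nrm E (l s - W (n + N) s) + nrm E (W (n + N) s - W n s)"
      by (rule nrm_triangle[OF E(1) l(1)[OF s] Wm[OF s] Wm[OF s]])
    also have "nrm E (l s - W (n + N) s) = nrm E (W (n + N) s - l s)"
      by (rule nrm_minus_commute[OF E(1) l(1)[OF s] Wm[OF s]])
    finally show "nrm E (l s - W n s) \<le> C * \<kappa> ^ n * exp (\<eta> * s) + e"
      using far[OF s, of n N] N[of "n + N"] by simp
  qed
  have lW: "l \<in> weighted_paths E 1 \<eta>"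
    unfolding weighted_paths_def set continuous_map_ntop_iff[OF E(1)]
  proof (intro CollectI conjI allI impI ballI)
    show "\<exists>M. \<forall>s\<le>0. nrm E (l s) \<le> M * exp (\<eta> * s)"
      using near[of _ 0] by (intro exI[of _ C]) (simp add: W0)
    fix s e :: real assume s: "s \<in> {..0}" and e: "e > 0"
    define B where "B = exp (\<eta> * s) + exp (\<bar>\<eta>\<bar> + \<eta> * s)"
    have B: "exp (\<eta> * r) \<le> B" if "dist r s < 1" for r
    proof -
      have "\<eta> * (r - s) \<le> \<bar>\<eta>\<bar> * \<bar>r - s\<bar>" using abs_mult[of \<eta> "r - s"] by (metis abs_ge_self)
      also have "\<dots> \<le> \<bar>\<eta>\<bar> * 1" using that by (intro mult_left_mono) (auto simp: dist_real_def)
      finally have "\<eta> * r \<le> \<bar>\<eta>\<bar> + \<eta> * s" by (simp add: algebra_simps)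
      then show ?thesis unfolding B_def by (meson exp_ge_zero exp_le_cancel_iff le_add_same_cancel2 order_trans)
    qed
    obtain n where n: "C * B * \<kappa> ^ n < e / 3"
      using order_tendstoD(2)[OF plim, of "e/3"] e by (auto simp: eventually_sequentially)
    have un: "nrm E (l r - W n r) < e / 3" if "r \<le> 0" "dist r s < 1" for r
    proof -
      have "C * \<kappa> ^ n * exp (\<eta> * r) \<le> C * \<kappa> ^ n * B" using B[OF that(2)] C0 \<kappa> by (intro mult_left_mono) auto
      then show ?thesis using near[OF that(1), of n] n by (simp add: mult_ac)
    qed
    have Wc: "\<forall>s\<in>{..0}. \<forall>e>0. \<exists>d>0. \<forall>r\<in>{..0}. dist r s < d \<longrightarrow> nrm E (W n r - W n s) < e"
      using W[of n] unfolding weighted_paths_def set continuous_map_ntop_iff[OF E(1)] mem_Collect_eq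
      by (elim conjE)
    have "e / 3 > 0" using e by simp
    then have "\<exists>d>0. \<forall>r\<in>{..0}. dist r s < d \<longrightarrow> nrm E (W n r - W n s) < e / 3"
      using Wc s by blast
    then obtain d where d: "d > 0" "\<forall>r\<in>{..0}. dist r s < d \<longrightarrow> nrm E (W n r - W n s) < e / 3"
      by (elim exE conjE)
    have "nrm E (l r - l s) < e" if r: "r \<in> {..0}" "dist r s < min d 1" for r
    proof -
      have m: "r \<le> 0" "s \<le> 0" using r s by auto
      have "nrm E (l r - l s) \<le> nrm E (l r - W n r) + nrm E (W n r - l s)"
        by (rule nrm_triangle[OF E(1) l(1)[OF m(1)] Wm[OF m(1)] l(1)[OF m(2)]])
      also have "nrm E (W n r - l s) \<le> nrm E (W n r - W n s) + nrm E (W n s - l s)"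
        by (rule nrm_triangle[OF E(1) Wm[OF m(1)] Wm[OF m(2)] l(1)[OF m(2)]])
      also have "nrm E (W n s - l s) = nrm E (l s - W n s)"
        by (rule nrm_minus_commute[OF E(1) Wm[OF m(2)] l(1)[OF m(2)]])
      finally show ?thesis using un[OF m(1)] un[OF m(2)] d(2) r by force
    qed
    then show "\<exists>d>0. \<forall>r\<in>{..0}. dist r s < d \<longrightarrow> nrm E (l r - l s) < e"
      using d(1) by (intro exI[of _ "min d 1"]) auto
  qed (use l in auto)
  have "L l t = l t" if t: "t \<le> 0" for t
  proof -
    have Lm: "L l t \<in> carr E" using maps[OF lW] t by (rule weighted_paths_mem)
    have "nrm E (L l t - l t) \<le> 2 * C * exp (\<eta> * t) * \<kappa> ^ n" for n
    proof -
      have "\<forall>s\<le>0. nrm E (l s - W n s) \<le> (C * \<kappa> ^ n) * exp (\<eta> * s)" using near by simp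
      from contr[OF lW W this] t have 1: "nrm E (L l t - W (Suc n) t) \<le> \<kappa> * (C * \<kappa> ^ n) * exp (\<eta> * t)"
        by (simp add: WS)
      have "nrm E (L l t - l t) \<le> nrm E (L l t - W (Suc n) t) + nrm E (W (Suc n) t - l t)"
        by (rule nrm_triangle[OF E(1) Lm Wm[OF t] l(1)[OF t]])
      also have "nrm E (W (Suc n) t - l t) = nrm E (l t - W (Suc n) t)"
        by (rule nrm_minus_commute[OF E(1) Wm[OF t] l(1)[OF t]])
      also have "nrm E (l t - W (Suc n) t) \<le> C * \<kappa> ^ Suc n * exp (\<eta> * t)" by (rule near[OF t])
      finally have "nrm E (L l t - l t) \<le> \<kappa> * (2 * C * exp (\<eta> * t) * \<kappa> ^ n)" using 1 by (simp add: mult_ac)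
      also have "\<dots> \<le> 1 * (2 * C * exp (\<eta> * t) * \<kappa> ^ n)" using \<kappa> C0 by (intro mult_right_mono) auto
      finally show ?thesis by simp
    qed
    then have "nrm E (L l t - l t) \<le> 0"
      by (intro LIMSEQ_le_const[OF plim]) auto
    then have "L l t - l t = 0"
      using normed_nspaceD(4,5)[OF E(1) normed_nspaceD(9)[OF E(1) Lm l(1)[OF t]]] by linarith
    then show ?thesis by simp
  qed
  then show ?thesis using lW by blast
qed

text \<open>
  The Lyapunov-Perron operator for a fast variable in \<open>ZX\<close> and a second variable in \<open>ZY\<close> that is split along
  \<open>F\<close> and \<open>S\<close>. The prefixes \<open>fast\<close>, \<open>mid\<close> and \<open>slow\<close> belong to the components in \<open>ZX\<close>, \<open>F\<close> and \<open>S\<close>.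
\<close>

locale lyapunov_perron =
  fast: smoothing_convolution ZX QX U E \<phi>X cX \<theta>X \<omega>X \<eta> +
  mid: smoothing_convolution ZY QY V E \<phi>F cF \<theta>F \<omega>F \<eta> +
  slow: slow_convolution ZY QY G E \<psi> cS \<sigma> \<eta>
  for ZX :: "'x::banach nspace" and QX U and ZY :: "'y::banach nspace" and QY V G
    and E :: "('x \<times> 'y \<times> 'y) nspace" and \<phi>X \<phi>F \<psi> cX \<theta>X \<omega>X cF \<theta>F \<omega>F cS \<sigma> \<eta> +
  fixes F S :: "'y set" and c0 :: real
  assumes E_eq: "E = ZX \<times>\<^sub>n nsub ZY F \<times>\<^sub>n nsub ZY S"
    and subspaces: "subspace F" "subspace S" "closed F" "closed S"
    and V_F: "\<And>r p. 0 \<le> r \<Longrightarrow> p \<in> carr E \<Longrightarrow> V r (\<phi>F p) \<in> F"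
    and \<psi>_S: "\<And>p. p \<in> carr E \<Longrightarrow> \<psi> p \<in> S"
    and G_S: "\<And>r y. 0 \<le> r \<Longrightarrow> y \<in> S \<Longrightarrow> G r y \<in> S"
    and G_bound: "\<And>r y. 0 \<le> r \<Longrightarrow> y \<in> S \<inter> carr ZY \<Longrightarrow> nrm ZY (G r y) \<le> c0 * exp (- \<sigma> * r) * nrm ZY y"
    and gap: "fast.contraction + mid.contraction + slow.contraction < 1"
begin

text \<open>
  Here \<open>y\<close> is the value that the slow component of a fixed point has at time \<open>0\<close>.
\<close>

definition LP :: "'y \<Rightarrow> (real \<Rightarrow> 'x \<times> 'y \<times> 'y) \<Rightarrow> real \<Rightarrow> 'x \<times> 'y \<times> 'y" where
  "LP y w t = (fast.conv w t, mid.conv w t, G (- t) y - slow.conv w t)"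

abbreviation \<kappa> :: real where "\<kappa> \<equiv> fast.contraction + mid.contraction + slow.contraction"

lemma \<kappa>_nonneg: "0 \<le> \<kappa>"
  using fast.contraction_nonneg mid.contraction_nonneg slow.contraction_nonneg by simp

lemma normed_parts: "normed_nspace (nsub ZY F)" "normed_nspace (nsub ZY S)"
  "normed_nspace (nsub ZY F \<times>\<^sub>n nsub ZY S)"
  using subspaces by (auto intro!: normed_nsub normed_nprod mid.normed)

lemma E_complete: "complete_nspace E"
  unfolding E_eq using subspaces
  by (intro complete_nprod fast.complete_carr mid.complete_nsub fast.normed normed_parts)

lemma carr_E: "(x, a, b) \<in> carr E \<longleftrightarrow> x \<in> carr ZX \<and> a \<in> F \<and> a \<in> carr ZY \<and> b \<in> S \<and> b \<in> carr ZY"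
  by (simp add: E_eq nprod_def nsub_def)

lemma nrm_E: "nrm E (x, a, b) = nrm ZX x + nrm ZY a + nrm ZY b"
  by (simp add: E_eq nprod_def nsub_def)

lemma LP_mem:
  assumes w: "w \<in> weighted_paths E p \<eta>" and y: "y \<in> S \<inter> carr ZY" and t: "t \<le> 0"
  shows "LP y w t \<in> carr E"
  unfolding LP_def carr_E
proof (intro conjI)
  show "fast.conv w t \<in> carr ZX" by (rule fast.conv_basic(2)[OF w t])
  show "mid.conv w t \<in> F" by (rule mid.conv_in_subspace[OF w t]) (use subspaces V_F in auto)
  show "mid.conv w t \<in> carr ZY" by (rule mid.conv_basic(2)[OF w t])
  have "slow.conv w t \<in> S"
    by (rule slow.conv_in_subspace[OF w t]) (use subspaces G_S \<psi>_S in auto)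
  moreover have "G (- t) y \<in> S" using G_S y t by simp
  ultimately show "G (- t) y - slow.conv w t \<in> S" by (intro subspace_diff subspaces)
  show "G (- t) y - slow.conv w t \<in> carr ZY"
    using slow.T_mem[of "- t" y] y t by (intro mid.nD slow.conv_basic(2)[OF w t]) auto
qed

lemma LP_contraction:
  assumes w: "w \<in> weighted_paths E p \<eta>" and v: "v \<in> weighted_paths E p \<eta>" and t: "t \<le> 0"
    and M: "\<forall>s\<le>0. nrm E (w s - v s) \<le> M * exp (\<eta> * s)"
  shows "nrm E (LP y w t - LP y v t) \<le> \<kappa> * M * exp (\<eta> * t)"
proof -
  have "nrm E (LP y w t - LP y v t) = nrm ZX (fast.conv w t - fast.conv v t)
      + nrm ZY (mid.conv w t - mid.conv v t) + nrm ZY (slow.conv v t - slow.conv w t)"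
    by (simp add: LP_def nrm_E)
  also have "nrm ZY (slow.conv v t - slow.conv w t) = nrm ZY (slow.conv w t - slow.conv v t)"
    by (intro nrm_minus_commute mid.normed slow.conv_basic(2)[OF v t] slow.conv_basic(2)[OF w t])
  finally show ?thesis
    using fast.conv_contraction[OF w v t M] mid.conv_contraction[OF w v t M] slow.conv_contraction[OF w v t M]
    by (simp add: algebra_simps)
qed

lemma LP_weighted:
  assumes w: "w \<in> weighted_paths E 1 \<eta>" and y: "y \<in> S \<inter> carr ZY"
  shows "LP y w \<in> weighted_paths E 1 \<eta>"
  unfolding weighted_paths_def
proof (intro CollectI conjI allI impI)
  have set: "{..0} - {1} = {..0::real}" by auto
  show "LP y w t \<in> carr E" if "t \<le> 0" for t by (rule LP_mem[OF w y that])
  note mem = this[unfolded LP_def carr_E]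
  have G: "continuous_on {..0} (\<lambda>t. QY (G (- t) y))"
  proof (rule continuous_on_eq)
    show "continuous_on {..0} (\<lambda>t. G (- t) (QY y))" by (intro slow.T_continuous_on continuous_intros) auto
    show "G (- t) (QY y) = QY (G (- t) y)" if "t \<in> {..0}" for t using slow.Q_T[of "- t" y] that y by simp
  qed
  have S: "continuous_on {..0} (\<lambda>t. QY (G (- t) y - slow.conv w t))"
  proof (rule continuous_on_eq)
    show "continuous_on {..0} (\<lambda>t. QY (G (- t) y) - QY (slow.conv w t))"
      by (intro continuous_on_diff G slow.conv_continuous[OF w]) simp
    show "QY (G (- t) y) - QY (slow.conv w t) = QY (G (- t) y - slow.conv w t)" if "t \<in> {..0}" for t
      using mid.Q_diff slow.T_mem[of "- t" y] y that slow.conv_basic(2)[OF w, of t] by simp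
  qed
  show "continuous_map (top_of_set ({..0} - {1})) (ntop E) (LP y w)"
    unfolding set E_eq LP_def continuous_map_ntop_nprod[OF fast.normed normed_parts(3)]
      continuous_map_ntop_nprod[OF normed_parts(1,2)]
      continuous_map_ntop_nsub[OF mid.normed subspaces(1)] continuous_map_ntop_nsub[OF mid.normed subspaces(2)]
      fast.continuous_map_iff mid.continuous_map_iff fst_conv snd_conv
    using mem fast.conv_continuous[OF w] mid.conv_continuous[OF w] S by simp
  obtain M where M: "\<forall>s\<le>0. nrm E (w s - (\<lambda>s. 0) s) \<le> M * exp (\<eta> * s)"
    using weighted_paths_diff_bound[OF fast.E w weighted_paths_zero[OF fast.E]] by blast
  have "nrm E (LP y w t) \<le> (\<kappa> * M + \<bar>c0\<bar> * nrm ZY y) * exp (\<eta> * t)" if t: "t \<le> 0" for t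
  proof -
    have z: "fast.conv (\<lambda>s. 0) t = 0" "mid.conv (\<lambda>s. 0) t = 0" "slow.conv (\<lambda>s. 0) t = 0"
    proof -
      show "fast.conv (\<lambda>s. 0) t = 0" unfolding fast.conv_def fast.\<phi>_0
        by (rule integral_unique, rule has_integral_eq[OF _ has_integral_0])
          (simp add: linear_0[OF fast.T_linear])
      show "mid.conv (\<lambda>s. 0) t = 0" unfolding mid.conv_def mid.\<phi>_0
        by (rule integral_unique, rule has_integral_eq[OF _ has_integral_0])
          (simp add: linear_0[OF mid.T_linear])
      show "slow.conv (\<lambda>s. 0) t = 0" unfolding slow.conv_def slow.\<psi>_0
        by (rule integral_unique, rule has_integral_eq[OF _ has_integral_0])
          (simp add: linear_0[OF slow.T_linear])
    qed
    have Gm: "G (- t) y \<in> S" "G (- t) y \<in> carr ZY" using G_S slow.T_mem y t by auto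
    have LP0: "LP y (\<lambda>s. 0) t = (0, 0, G (- t) y)" by (simp add: LP_def z)
    have y0: "0 \<le> nrm ZY y" using y mid.nD by simp
    have "nrm E (LP y (\<lambda>s. 0) t) \<le> c0 * exp (- \<sigma> * - t) * nrm ZY y"
      unfolding LP0 nrm_E using G_bound[of "- t" y] y t fast.nD mid.nD by simp
    also have "\<dots> \<le> \<bar>c0\<bar> * exp (\<eta> * t) * nrm ZY y"
    proof (intro mult_right_mono mult_mono y0)
      have "\<sigma> * t \<le> \<eta> * t" using t slow.\<sigma>_greater by (intro mult_right_mono_neg) auto
      then show "exp (- \<sigma> * - t) \<le> exp (\<eta> * t)" by simp
    qed auto
    finally have 1: "nrm E (LP y (\<lambda>s. 0) t) \<le> \<bar>c0\<bar> * nrm ZY y * exp (\<eta> * t)" by (simp add: mult_ac)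
    have 2: "nrm E (LP y w t - LP y (\<lambda>s. 0) t) \<le> \<kappa> * M * exp (\<eta> * t)"
      by (rule LP_contraction[OF w weighted_paths_zero[OF fast.E] t M])
    have "nrm E (LP y w t) = nrm E ((LP y w t - LP y (\<lambda>s. 0) t) + LP y (\<lambda>s. 0) t)" by simp
    also have "\<dots> \<le> nrm E (LP y w t - LP y (\<lambda>s. 0) t) + nrm E (LP y (\<lambda>s. 0) t)"
      by (intro normed_nspaceD[OF fast.E] LP_mem[OF w y t] LP_mem[OF weighted_paths_zero[OF fast.E] y t])
    finally show ?thesis using 1 2 by (simp add: algebra_simps)
  qed
  then show "\<exists>M. \<forall>s\<le>0. nrm E (LP y w s) \<le> M * exp (\<eta> * s)" by blast
qed

lemma LP_fixed_point:
  assumes y: "y \<in> S \<inter> carr ZY"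
  shows "\<exists>w\<in>weighted_paths E 1 \<eta>. \<forall>t\<le>0. LP y w t = w t"
  by (rule weighted_contraction_fixed_point[where \<kappa> = \<kappa>])
     (use fast.E E_complete LP_weighted[OF _ y] LP_contraction \<kappa>_nonneg gap in auto)

lemma LP_perturbation:
  assumes y: "y \<in> S \<inter> carr ZY" and w: "w \<in> weighted_paths E p \<eta>" and u: "u \<in> weighted_paths E p \<eta>"
    and fixu: "\<forall>s\<le>0. LP y u s = u s" and near: "\<forall>s\<le>0. nrm E (w s - LP y w s) \<le> K * exp (\<eta> * s)" and t: "t \<le> 0"
  shows "nrm E (w t - u t) \<le> K / (1 - \<kappa>) * exp (\<eta> * t)"
  by (rule weighted_contraction_perturbation[OF fast.E w u _ \<kappa>_nonneg gap fixu near t])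
     (auto intro!: LP_mem[OF w y] LP_mem[OF u y] LP_contraction[OF w u])

end

section \<open>Differentiation along semigroup orbits\<close>

lemma has_vector_derivative_iff_quotient:
  fixes f :: "real \<Rightarrow> 'a::real_normed_vector"
  shows "(f has_vector_derivative d) (at x within A) \<longleftrightarrow>
    ((\<lambda>y. (f y - f x) /\<^sub>R (y - x)) \<longlongrightarrow> d) (at x within A)"
proof -
  have eq: "norm (f y - f x - (y - x) *\<^sub>R d) / norm (y - x) = norm ((f y - f x) /\<^sub>R (y - x) - d)" if "y \<noteq> x" for y
  proof -
    have "(f y - f x) /\<^sub>R (y - x) - d = inverse (y - x) *\<^sub>R (f y - f x - (y - x) *\<^sub>R d)"
      using that by (simp add: scaleR_diff_right)
    then show ?thesis by (simp add: divide_inverse mult.commute)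
  qed
  have "((\<lambda>y. norm (f y - f x - (y - x) *\<^sub>R d) / norm (y - x)) \<longlongrightarrow> 0) (at x within A) \<longleftrightarrow>
      ((\<lambda>y. norm ((f y - f x) /\<^sub>R (y - x) - d)) \<longlongrightarrow> 0) (at x within A)"
    by (rule filterlim_cong[OF refl refl], unfold eventually_at_filter, rule always_eventually, intro allI impI, rule eq)
  also have "\<dots> \<longleftrightarrow> ((\<lambda>y. (f y - f x) /\<^sub>R (y - x)) \<longlongrightarrow> d) (at x within A)"
    by (simp add: tendsto_norm_zero_iff LIM_zero_iff)
  finally show ?thesis
    by (simp add: has_vector_derivative_def has_derivative_iff_norm bounded_linear_scaleR_left)
qed

context semigroup_graph begin

text \<open>
  A derivative from the right at \<open>0\<close> is a two-sided derivative at every positive time: both one-sided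
  difference quotients at \<open>r\<close> are \<open>T (min q r)\<close> applied to the one at \<open>0\<close> with increment \<open>\<bar>q - r\<bar>\<close>.
\<close>

lemma orbit_derivative:
  assumes gen: "((\<lambda>h. (T h x - T 0 x) /\<^sub>R h) \<longlongrightarrow> d) (at_right 0)" and r: "0 \<le> r"
  shows "((\<lambda>r. T r x) has_vector_derivative T r d) (at r within {0..})"
  unfolding has_vector_derivative_iff_quotient
proof -
  let ?F = "at r within {0..}"
  have abs: "filterlim (\<lambda>q. \<bar>q - r\<bar>) (at_right 0) ?F"
    unfolding filterlim_at
  proof
    have "((\<lambda>q. \<bar>q - r\<bar>) \<longlongrightarrow> \<bar>r - r\<bar>) ?F" by (intro tendsto_intros)
    then show "((\<lambda>q. \<bar>q - r\<bar>) \<longlongrightarrow> 0) ?F" by simp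
  qed (auto simp: eventually_at_filter)
  have "((\<lambda>q. T (min q r) ((T \<bar>q - r\<bar> x - T 0 x) /\<^sub>R \<bar>q - r\<bar>)) \<longlongrightarrow> T r d) ?F"
  proof (rule T_tendsto)
    have "((\<lambda>q. min q r) \<longlongrightarrow> min r r) ?F" by (intro tendsto_intros)
    then show "((\<lambda>q. min q r) \<longlongrightarrow> r) ?F" by simp
    show "((\<lambda>q. (T \<bar>q - r\<bar> x - T 0 x) /\<^sub>R \<bar>q - r\<bar>) \<longlongrightarrow> d) ?F"
      by (rule filterlim_compose[OF gen abs])
    show "\<forall>\<^sub>F q in ?F. 0 \<le> min q r" using r by (auto simp: eventually_at_filter)
  qed (rule r)
  moreover have "\<forall>\<^sub>F q in ?F. T (min q r) ((T \<bar>q - r\<bar> x - T 0 x) /\<^sub>R \<bar>q - r\<bar>) = (T q x - T r x) /\<^sub>R (q - r)"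
    unfolding eventually_at_filter
  proof (intro always_eventually allI impI)
    fix q assume q: "q \<noteq> r" "q \<in> {0..}"
    have m: "0 \<le> min q r" using q r by simp
    have 1: "T (min q r) ((T \<bar>q - r\<bar> x - T 0 x) /\<^sub>R \<bar>q - r\<bar>)
        = (T (min q r + \<bar>q - r\<bar>) x - T (min q r + 0) x) /\<^sub>R \<bar>q - r\<bar>"
      by (subst T_add[OF m], simp, subst T_add[OF m], simp)
         (simp add: linear_scale[OF T_linear[OF m]] linear_diff[OF T_linear[OF m]])
    show "T (min q r) ((T \<bar>q - r\<bar> x - T 0 x) /\<^sub>R \<bar>q - r\<bar>) = (T q x - T r x) /\<^sub>R (q - r)"
    proof (cases "r < q")
      case True
      then show ?thesis unfolding 1 by simp
    next
      case False
      then have "q < r" using q by simp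
      then have "min q r + \<bar>q - r\<bar> = r" "min q r + 0 = q" "\<bar>q - r\<bar> = - (q - r)" by auto
      then show ?thesis unfolding 1 by (simp only: inverse_minus_eq scaleR_minus_left) (simp add: scaleR_diff_right)
    qed
  qed
  ultimately show "((\<lambda>q. (T q x - T r x) /\<^sub>R (q - r)) \<longlongrightarrow> T r d) ?F"
    by (rule Lim_transform_eventually)
qed

lemma moving_derivative:
  assumes gen: "((\<lambda>h. (T h (v r) - T 0 (v r)) /\<^sub>R h) \<longlongrightarrow> d) (at_right 0)"
    and v: "(v has_vector_derivative v') (at r within A)"
    and \<tau>: "\<And>q. \<tau> q = \<tau>0 + \<sigma> * q" "\<And>q. q \<in> A \<Longrightarrow> 0 \<le> \<tau> q" and r: "r \<in> A"
  shows "((\<lambda>q. T (\<tau> q) (v q)) has_vector_derivative T (\<tau> r) (v' + \<sigma> *\<^sub>R d)) (at r within A)"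
  unfolding has_vector_derivative_iff_quotient
proof -
  let ?F = "at r within A"
  have \<tau>r: "0 \<le> \<tau> r" using \<tau>(2) r .
  have ev: "\<forall>\<^sub>F q in ?F. 0 \<le> \<tau> q" using \<tau>(2) by (auto simp: eventually_at_filter)
  have \<tau>lim: "(\<tau> \<longlongrightarrow> \<tau> r) ?F" unfolding \<tau>(1) by (intro tendsto_intros)
  have 1: "((\<lambda>q. T (\<tau> q) ((v q - v r) /\<^sub>R (q - r))) \<longlongrightarrow> T (\<tau> r) v') ?F"
    using v unfolding has_vector_derivative_iff_quotient by (intro T_tendsto \<tau>lim ev \<tau>r)
  have d\<tau>: "(\<tau> has_vector_derivative \<sigma>) (at r within A)"
    unfolding \<tau>(1) has_real_derivative_iff_has_vector_derivative[symmetric]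
    by (auto intro!: derivative_eq_intros)
  have "((\<lambda>r. T r (v r0)) has_vector_derivative T (\<tau> r) d) (at (\<tau> r) within \<tau> ` A)" if "r0 = r" for r0
    unfolding that using orbit_derivative[OF gen \<tau>r]
    by (rule has_vector_derivative_within_subset) (use \<tau>(2) in auto)
  from vector_diff_chain_within[OF d\<tau> this[OF refl]]
  have "((\<lambda>q. T (\<tau> q) (v r)) has_vector_derivative \<sigma> *\<^sub>R T (\<tau> r) d) (at r within A)"
    by (simp add: o_def)
  then have 2: "((\<lambda>q. (T (\<tau> q) (v r) - T (\<tau> r) (v r)) /\<^sub>R (q - r)) \<longlongrightarrow> \<sigma> *\<^sub>R T (\<tau> r) d) ?F"
    unfolding has_vector_derivative_iff_quotient .
  have "T (\<tau> r) (v' + \<sigma> *\<^sub>R d) = T (\<tau> r) v' + \<sigma> *\<^sub>R T (\<tau> r) d"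
    by (simp add: linear_add[OF T_linear[OF \<tau>r]] linear_scale[OF T_linear[OF \<tau>r]])
  moreover have "\<forall>\<^sub>F q in ?F. T (\<tau> q) ((v q - v r) /\<^sub>R (q - r)) + (T (\<tau> q) (v r) - T (\<tau> r) (v r)) /\<^sub>R (q - r)
      = (T (\<tau> q) (v q) - T (\<tau> r) (v r)) /\<^sub>R (q - r)"
    using ev
  proof eventually_elim
    case (elim q)
    then show ?case
      by (simp add: linear_diff[OF T_linear] linear_scale[OF T_linear] flip: scaleR_add_right)
  qed
  ultimately show "((\<lambda>q. (T (\<tau> q) (v q) - T (\<tau> r) (v r)) /\<^sub>R (q - r)) \<longlongrightarrow> T (\<tau> r) (v' + \<sigma> *\<^sub>R d)) ?F"
    using Lim_transform_eventually[OF tendsto_add[OF 1 2]] by simp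
qed

text \<open>
  The variation of constants formula in integrated form, for a time \<open>\<tau>\<close> that runs forwards (\<open>\<sigma> = 1\<close>) or
  backwards (\<open>\<sigma> = -1\<close>).
\<close>

lemma moving_integral:
  assumes gen: "\<And>r. r \<in> {a..b} \<Longrightarrow> ((\<lambda>h. (T h (v r) - T 0 (v r)) /\<^sub>R h) \<longlongrightarrow> d r) (at_right 0)"
    and v: "\<And>r. r \<in> {a..b} \<Longrightarrow> (v has_vector_derivative v' r) (at r within {a..b})"
    and \<tau>: "\<And>q. \<tau> q = \<tau>0 + \<sigma> * q" "\<And>q. q \<in> {a..b} \<Longrightarrow> 0 \<le> \<tau> q" and ab: "a \<le> b"
  shows "((\<lambda>r. T (\<tau> r) (v' r + \<sigma> *\<^sub>R d r)) has_integral T (\<tau> b) (v b) - T (\<tau> a) (v a)) {a..b}"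
  by (rule fundamental_theorem_of_calculus[OF ab], rule moving_derivative[OF gen v \<tau>])

end

lemma generates_semigroup_invariant:
  assumes gen: "generates_semigroup D S T" and x: "x \<in> D" and t: "0 \<le> t"
  shows "T t x \<in> D" "S (T t x) = T t (S x)"
proof -
  have bl: "bounded_linear (T t)" using gen t by (simp add: generates_semigroup_def)
  have "((\<lambda>h. (T h x - x) /\<^sub>R h) \<longlongrightarrow> S x) (at_right 0)"
    using gen x by (auto simp: generates_semigroup_def)
  from bounded_linear.tendsto[OF bl this]
  have "((\<lambda>h. T t ((T h x - x) /\<^sub>R h)) \<longlongrightarrow> T t (S x)) (at_right 0)" .
  moreover have "\<forall>\<^sub>F h in at_right 0. T t ((T h x - x) /\<^sub>R h) = (T h (T t x) - T t x) /\<^sub>R h"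
    unfolding eventually_at_filter
  proof (intro always_eventually allI impI)
    fix h :: real assume h: "h \<noteq> 0" "h \<in> {0<..}"
    have "T t (T h x) = T h (T t x)"
      using gen h t unfolding generates_semigroup_def by (metis add.commute greaterThan_iff less_imp_le)
    then show "T t ((T h x - x) /\<^sub>R h) = (T h (T t x) - T t x) /\<^sub>R h"
      by (simp add: linear_simps[OF bl])
  qed
  ultimately have "((\<lambda>h. (T h (T t x) - T t x) /\<^sub>R h) \<longlongrightarrow> T t (S x)) (at_right 0)"
    by (rule Lim_transform_eventually)
  then have "T t x \<in> D \<and> S (T t x) = T t (S x)" using gen unfolding generates_semigroup_def by blast
  then show "T t x \<in> D" "S (T t x) = T t (S x)" by auto
qed

lemma semigroup_continuous_on:
  assumes gen: "generates_semigroup D S T"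
    and growth: "\<And>t x. 0 \<le> t \<Longrightarrow> norm (T t x) \<le> M * exp (\<omega> * t) * norm x"
  shows "continuous_on {0..} (\<lambda>t. T t x)"
  unfolding continuous_on_def
proof
  fix r :: real assume "r \<in> {0..}"
  then have r: "0 \<le> r" by simp
  let ?F = "at r within {0..}"
  have T0: "T 0 y = y" for y using gen by (simp add: generates_semigroup_def)
  have add: "T (s + t) y = T s (T t y)" if "0 \<le> s" "0 \<le> t" for s t y
    using gen that by (simp add: generates_semigroup_def)
  have lin: "linear (T t)" if "0 \<le> t" for t
    using gen that by (simp add: generates_semigroup_def bounded_linear.linear)
  have lim0: "((\<lambda>h. T h x) \<longlongrightarrow> T 0 x) (at_right 0)" using gen by (simp add: generates_semigroup_def)
  have le: "norm (T q x - T r x) \<le> M * exp (\<omega> * min q r) * norm (T \<bar>q - r\<bar> x - T 0 x)" if "q \<in> {0..}" for q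
  proof -
    have m: "0 \<le> min q r" using that r by simp
    have "norm (T (min q r) (T \<bar>q - r\<bar> x - T 0 x)) \<le> M * exp (\<omega> * min q r) * norm (T \<bar>q - r\<bar> x - T 0 x)"
      by (rule growth[OF m])
    moreover have "T (min q r) (T \<bar>q - r\<bar> x - T 0 x) = T (min q r + \<bar>q - r\<bar>) x - T (min q r) x"
      using add[OF m, of "\<bar>q - r\<bar>" x] by (simp add: linear_diff[OF lin[OF m]] T0)
    moreover have "norm (T (min q r + \<bar>q - r\<bar>) x - T (min q r) x) = norm (T q x - T r x)"
      by (cases "r \<le> q") (auto simp: norm_minus_commute min_def)
    ultimately show ?thesis by simp
  qed
  have "((\<lambda>q. \<bar>q - r\<bar>) \<longlongrightarrow> \<bar>r - r\<bar>) ?F" by (intro tendsto_intros)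
  then have abs: "filterlim (\<lambda>q. \<bar>q - r\<bar>) (at_right 0) ?F"
    unfolding filterlim_at by (auto simp: eventually_at_filter)
  have "((\<lambda>q. M * exp (\<omega> * min q r) * norm (T \<bar>q - r\<bar> x - T 0 x)) \<longlongrightarrow> M * exp (\<omega> * min r r) * norm (T 0 x - T 0 x)) ?F"
    by (intro tendsto_intros filterlim_compose[OF lim0 abs])
  then have "((\<lambda>q. M * exp (\<omega> * min q r) * norm (T \<bar>q - r\<bar> x - T 0 x)) \<longlongrightarrow> 0) ?F" by simp
  then have "((\<lambda>q. T q x - T r x) \<longlongrightarrow> 0) ?F"
    by (rule Lim_null_comparison[rotated]) (use le in \<open>auto simp: eventually_at_filter\<close>)
  then show "((\<lambda>t. T t x) \<longlongrightarrow> T r x) ?F" using LIM_zero_iff by blast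
qed

section \<open>Interpolation-extrapolation scales\<close>

lemma banach_space_isometric_image:
  fixes q :: "'z::banach \<Rightarrow> 'e::real_vector"
  assumes q: "linear q" and carr: "carr Z = range q" and iso: "\<And>x. nrm Z (q x) = norm x"
  shows "banach_space Z"
proof -
  have 1: "subspace (carr Z)" unfolding carr using linear_subspace_image[OF q subspace_UNIV] .
  have inj: "q x = 0 \<longleftrightarrow> x = 0" for x
    using iso[of x] iso[of 0] linear_0[OF q] by (metis norm_eq_zero)
  have n: "normed_nspace Z"
    unfolding normed_nspace_def
  proof (intro conjI ballI allI 1)
    fix x assume x: "x \<in> carr Z"
    then obtain a where a: "x = q a" using carr by auto
    show "0 \<le> nrm Z x" "nrm Z x = 0 \<longleftrightarrow> x = 0" using inj iso by (auto simp: a)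
    show "nrm Z (c *\<^sub>R x) = \<bar>c\<bar> * nrm Z x" for c
      using iso by (simp add: a linear_scale[OF q, symmetric])
    fix y assume "y \<in> carr Z"
    then obtain b where b: "y = q b" using carr by auto
    show "nrm Z (x + y) \<le> nrm Z x + nrm Z y"
      using iso norm_triangle_ineq by (simp add: a b linear_add[OF q, symmetric])
  qed
  interpret M: Metric_space "carr Z" "ndist Z" by (rule Metric_space_ndist[OF n])
  have d: "ndist Z (q a) (q b) = dist a b" for a b
    using carr iso[of "a - b"] by (simp add: ndist_def dist_norm linear_diff[OF q])
  have "M.mcomplete"
    unfolding M.mcomplete_def
  proof (intro allI impI)
    fix s assume s: "M.MCauchy s"
    then have "range s \<subseteq> range q" using carr unfolding M.MCauchy_def by blast
    then have "\<forall>n. \<exists>a. s n = q a" by blast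
    then obtain a where a: "\<And>n. s n = q (a n)" by metis
    have "Cauchy a" using s unfolding M.MCauchy_def a d Cauchy_def by meson
    then obtain l where l: "a \<longlonglongrightarrow> l" using Cauchy_convergent convergent_def by blast
    have "limitin M.mtopology s (q l) sequentially"
      unfolding M.limit_metric_sequentially
    proof (intro conjI allI impI)
      show "q l \<in> carr Z" using carr by simp
      fix e :: real assume "e > 0"
      then obtain N where "\<forall>n\<ge>N. dist (a n) l < e" using l unfolding lim_sequentially by blast
      then show "\<exists>N. \<forall>n\<ge>N. s n \<in> carr Z \<and> ndist Z (s n) (q l) < e" unfolding a d using carr by auto
    qed
    then show "\<exists>x. limitin M.mtopology s x sequentially" by blast
  qed
  then show ?thesis using n by (simp add: banach_space_def normed_nspace_def)
qed

text \<open>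
  An interpolation-extrapolation scale generated by an operator \<open>Q\<close> with domain \<open>D\<close>.
\<close>

locale scale =
  fixes D :: "'z::banach set" and Q :: "'z \<Rightarrow> 'z" and j :: "'z \<Rightarrow> 'e::banach" and tow :: "real \<Rightarrow> 'e nspace"
  assumes scale: "interp_extrap_scale D Q j tow"
begin

lemma Q_resolvent: "bij_betw Q D UNIV" "\<exists>K. \<forall>x\<in>D. norm x \<le> K * norm (Q x)"
  using scale by (auto simp: interp_extrap_scale_def in_resolvent_set_def)

lemma D_dense: "closure D = UNIV" and D_subspace: "subspace D"
  and Q_linear: "linear_between \<lparr>carr = D, nrm = norm\<rparr> Q"
  using scale by (auto simp: interp_extrap_scale_def closed_operator_def)

lemma j_linear: "linear j" and j_norm: "norm (j z) = norm (the_inv_into D Q z)"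
  using scale by (auto simp: interp_extrap_scale_def extrapolation_space_def)

lemma the_inv_mem: "the_inv_into D Q z \<in> D" and Q_the_inv: "Q (the_inv_into D Q z) = z"
  using Q_resolvent(1) by (auto simp: bij_betw_def intro: the_inv_into_into f_the_inv_into_f)

lemma Q_zero: "Q 0 = 0"
  using Q_linear[unfolded linear_between_def, THEN bspec, THEN bspec, of 0 0, THEN spec, THEN spec, of 0 0]
    subspace_0[OF D_subspace] by simp

lemma j_inj: "inj j"
proof (subst linear_injective_0[OF j_linear], intro allI impI)
  fix z assume "j z = 0"
  then have "the_inv_into D Q z = 0" using j_norm[of z] by simp
  then show "z = 0" using Q_the_inv[of z] Q_zero by simp
qed

lemma level_1: "carr (generated_level D Q j \<Phi> 1) = j ` D" "nrm (generated_level D Q j \<Phi> 1) (j x) = norm (Q x)"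
  using j_inj by (auto simp: generated_level_def integer_level_def)

lemma tower_equivalent:
  "\<exists>\<Phi>. (\<forall>\<theta>. 0 < \<theta> \<and> \<theta> < 1 \<longrightarrow> exact_interpolation_functor (\<Phi> \<theta>)) \<and>
     (\<forall>\<alpha>\<ge>-1. banach_space (tow \<alpha>) \<and> equivalent_spaces (tow \<alpha>) (generated_level D Q j \<Phi> \<alpha>))"
  using scale unfolding interp_extrap_scale_def by blast

lemma tower_equivalent_1: "\<exists>\<Phi>. equivalent_spaces (tow 1) (generated_level D Q j \<Phi> 1)"
proof -
  have "(-1::real) \<le> 1" by simp
  then show ?thesis using tower_equivalent by blast
qed

lemma normed_level:
  assumes "-1 \<le> \<alpha>"
  shows "normed_nspace (npull j (tow \<alpha>))"
proof -
  have n: "normed_nspace (tow \<alpha>)" using tower_equivalent assms banach_space_normed by blast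
  note N = normed_nspaceD[OF n]
  have inj: "j x = 0 \<longleftrightarrow> x = 0" for x using j_inj linear_0[OF j_linear] by (metis injD)
  show ?thesis
    unfolding normed_nspace_def npull_def
    using N(3,4,6,7) linear_subspace_vimage[OF j_linear N(1)] inj
    by (auto simp: linear_0[OF j_linear] linear_scale[OF j_linear] linear_add[OF j_linear] dest: N(5))
qed

lemma carr_level_1: "carr (npull j (tow 1)) = D"
proof -
  obtain \<Phi> where e: "equivalent_spaces (tow 1) (generated_level D Q j \<Phi> 1)"
    using tower_equivalent_1 by blast
  then have "carr (tow 1) = j ` D"
    unfolding equivalent_spaces_def embedded_def op_bound_def using level_1(1)[of \<Phi>] by blast
  then show ?thesis using j_inj by (auto simp: npull_def inj_def)
qed

lemma graph_space_level_1: "graph_space (npull j (tow 1)) Q"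
proof
  obtain \<Phi> where e: "equivalent_spaces (tow 1) (generated_level D Q j \<Phi> 1)"
    using tower_equivalent_1 by blast
  then obtain K L where K: "op_bound (tow 1) (generated_level D Q j \<Phi> 1) (\<lambda>z. z) K"
    and L: "op_bound (generated_level D Q j \<Phi> 1) (tow 1) (\<lambda>z. z) L"
    unfolding equivalent_spaces_def embedded_def by blast
  show "normed_nspace (npull j (tow 1))" by (rule normed_level) simp
  show "linear_between (npull j (tow 1)) Q" using Q_linear by (simp add: linear_between_def carr_level_1)
  show "bij_betw Q (carr (npull j (tow 1))) UNIV" by (simp add: carr_level_1 Q_resolvent)
  show "\<exists>K. \<forall>x\<in>carr (npull j (tow 1)). norm x \<le> K * norm (Q x)" using Q_resolvent by (simp add: carr_level_1)
  show "\<exists>K. \<forall>x\<in>carr (npull j (tow 1)). nrm (npull j (tow 1)) x \<le> K * norm (Q x)"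
  proof (intro exI ballI)
    fix x assume "x \<in> carr (npull j (tow 1))"
    then have "j x \<in> carr (generated_level D Q j \<Phi> 1)" by (simp add: carr_level_1 level_1)
    then have "nrm (tow 1) (j x) \<le> L * nrm (generated_level D Q j \<Phi> 1) (j x)" using L by (simp add: op_bound_def)
    then show "nrm (npull j (tow 1)) x \<le> L * norm (Q x)" by (simp add: npull_def level_1)
  qed
  show "\<exists>K. \<forall>x\<in>carr (npull j (tow 1)). norm (Q x) \<le> K * nrm (npull j (tow 1)) x"
  proof (intro exI ballI)
    fix x assume "x \<in> carr (npull j (tow 1))"
    then have "j x \<in> carr (tow 1)" by (simp add: npull_def)
    then have "nrm (generated_level D Q j \<Phi> 1) (j x) \<le> K * nrm (tow 1) (j x)" using K by (simp add: op_bound_def)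
    then show "norm (Q x) \<le> K * nrm (npull j (tow 1)) x" by (simp add: npull_def level_1)
  qed
qed

lemma banach_couple_01: "banach_couple (integer_level D Q j 0) (integer_level D Q j 1)"
proof -
  obtain K where K: "\<And>x. x \<in> D \<Longrightarrow> norm x \<le> K * norm (Q x)" using Q_resolvent by blast
  have jn: "norm (j z) \<le> K * norm z" for z
    unfolding j_norm using K[OF the_inv_mem, of z] by (simp add: Q_the_inv)
  have K1: "norm (j z) \<le> (K * K) * norm (Q z)" if "z \<in> D" for z
  proof (cases "0 \<le> K")
    case True
    then show ?thesis using jn[of z] mult_left_mono[OF K[OF that] True] by (simp add: mult.assoc)
  next
    case False
    then have "norm z \<le> 0" using order_trans[OF norm_ge_zero jn[of z]] by (simp add: zero_le_mult_iff)
    then show ?thesis using linear_0[OF j_linear] Q_zero by simp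
  qed
  interpret Z: graph_space "npull j (tow 1)" Q by (rule graph_space_level_1)
  have inv: "inv j (j x) = x" for x using j_inj by simp
  have "banach_space (integer_level D Q j 0)"
    by (rule banach_space_isometric_image[OF j_linear]) (auto simp: integer_level_def inv)
  moreover have "banach_space (integer_level D Q j 1)"
  proof (rule banach_space_isometric_image)
    show "linear (j \<circ> Z.R)" by (intro linear_compose j_linear bounded_linear.linear Z.bounded_linear_R)
    have "range Z.R = D" using Z.R_mem Z.R_Q unfolding carr_level_1 by (auto intro: range_eqI[OF sym])
    then show "carr (integer_level D Q j 1) = range (j \<circ> Z.R)" by (auto simp: integer_level_def)
    show "nrm (integer_level D Q j 1) ((j \<circ> Z.R) x) = norm x" for x by (simp add: integer_level_def inv)
  qed
  moreover have "embedded (integer_level D Q j 0) whole"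
    unfolding embedded_def op_bound_def using jn
    by (intro exI[of _ K]) (auto simp: integer_level_def whole_def inv)
  moreover have "embedded (integer_level D Q j 1) whole"
    unfolding embedded_def op_bound_def using K1
    by (intro exI[of _ "K * K"]) (auto simp: integer_level_def whole_def inv)
  ultimately show ?thesis by (simp add: banach_couple_def)
qed

text \<open>
  The domain with the graph norm embeds into the levels of order \<open>\<alpha> \<in> (0, 1]\<close>; for \<open>\<alpha> < 1\<close> this is the embedding
  of the intersection of a Banach couple into its interpolation spaces.
\<close>

lemma level_embedding:
  assumes "0 < \<alpha>" "\<alpha> \<le> 1"
  shows "\<exists>K. \<forall>x\<in>D. x \<in> carr (npull j (tow \<alpha>)) \<and> nrm (npull j (tow \<alpha>)) x \<le> K * norm (Q x)"
proof (cases "\<alpha> = 1")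
  case True
  interpret Z: graph_space "npull j (tow 1)" Q by (rule graph_space_level_1)
  show ?thesis using Z.nrm_le_Q unfolding True carr_level_1 by auto
next
  case False
  then have a: "0 < \<alpha>" "\<alpha> < 1" using assms by auto
  have fl: "\<lfloor>\<alpha>\<rfloor> = 0" using a by linarith
  have notint: "\<alpha> \<notin> \<int>" using a fl by (metis Ints_cases floor_of_int less_irrefl of_int_0)
  obtain \<Phi> where ex: "exact_interpolation_functor (\<Phi> \<alpha>)"
    and e: "equivalent_spaces (tow \<alpha>) (generated_level D Q j \<Phi> \<alpha>)"
    using tower_equivalent a by (meson dual_order.trans less_imp_le le_minus_one_simps(1) zero_le_one neg_le_0_iff_le)
  let ?I0 = "integer_level D Q j 0" and ?I1 = "integer_level D Q j 1"
  have gl: "generated_level D Q j \<Phi> \<alpha> = \<Phi> \<alpha> ?I0 ?I1"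
    using notint a by (simp add: generated_level_def fl frac_def)
  have "embedded (couple_inter ?I0 ?I1) (\<Phi> \<alpha> ?I0 ?I1)"
    using ex banach_couple_01 by (simp add: exact_interpolation_functor_def)
  then obtain K where K: "op_bound (couple_inter ?I0 ?I1) (\<Phi> \<alpha> ?I0 ?I1) (\<lambda>z. z) K" by (auto simp: embedded_def)
  obtain L where L: "op_bound (\<Phi> \<alpha> ?I0 ?I1) (tow \<alpha>) (\<lambda>z. z) L"
    using e unfolding gl equivalent_spaces_def embedded_def by blast
  obtain M where M: "\<And>x. x \<in> D \<Longrightarrow> norm x \<le> M * norm (Q x)" using Q_resolvent by blast
  have inv: "inv j (j x) = x" for x using j_inj by simp
  have nL: "normed_nspace (\<Phi> \<alpha> ?I0 ?I1)"
    using ex banach_couple_01 banach_space_normed by (auto simp: exact_interpolation_functor_def)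
  show ?thesis
  proof (intro exI ballI)
    fix x assume x: "x \<in> D"
    have jc: "j x \<in> carr (couple_inter ?I0 ?I1)" using x by (auto simp: couple_inter_def integer_level_def)
    have nm: "nrm (couple_inter ?I0 ?I1) (j x) = max (norm x) (norm (Q x))"
      by (simp add: couple_inter_def integer_level_def inv)
    have 1: "j x \<in> carr (\<Phi> \<alpha> ?I0 ?I1)"
      "nrm (\<Phi> \<alpha> ?I0 ?I1) (j x) \<le> K * max (norm x) (norm (Q x))"
      using bspec[OF K[unfolded op_bound_def] jc] unfolding nm by blast+
    have 2: "j x \<in> carr (tow \<alpha>)" "nrm (tow \<alpha>) (j x) \<le> L * nrm (\<Phi> \<alpha> ?I0 ?I1) (j x)"
      using L 1(1) unfolding op_bound_def by auto
    have "nrm (tow \<alpha>) (j x) \<le> \<bar>L\<bar> * (\<bar>K\<bar> * ((\<bar>M\<bar> + 1) * norm (Q x)))"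
    proof -
      have "L * nrm (\<Phi> \<alpha> ?I0 ?I1) (j x) \<le> \<bar>L\<bar> * nrm (\<Phi> \<alpha> ?I0 ?I1) (j x)"
        using normed_nspaceD(4)[OF nL 1(1)] by (intro mult_right_mono) auto
      also have "\<dots> \<le> \<bar>L\<bar> * (\<bar>K\<bar> * max (norm x) (norm (Q x)))"
        by (intro mult_left_mono order_trans[OF 1(2)] mult_right_mono) (auto simp: max_def)
      also have "max (norm x) (norm (Q x)) \<le> (\<bar>M\<bar> + 1) * norm (Q x)"
      proof -
        have "M * norm (Q x) \<le> \<bar>M\<bar> * norm (Q x)" by (rule mult_right_mono) auto
        then show ?thesis using M[OF x] by (simp add: distrib_right add_increasing add_increasing2)
      qed
      finally show ?thesis using 2(2) by (simp add: mult_left_mono)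
    qed
    then show "x \<in> carr (npull j (tow \<alpha>)) \<and> nrm (npull j (tow \<alpha>)) x \<le> (\<bar>L\<bar> * \<bar>K\<bar> * (\<bar>M\<bar> + 1)) * norm (Q x)"
      using 2(1) by (simp add: npull_def mult.assoc)
  qed
qed

end

text \<open>
  Growth bounds on the domain carry over to the whole space, since the isomorphism \<open>A - \<mu>\<close> commutes with
  the semigroup.
\<close>

lemma semigroup_graphI:
  assumes sc: "scale D (\<lambda>x. A x - \<mu> *\<^sub>R x) j tow" and gen: "generates_semigroup D A T"
    and bound: "\<And>t. 0 < t \<Longrightarrow> op_bound (npull j (tow 1)) (npull j (tow 1)) (T t) (M * exp (\<omega> * t))"
  shows "semigroup_graph (npull j (tow 1)) (\<lambda>x. A x - \<mu> *\<^sub>R x) T"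
proof -
  interpret scale D "\<lambda>x. A x - \<mu> *\<^sub>R x" j tow by (rule sc)
  interpret Z: graph_space "npull j (tow 1)" "\<lambda>x. A x - \<mu> *\<^sub>R x" by (rule graph_space_level_1)
  let ?Q = "\<lambda>x. A x - \<mu> *\<^sub>R x"
  have bl: "bounded_linear (T t)" if "0 \<le> t" for t using gen that by (simp add: generates_semigroup_def)
  have mem: "T t x \<in> D" if "0 \<le> t" "x \<in> D" for t x by (rule generates_semigroup_invariant[OF gen that(2,1)])
  have comm: "?Q (T t x) = T t (?Q x)" if "0 \<le> t" "x \<in> D" for t x
    using generates_semigroup_invariant(2)[OF gen that(2,1)] by (simp add: linear_simps[OF bl[OF that(1)]])
  obtain K where K: "K > 0" "\<And>x. x \<in> D \<Longrightarrow> nrm (npull j (tow 1)) x \<le> K * norm (?Q x)"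
    using Z.nrm_bound unfolding carr_level_1 by blast
  obtain L where L: "L > 0" "\<And>x. x \<in> D \<Longrightarrow> norm (?Q x) \<le> L * nrm (npull j (tow 1)) x"
    using Z.Q_bound unfolding carr_level_1 by blast
  define M' where "M' = max 1 (L * (\<bar>M\<bar> * K))"
  have growth: "norm (T t x) \<le> M' * exp (\<omega> * t) * norm x" if t: "0 \<le> t" for t x
  proof (cases "t = 0")
    case True
    then have "T t x = x" using gen by (simp add: generates_semigroup_def)
    then show ?thesis using True by (simp add: M'_def mult_right_mono[of 1 _ "norm x", simplified])
  next
    case False
    then have t0: "0 < t" using t by simp
    define y where "y = Z.R x"
    have y: "y \<in> D" "?Q y = x" using Z.R_mem[of x] Z.Q_R[of x] unfolding carr_level_1 by (auto simp: y_def)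
    have "norm (T t x) = norm (?Q (T t y))" using comm[OF t y(1)] y(2) by simp
    also have "\<dots> \<le> L * nrm (npull j (tow 1)) (T t y)" by (rule L(2)[OF mem[OF t y(1)]])
    also have "\<dots> \<le> L * (M * exp (\<omega> * t) * nrm (npull j (tow 1)) y)"
      using bound[OF t0] y L(1) unfolding op_bound_def carr_level_1 by (intro mult_left_mono) auto
    also have "\<dots> \<le> L * (\<bar>M\<bar> * exp (\<omega> * t) * (K * norm x))"
      using K(2)[OF y(1)] y L(1) normed_nspaceD(4)[OF Z.normed, unfolded carr_level_1]
      by (intro mult_left_mono mult_mono) auto
    also have "\<dots> = (L * (\<bar>M\<bar> * K)) * (exp (\<omega> * t) * norm x)" by simp
    also have "\<dots> \<le> M' * (exp (\<omega> * t) * norm x)" by (rule mult_right_mono) (auto simp: M'_def)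
    finally show ?thesis by (simp add: mult.assoc)
  qed
  show ?thesis
  proof (rule semigroup_graph.intro[OF Z.graph_space_axioms semigroup_graph_axioms.intro])
    show "bounded_linear (T t)" if "0 \<le> t" for t by (rule bl[OF that])
    show "T (s + t) x = T s (T t x)" if "0 \<le> s" "0 \<le> t" for s t x
      using gen that by (simp add: generates_semigroup_def)
    show "\<exists>M \<omega>. \<forall>t\<ge>0. \<forall>x. norm (T t x) \<le> M * exp (\<omega> * t) * norm x" using growth by blast
    show "continuous_on {0..} (\<lambda>t. T t x)" for x by (rule semigroup_continuous_on[OF gen growth])
    show "T t x \<in> carr (npull j (tow 1))" if "0 \<le> t" "x \<in> carr (npull j (tow 1))" for t x
      using mem that by (simp add: carr_level_1)
    show "A (T t x) - \<mu> *\<^sub>R T t x = T t (A x - \<mu> *\<^sub>R x)" if "0 \<le> t" "x \<in> carr (npull j (tow 1))" for t x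
      using comm that by (simp add: carr_level_1)
  qed
qed

section \<open>The split fast-slow system\<close>

text \<open>
  The fast-slow system together with one splitting of the slow space and one pair \<open>(\<epsilon>, \<zeta>)\<close> that satisfies
  the gap condition.
\<close>

locale split_fast_slow =
  fast_slow X Y \<gamma>X \<delta>X \<delta>Y f g Lf Lg MA CA MB CB \<omega>A \<omega>B \<omega>f +
  slow_splitting X Y \<delta>Y g Lg \<omega>A CF Ms \<zeta> F S NF NS
  for X :: "('x::banach, 'xm::banach) scaled_semigroup"
    and Y :: "('y::banach, 'ym::banach) scaled_semigroup"
    and \<gamma>X \<delta>X \<delta>Y f g Lf Lg MA CA MB CB \<omega>A \<omega>B \<omega>f CF Ms \<zeta> F S NF NS +
  fixes \<epsilon> :: real
  assumes splitting_pos: "0 < CF" "0 < Ms" "0 < \<zeta>" "0 < \<epsilon>"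
    and fast_Lipschitz: "\<And>p q. p \<in> carr (split_space X Y F S) \<Longrightarrow> q \<in> carr (split_space X Y F S) \<Longrightarrow>
        proj F S (g (joined p) - g (joined q)) \<in> carr (lev Y \<delta>Y) \<and>
        nrm (lev Y \<delta>Y) (proj F S (g (joined p) - g (joined q)))
          \<le> Lg * nrm (split_space X Y F S) (p - q)"
    and gap_cond: "gap_condition \<gamma>X \<delta>Y Lf Lg CA CF Ms \<omega>A NF NS \<epsilon> \<zeta>"
begin

text \<open>
  A shift that makes \<open>B - \<mu>\<close> the generator of the scale of the slow variable.
\<close>

definition \<mu> :: real where
  "\<mu> = (SOME m. interp_extrap_scale (opdom Y) (\<lambda>y. oper Y y - m *\<^sub>R y) (emb Y) (tower Y))"

text \<open>
  The shifted generator, whose graph norm is equivalent to the norm of \<open>Y\<^sub>1\<close>.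
\<close>

definition QY :: "'y \<Rightarrow> 'y" where "QY y = oper Y y - \<mu> *\<^sub>R y"

abbreviation PF :: "'y \<Rightarrow> 'y" where "PF \<equiv> proj F S"
abbreviation PS :: "'y \<Rightarrow> 'y" where "PS \<equiv> proj S F"
abbreviation \<eta> :: real where "\<eta> \<equiv> eta \<omega>A \<zeta> NF NS"
abbreviation E :: "('x \<times> 'y \<times> 'y) nspace" where "E \<equiv> split_space X Y F S"

text \<open>
  The group on \<open>S\<close> with reversed time, extended by the projection to a family of operators on the whole space.
\<close>

definition slow_back :: "real \<Rightarrow> 'y \<Rightarrow> 'y" where "slow_back r y = slow_group Y S (- r) (PS y)"

sublocale XS: scale "opdom X" "oper X" "emb X" "tower X"
  by (rule scale.intro[OF X_scale])

sublocale YS: scale "opdom Y" QY "emb Y" "tower Y"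
proof
  have "\<exists>m. interp_extrap_scale (opdom Y) (\<lambda>y. oper Y y - m *\<^sub>R y) (emb Y) (tower Y)" using Y_scale by blast
  from someI_ex[OF this] show "interp_extrap_scale (opdom Y) QY (emb Y) (tower Y)"
    unfolding QY_def \<mu>_def by simp
qed

lemma carr_X1: "carr (lev X 1) = opdom X" and carr_Y1: "carr (lev Y 1) = opdom Y"
  using XS.carr_level_1 YS.carr_level_1 by (auto simp: lev_def)

lemma normed_lev_X: "-1 \<le> \<alpha> \<Longrightarrow> normed_nspace (lev X \<alpha>)" and normed_lev_Y: "-1 \<le> \<alpha> \<Longrightarrow> normed_nspace (lev Y \<alpha>)"
  using XS.normed_level YS.normed_level by (auto simp: lev_def)

sublocale XG: semigroup_graph "lev X 1" "oper X" "semi X"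
proof -
  have "scale (opdom X) (\<lambda>x. oper X x - 0 *\<^sub>R x) (emb X) (tower X)" using XS.scale_axioms by simp
  from semigroup_graphI[OF this A_generates A_bound[unfolded lev_def]]
  show "semigroup_graph (lev X 1) (oper X) (semi X)" by (simp add: lev_def)
qed

sublocale XE: semigroup_graph "lev X 1" "oper X" "\<lambda>r. semi X (r / \<epsilon>)"
proof (rule semigroup_graph.intro[OF XG.graph_space_axioms semigroup_graph_axioms.intro])
  have \<epsilon>: "0 \<le> t \<Longrightarrow> 0 \<le> t / \<epsilon>" for t using splitting_pos by simp
  show "bounded_linear (semi X (t / \<epsilon>))" if "0 \<le> t" for t by (rule XG.T_bl[OF \<epsilon>[OF that]])
  show "semi X ((s + t) / \<epsilon>) x = semi X (s / \<epsilon>) (semi X (t / \<epsilon>) x)" if "0 \<le> s" "0 \<le> t" for s t x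
    using XG.T_add[OF \<epsilon>[OF that(1)] \<epsilon>[OF that(2)]] by (simp add: add_divide_distrib)
  obtain M \<omega> where "\<And>t x. 0 \<le> t \<Longrightarrow> norm (semi X t x) \<le> M * exp (\<omega> * t) * norm x" using XG.T_growth by blast
  then have "\<forall>t\<ge>0. \<forall>x. norm (semi X (t / \<epsilon>) x) \<le> M * exp ((\<omega> / \<epsilon>) * t) * norm x" using \<epsilon> by fastforce
  then show "\<exists>M \<omega>. \<forall>t\<ge>0. \<forall>x. norm (semi X (t / \<epsilon>) x) \<le> M * exp (\<omega> * t) * norm x" by blast
  show "continuous_on {0..} (\<lambda>t. semi X (t / \<epsilon>) x)" for x
    by (rule continuous_on_compose2[OF XG.T_cont[of x]]) (use splitting_pos in \<open>auto intro!: continuous_intros\<close>)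
  show "semi X (t / \<epsilon>) x \<in> carr (lev X 1)" if "0 \<le> t" "x \<in> carr (lev X 1)" for t x
    by (rule XG.T_mem[OF \<epsilon>[OF that(1)] that(2)])
  show "oper X (semi X (t / \<epsilon>) x) = semi X (t / \<epsilon>) (oper X x)" if "0 \<le> t" "x \<in> carr (lev X 1)" for t x
    by (rule XG.Q_T[OF \<epsilon>[OF that(1)] that(2)])
qed

sublocale YG: semigroup_graph "lev Y 1" QY "semi Y"
proof -
  have q: "QY = (\<lambda>y. oper Y y - \<mu> *\<^sub>R y)" by (simp add: QY_def fun_eq_iff)
  show "semigroup_graph (lev Y 1) QY (semi Y)"
    using semigroup_graphI[OF YS.scale_axioms[unfolded q] B_generates B_bound[unfolded lev_def]]
    unfolding q lev_def .
qed

lemma direct_sum': "\<exists>!b. b \<in> S \<and> y - b \<in> F"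
proof -
  obtain a where a: "a \<in> F" "y - a \<in> S" "\<And>a'. a' \<in> F \<Longrightarrow> y - a' \<in> S \<Longrightarrow> a' = a" using direct_sum[of y] by blast
  show ?thesis
  proof (rule ex1I[of _ "y - a"])
    fix b assume "b \<in> S \<and> y - b \<in> F"
    then have "y - b = a" using a(3)[of "y - b"] by simp
    then have eq: "a = y - b" by simp
    show "b = y - a" unfolding eq by simp
  qed (use a(1,2) in simp)
qed

lemma PF_bl: "bounded_linear PF"
  by (rule bounded_linear_proj[OF subspaces direct_sum])

lemma PS_bl: "bounded_linear PS"
  by (rule bounded_linear_proj[OF subspaces(2,1,4,3) direct_sum'])

lemma PF_mem [simp]: "PF y \<in> F" and PS_mem [simp]: "PS y \<in> S"
  using proj_mem[OF direct_sum] proj_mem[OF direct_sum'] by auto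

lemma PF_id: "y \<in> F \<Longrightarrow> PF y = y" and PS_id: "y \<in> S \<Longrightarrow> PS y = y"
  using proj_eqI[OF direct_sum, of y y] proj_eqI[OF direct_sum', of y y] subspaces(1,2)
  by (auto simp: subspace_0)

lemma PF_S: "y \<in> S \<Longrightarrow> PF y = 0" and PS_F: "y \<in> F \<Longrightarrow> PS y = 0"
  using proj_eqI[OF direct_sum, of 0 y] proj_eqI[OF direct_sum', of 0 y] subspaces(1,2)
  by (auto simp: subspace_0)

lemma oper_PF: "y \<in> opdom Y \<Longrightarrow> PF y \<in> opdom Y" "y \<in> opdom Y \<Longrightarrow> oper Y (PF y) = PF (oper Y y)"
  using commute_F by auto

lemma oper_PS: "y \<in> opdom Y \<Longrightarrow> PS y \<in> opdom Y" "y \<in> opdom Y \<Longrightarrow> oper Y (PS y) = PS (oper Y y)"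
  using commute_S by auto

lemma QY_PF: "y \<in> opdom Y \<Longrightarrow> QY (PF y) = PF (QY y)" and QY_PS: "y \<in> opdom Y \<Longrightarrow> QY (PS y) = PS (QY y)"
  by (simp_all add: QY_def oper_PF oper_PS linear_simps[OF PF_bl] linear_simps[OF PS_bl])

lemma semi_generator:
  assumes "y \<in> opdom Y"
  shows "((\<lambda>h. (semi Y h y - semi Y 0 y) /\<^sub>R h) \<longlongrightarrow> oper Y y) (at_right 0)"
  using B_generates assms unfolding generates_semigroup_def by auto

lemma semi_0: "semi X 0 x = x" "semi Y 0 y = y"
  using A_generates B_generates unfolding generates_semigroup_def by auto

text \<open>
  On the domain, \<open>r \<mapsto> PF (semi Y r y)\<close> solves the Cauchy problem with initial value \<open>PF y\<close>; density and the
  boundedness of the projection give the rest. In particular the semigroup leaves \<open>F\<close> invariant.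
\<close>

lemma PF_semi:
  assumes t: "0 \<le> t"
  shows "PF (semi Y t y) = semi Y t (PF y)"
proof -
  have D: "PF (semi Y t y) = semi Y t (PF y)" if y: "y \<in> opdom Y" for y
  proof -
    have inv: "semi Y r y \<in> opdom Y" "oper Y (semi Y r y) = semi Y r (oper Y y)" if "0 \<le> r" for r
      by (rule generates_semigroup_invariant[OF B_generates y that])+
    have "((\<lambda>r. semi Y (t - r) (PF (semi Y r (oper Y y)) + (-1) *\<^sub>R oper Y (PF (semi Y r y)))) has_integral
        semi Y (t - t) (PF (semi Y t y)) - semi Y (t - 0) (PF (semi Y 0 y))) {0..t}"
    proof (rule YG.moving_integral)
      fix r assume r: "r \<in> {0..t}"
      show "((\<lambda>h. (semi Y h (PF (semi Y r y)) - semi Y 0 (PF (semi Y r y))) /\<^sub>R h) \<longlongrightarrow> oper Y (PF (semi Y r y))) (at_right 0)"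
        using r by (intro semi_generator oper_PF inv) simp
      have "((\<lambda>r. semi Y r y) has_vector_derivative semi Y r (oper Y y)) (at r within {0..t})"
        by (rule has_vector_derivative_within_subset[OF YG.orbit_derivative[OF semi_generator[OF y]]]) (use r in auto)
      from bounded_linear.has_vector_derivative[OF PF_bl this]
      show "((\<lambda>r. PF (semi Y r y)) has_vector_derivative PF (semi Y r (oper Y y))) (at r within {0..t})" .
    next
      show "t - q = t + (-1) * q" for q by simp
    qed (use t in auto)
    moreover have "semi Y (t - r) (PF (semi Y r (oper Y y)) + (-1) *\<^sub>R oper Y (PF (semi Y r y))) = 0" if "r \<in> {0..t}" for r
      using that inv[of r] oper_PF(2)[OF inv(1)[of r]] linear_0[OF YG.T_linear, of "t - r"] by simp
    ultimately have "((\<lambda>r. 0) has_integral semi Y (t - t) (PF (semi Y t y)) - semi Y (t - 0) (PF (semi Y 0 y))) {0..t}"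
      by (rule has_integral_eq[rotated])
    then have "semi Y (t - t) (PF (semi Y t y)) - semi Y (t - 0) (PF (semi Y 0 y)) = 0"
      using has_integral_unique has_integral_0 by blast
    then show ?thesis by (simp add: semi_0)
  qed
  have "closed {y. PF (semi Y t y) = semi Y t (PF y)}"
    using bounded_linear_compose[OF PF_bl YG.T_bl[OF t]] bounded_linear_compose[OF YG.T_bl[OF t] PF_bl]
    by (intro closed_Collect_eq linear_continuous_on) auto
  then have "closure (opdom Y) \<subseteq> {y. PF (semi Y t y) = semi Y t (PF y)}"
    by (intro closure_minimal) (use D in auto)
  then show ?thesis using YS.D_dense by blast
qed

lemma semi_F: "0 \<le> t \<Longrightarrow> y \<in> F \<Longrightarrow> semi Y t y \<in> F"
  using PF_semi[of t y] PF_id[of y] PF_mem by metis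

lemma group_facts:
  shows "\<And>x y c d t. x \<in> S \<Longrightarrow> y \<in> S \<Longrightarrow> slow_group Y S t (c *\<^sub>R x + d *\<^sub>R y) = c *\<^sub>R slow_group Y S t x + d *\<^sub>R slow_group Y S t y"
    and "\<And>t. \<exists>K. \<forall>x\<in>S. slow_group Y S t x \<in> S \<and> norm (slow_group Y S t x) \<le> K * norm x"
    and "\<And>x. x \<in> S \<Longrightarrow> slow_group Y S 0 x = x"
    and "\<And>s t x. x \<in> S \<Longrightarrow> slow_group Y S (s + t) x = slow_group Y S s (slow_group Y S t x)"
    and "\<And>x. x \<in> S \<Longrightarrow> ((\<lambda>t. slow_group Y S t x) \<longlongrightarrow> x) (at 0)"
    and "\<And>x y. x \<in> S \<Longrightarrow> y \<in> S \<Longrightarrow> x \<in> opdom Y \<and> oper Y x = y \<longleftrightarrow>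
       ((\<lambda>t. (slow_group Y S t x - x) /\<^sub>R t) \<longlongrightarrow> y) (at 0)"
proof -
  note g = slow_generates[unfolded generates_group_on_def]
  note g1 = conjunct1[OF g] and g2 = conjunct1[OF conjunct2[OF g]]
    and g3 = conjunct1[OF conjunct2[OF conjunct2[OF g]]]
    and g4 = conjunct1[OF conjunct2[OF conjunct2[OF conjunct2[OF g]]]]
    and g5 = conjunct2[OF conjunct2[OF conjunct2[OF conjunct2[OF g]]]]
  show "slow_group Y S t (c *\<^sub>R x + d *\<^sub>R y) = c *\<^sub>R slow_group Y S t x + d *\<^sub>R slow_group Y S t y"
    if "x \<in> S" "y \<in> S" for x y c d t
    using conjunct1[OF spec[OF g1, of t]] that by (simp add: linear_between_def nsub_def whole_def)
  show "\<exists>K. \<forall>x\<in>S. slow_group Y S t x \<in> S \<and> norm (slow_group Y S t x) \<le> K * norm x" for t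
  proof -
    obtain K where "op_bound (nsub whole S) (nsub whole S) (slow_group Y S t) K"
      using conjunct2[OF spec[OF g1, of t]] by (rule exE)
    then show ?thesis by (auto simp: op_bound_def nsub_def whole_def)
  qed
  show "slow_group Y S 0 x = x" if "x \<in> S" for x using bspec[OF g2 that] .
  show "slow_group Y S (s + t) x = slow_group Y S s (slow_group Y S t x)" if "x \<in> S" for s t x
    using bspec[OF spec[OF spec[OF g3]] that] .
  show "((\<lambda>t. slow_group Y S t x) \<longlongrightarrow> x) (at 0)" if "x \<in> S" for x using bspec[OF g4 that] .
  show "x \<in> opdom Y \<and> oper Y x = y \<longleftrightarrow> ((\<lambda>t. (slow_group Y S t x - x) /\<^sub>R t) \<longlongrightarrow> y) (at 0)"
    if "x \<in> S" "y \<in> S" for x y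
  proof -
    have "(x \<in> part_dom S (opdom Y) (oper Y) \<and> oper Y x = y) \<longleftrightarrow> (x \<in> opdom Y \<and> oper Y x = y)"
      using that by (auto simp: part_dom_def)
    then show ?thesis using bspec[OF bspec[OF g5 that(1)] that(2)] by simp
  qed
qed

lemma oper_S: "x \<in> S \<Longrightarrow> x \<in> opdom Y \<Longrightarrow> oper Y x \<in> S"
  using oper_PS(2)[of x] PS_id[of x] PS_mem by metis

lemma slow_back_bl: "bounded_linear (slow_back t)"
proof -
  obtain K where K: "\<forall>x\<in>S. slow_group Y S (- t) x \<in> S \<and> norm (slow_group Y S (- t) x) \<le> K * norm x"
    using group_facts(2)[of "- t"] by (rule exE)
  interpret P: bounded_linear PS by (rule PS_bl)
  obtain L where L: "L \<ge> 0" "\<And>y. norm (PS y) \<le> norm y * L" using P.nonneg_bounded by blast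
  show ?thesis
  proof (rule bounded_linear_intro[where K = "\<bar>K\<bar> * L"])
    show "slow_back t (x + y) = slow_back t x + slow_back t y" for x y
      using group_facts(1)[of "PS x" "PS y" "- t" 1 1] by (simp add: slow_back_def P.add)
    show "slow_back t (c *\<^sub>R x) = c *\<^sub>R slow_back t x" for c x
      using group_facts(1)[of "PS x" "PS x" "- t" c 0] by (simp add: slow_back_def P.scaleR)
    show "norm (slow_back t x) \<le> norm x * (\<bar>K\<bar> * L)" for x
    proof -
      have "norm (slow_back t x) \<le> K * norm (PS x)" unfolding slow_back_def using K by simp
      also have "\<dots> \<le> \<bar>K\<bar> * (norm x * L)" by (intro mult_mono L) auto
      finally show ?thesis by (simp add: mult_ac)
    qed
  qed
qed

lemma slow_back_S [simp]: "slow_back t y \<in> S"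
  using group_facts(2)[of "- t"] by (auto simp: slow_back_def)

lemma slow_back_PS: "slow_back t (PS y) = slow_back t y"
  by (simp add: slow_back_def PS_id)

lemma slow_back_add: "slow_back (s + t) y = slow_back s (slow_back t y)"
  using group_facts(4)[of "PS y" "- s" "- t"] slow_back_S[of t y]
  by (simp add: slow_back_def PS_id add.commute)

lemma slow_back_0: "slow_back 0 y = PS y"
  by (simp add: slow_back_def group_facts(3))

lemma slow_back_at_0: "((\<lambda>t. slow_back t y) \<longlongrightarrow> PS y) (at 0)"
proof -
  have "filterlim uminus (at 0) (at (0::real))"
    by (simp add: filterlim_at eventually_at_filter) (auto intro!: tendsto_eq_intros)
  from filterlim_compose[OF group_facts(5)[OF PS_mem, of y] this] show ?thesis by (simp add: slow_back_def)
qed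

lemma slow_back_generator:
  assumes y: "y \<in> opdom Y"
  shows "((\<lambda>h. (slow_back h y - slow_back 0 y) /\<^sub>R h) \<longlongrightarrow> - PS (oper Y y)) (at_right 0)"
proof -
  have m: "filterlim uminus (at 0) (at_right (0::real))"
    by (simp add: filterlim_at eventually_at_filter) (auto intro!: tendsto_eq_intros)
  have "((\<lambda>t. (slow_group Y S t (PS y) - PS y) /\<^sub>R t) \<longlongrightarrow> PS (oper Y y)) (at 0)"
    using group_facts(6)[of "PS y" "PS (oper Y y)"] oper_PS[OF y] by simp
  from tendsto_minus[OF filterlim_compose[OF this m]]
  show ?thesis by (simp add: slow_back_def group_facts(3) scaleR_diff_right)
qed

lemma slow_back_mem:
  assumes y: "y \<in> opdom Y"
  shows "slow_back t y \<in> opdom Y" "oper Y (slow_back t y) = slow_back t (oper Y y)"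
proof -
  let ?z = "slow_back t y"
  have "((\<lambda>h. (slow_group Y S h (PS y) - PS y) /\<^sub>R h) \<longlongrightarrow> PS (oper Y y)) (at 0)"
    using group_facts(6)[of "PS y" "PS (oper Y y)"] oper_PS[OF y] by simp
  from bounded_linear.tendsto[OF slow_back_bl this, of t]
  have "((\<lambda>h. slow_back t ((slow_group Y S h (PS y) - PS y) /\<^sub>R h)) \<longlongrightarrow> slow_back t (PS (oper Y y))) (at 0)" .
  moreover have "slow_back t ((slow_group Y S h (PS y) - PS y) /\<^sub>R h) = (slow_group Y S h ?z - ?z) /\<^sub>R h" for h
  proof -
    have "slow_group Y S h (PS y) \<in> S" using group_facts(2)[of h] by auto
    then have "slow_back t (slow_group Y S h (PS y)) = slow_group Y S (- t + h) (PS y)"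
      using group_facts(4)[of "PS y" "- t" h] by (simp add: slow_back_def PS_id)
    also have "\<dots> = slow_group Y S h ?z"
      using group_facts(4)[of "PS y" h "- t"] by (simp add: slow_back_def)
    finally have eq: "slow_back t (slow_group Y S h (PS y)) = slow_group Y S h ?z" .
    interpret B: bounded_linear "slow_back t" by (rule slow_back_bl)
    show ?thesis by (simp only: B.scaleR B.diff eq slow_back_PS)
  qed
  moreover have "slow_back t (PS (oper Y y)) = slow_back t (oper Y y)" by (simp add: slow_back_def PS_id)
  ultimately have "((\<lambda>h. (slow_group Y S h ?z - ?z) /\<^sub>R h) \<longlongrightarrow> slow_back t (oper Y y)) (at 0)" by simp
  then show "?z \<in> opdom Y" "oper Y ?z = slow_back t (oper Y y)"
    using group_facts(6)[of ?z "slow_back t (oper Y y)"] by auto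
qed

lemma QY_slow_back: "y \<in> opdom Y \<Longrightarrow> QY (slow_back t y) = slow_back t (QY y)"
  by (simp add: QY_def slow_back_mem linear_simps[OF slow_back_bl])

lemma slow_back_nrm:
  assumes "0 \<le> r" "y \<in> S" "y \<in> opdom Y"
  shows "nrm (lev Y 1) (slow_back r y) \<le> Ms * exp (- (NS + \<omega>A / \<zeta>) * r) * nrm (lev Y 1) y"
  using slow_bound[OF assms(1)] assms(2,3) by (simp add: op_bound_def nsub_def carr_Y1 slow_back_def PS_id)

sublocale SG: semigroup_graph "lev Y 1" QY slow_back
proof (rule semigroup_graph.intro[OF YG.graph_space_axioms semigroup_graph_axioms.intro])
  show "bounded_linear (slow_back t)" for t by (rule slow_back_bl)
  show "slow_back (s + t) x = slow_back s (slow_back t x)" for s t x by (rule slow_back_add)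
  obtain K where K: "K > 0" "\<And>x. x \<in> opdom Y \<Longrightarrow> nrm (lev Y 1) x \<le> K * norm (QY x)"
    using YG.nrm_bound unfolding carr_Y1 by blast
  obtain L where L: "L > 0" "\<And>x. x \<in> opdom Y \<Longrightarrow> norm (QY x) \<le> L * nrm (lev Y 1) x"
    using YG.Q_bound unfolding carr_Y1 by blast
  obtain P where P: "P \<ge> 0" "\<And>y. norm (PS y) \<le> norm y * P" using bounded_linear.nonneg_bounded[OF PS_bl] by blast
  have "norm (slow_back t x) \<le> (L * (Ms * (K * P))) * exp (- (NS + \<omega>A / \<zeta>) * t) * norm x" if t: "0 \<le> t" for t x
  proof -
    define y where "y = PS (YG.R x)"
    have R: "YG.R x \<in> opdom Y" using YG.R_mem[of x] by (simp add: carr_Y1)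
    have y: "y \<in> opdom Y" "y \<in> S" "QY y = PS x" using oper_PS[OF R] QY_PS[OF R] by (simp_all add: y_def)
    have "norm (slow_back t x) = norm (QY (slow_back t y))" by (simp add: QY_slow_back y slow_back_PS)
    also have "\<dots> \<le> L * nrm (lev Y 1) (slow_back t y)" by (rule L(2)[OF slow_back_mem(1)[OF y(1)]])
    also have "\<dots> \<le> L * (Ms * exp (- (NS + \<omega>A / \<zeta>) * t) * nrm (lev Y 1) y)"
      using L(1) by (intro mult_left_mono slow_back_nrm t y) auto
    also have "\<dots> \<le> L * (Ms * exp (- (NS + \<omega>A / \<zeta>) * t) * (K * (norm x * P)))"
    proof -
      have "nrm (lev Y 1) y \<le> K * (norm x * P)"
      proof -
        have "nrm (lev Y 1) y \<le> K * norm (PS x)" using K(2)[OF y(1)] y(3) by simp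
        also have "\<dots> \<le> K * (norm x * P)" using P K(1) by (intro mult_left_mono) auto
        finally show ?thesis .
      qed
      then show ?thesis using L(1) splitting_pos by (intro mult_left_mono) auto
    qed
    finally show ?thesis by (simp add: mult_ac)
  qed
  then show "\<exists>M \<omega>. \<forall>t\<ge>0. \<forall>x. norm (slow_back t x) \<le> M * exp (\<omega> * t) * norm x" by blast
  show "continuous_on {0..} (\<lambda>t. slow_back t x)" for x
  proof (rule continuous_at_imp_continuous_on, intro ballI)
    fix r :: real
    have shift: "filterlim (\<lambda>q. q - r) (at 0) (at r)"
      by (simp add: filterlim_at eventually_at_filter) (auto intro!: tendsto_eq_intros)
    have "((\<lambda>q. slow_back r (slow_back (q - r) x)) \<longlongrightarrow> slow_back r (PS x)) (at r)"
      by (rule bounded_linear.tendsto[OF slow_back_bl filterlim_compose[OF slow_back_at_0 shift]])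
    then show "isCont (\<lambda>t. slow_back t x) r"
      by (simp add: isCont_def slow_back_PS flip: slow_back_add)
  qed
  show "slow_back t x \<in> carr (lev Y 1)" if "x \<in> carr (lev Y 1)" for t x
    using slow_back_mem that by (simp add: carr_Y1)
  show "QY (slow_back t x) = slow_back t (QY x)" if "x \<in> carr (lev Y 1)" for t x
    using QY_slow_back that by (simp add: carr_Y1)
qed

lemma carr_split: "(x, a, b) \<in> carr E \<longleftrightarrow> x \<in> opdom X \<and> a \<in> F \<and> a \<in> opdom Y \<and> b \<in> S \<and> b \<in> opdom Y"
  by (simp add: split_space_def nprod_def nsub_def carr_X1 carr_Y1)

lemma nrm_split: "nrm E (x, a, b) = nrm (lev X 1) x + nrm (lev Y 1) a + nrm (lev Y 1) b"
  by (simp add: split_space_def nprod_def nsub_def)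

lemma normed_E: "normed_nspace E"
  unfolding split_space_def using subspaces
  by (intro normed_nprod normed_nsub XG.normed YG.normed)

lemma joined_mem: "p \<in> carr E \<Longrightarrow> joined p \<in> carr (lev X 1 \<times>\<^sub>n lev Y 1)"
  using YG.nD(8) by (cases p) (auto simp: joined_def nprod_def carr_split carr_X1 carr_Y1)

lemma joined_le:
  assumes "p \<in> carr E" "q \<in> carr E"
  shows "nrm (lev X 1 \<times>\<^sub>n lev Y 1) (joined p - joined q) \<le> nrm E (p - q)"
proof -
  obtain x a b x' a' b' where pq: "p = (x, a, b)" "q = (x', a', b')" by (metis prod_cases3)
  have "nrm (lev Y 1) ((a - a') + (b - b')) \<le> nrm (lev Y 1) (a - a') + nrm (lev Y 1) (b - b')"
    using assms YG.nD(9) by (intro YG.nD) (auto simp: pq carr_split carr_Y1)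
  then show ?thesis by (simp add: pq joined_def nprod_def nrm_split add_diff_add)
qed

lemma joined_0: "joined (0 :: 'x \<times> 'y \<times> 'y) = (0, 0)"
  by (simp add: joined_def zero_prod_def)

lemma zero_E: "0 \<in> carr E"
  by (rule normed_nspaceD(2)[OF normed_E])

lemma exponent_gaps: "\<omega>A / \<epsilon> < \<eta>" "NF + \<omega>A / \<zeta> < \<eta>" "\<eta> < NS + \<omega>A / \<zeta>"
  "2 * (\<epsilon> / \<zeta> - 1) * \<omega>A + \<epsilon> * (NS + NF) = 2 * \<epsilon> * (\<eta> - \<omega>A / \<epsilon>)"
proof -
  show eq: "2 * (\<epsilon> / \<zeta> - 1) * \<omega>A + \<epsilon> * (NS + NF) = 2 * \<epsilon> * (\<eta> - \<omega>A / \<epsilon>)"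
    using splitting_pos by (simp add: eta_def field_simps)
  have "0 < 2 * \<epsilon> * (\<eta> - \<omega>A / \<epsilon>)" using gap_cond unfolding eq[symmetric] by (simp add: gap_condition_def)
  then show "\<omega>A / \<epsilon> < \<eta>" using splitting_pos by (simp add: zero_less_mult_iff)
  show "NF + \<omega>A / \<zeta> < \<eta>" "\<eta> < NS + \<omega>A / \<zeta>" using exponents by (auto simp: eta_def field_simps)
qed

text \<open>
  The time scale of the fast variable turns \<open>(1 / \<epsilon>) * (r / \<epsilon>) powr (\<gamma>X - 1)\<close> into \<open>r powr (\<gamma>X - 1) / \<epsilon> powr \<gamma>X\<close>.
\<close>

sublocale LX: smoothing_convolution "lev X 1" "oper X" "\<lambda>r. semi X (r / \<epsilon>)" E
  "\<lambda>p. (1 / \<epsilon>) *\<^sub>R f (joined p)" "CA * Lf / \<epsilon> powr \<gamma>X" \<gamma>X "\<omega>A / \<epsilon>" \<eta>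
proof
  have n\<gamma>: "normed_nspace (lev X \<gamma>X)" using \<gamma>X by (intro normed_lev_X) simp
  show "normed_nspace E" by (rule normed_E)
  show "(1 / \<epsilon>) *\<^sub>R f (joined 0) = 0" by (simp add: joined_0 f_zero)
  show "0 \<le> CA * Lf / \<epsilon> powr \<gamma>X" using constants_pos Lf_pos by simp
  show "0 < \<gamma>X" by (rule \<gamma>X)
  show "\<omega>A / \<epsilon> < \<eta>" by (rule exponent_gaps)
  have bound: "op_bound (lev X \<gamma>X) (lev X 1) (semi X (r / \<epsilon>)) (CA * (r / \<epsilon>) powr (\<gamma>X - 1) * exp (\<omega>A * (r / \<epsilon>)))"
    if "0 < r" for r using that splitting_pos by (intro A_smoothing_\<gamma>) simp
  show "semi X (r / \<epsilon>) ((1 / \<epsilon>) *\<^sub>R f (joined p)) \<in> carr (lev X 1)" if "0 < r" "p \<in> carr E" for r p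
    using bound[OF that(1)] normed_nspaceD(10)[OF n\<gamma> f_range[OF joined_mem[OF that(2)]]]
    by (simp add: op_bound_def)
  show "nrm (lev X 1) (semi X (r / \<epsilon>) ((1 / \<epsilon>) *\<^sub>R f (joined p)) - semi X (r / \<epsilon>) ((1 / \<epsilon>) *\<^sub>R f (joined q)))
      \<le> CA * Lf / \<epsilon> powr \<gamma>X * r powr (\<gamma>X - 1) * exp (\<omega>A / \<epsilon> * r) * nrm E (p - q)"
    if r: "0 < r" and p: "p \<in> carr E" and q: "q \<in> carr E" for r p q
  proof -
    have r': "0 \<le> r / \<epsilon>" using r splitting_pos by simp
    let ?d = "f (joined p) - f (joined q)"
    have d: "?d \<in> carr (lev X \<gamma>X)" by (intro normed_nspaceD(9)[OF n\<gamma>] f_range joined_mem p q)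
    have "semi X (r / \<epsilon>) ((1 / \<epsilon>) *\<^sub>R f (joined p)) - semi X (r / \<epsilon>) ((1 / \<epsilon>) *\<^sub>R f (joined q))
        = semi X (r / \<epsilon>) ((1 / \<epsilon>) *\<^sub>R ?d)"
      by (simp only: linear_simps[OF XG.T_bl[OF r']] scaleR_diff_right)
    also have "nrm (lev X 1) \<dots> \<le> CA * (r / \<epsilon>) powr (\<gamma>X - 1) * exp (\<omega>A * (r / \<epsilon>)) * nrm (lev X \<gamma>X) ((1 / \<epsilon>) *\<^sub>R ?d)"
      using bound[OF r] normed_nspaceD(10)[OF n\<gamma> d] by (simp add: op_bound_def)
    also have "nrm (lev X \<gamma>X) ((1 / \<epsilon>) *\<^sub>R ?d) = (1 / \<epsilon>) * nrm (lev X \<gamma>X) ?d"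
      using normed_nspaceD(6)[OF n\<gamma> d, of "1 / \<epsilon>"] splitting_pos by simp
    also have "CA * (r / \<epsilon>) powr (\<gamma>X - 1) * exp (\<omega>A * (r / \<epsilon>)) * ((1 / \<epsilon>) * nrm (lev X \<gamma>X) ?d)
        \<le> CA * (r / \<epsilon>) powr (\<gamma>X - 1) * exp (\<omega>A * (r / \<epsilon>)) * ((1 / \<epsilon>) * (Lf * nrm E (p - q)))"
    proof (intro mult_left_mono)
      show "nrm (lev X \<gamma>X) ?d \<le> Lf * nrm E (p - q)"
        using order_trans[OF f_Lipschitz[OF joined_mem[OF p] joined_mem[OF q]] mult_left_mono[OF joined_le[OF p q]]] Lf_pos
        by simp
    qed (use constants_pos splitting_pos in auto)
    also have "\<dots> = CA * Lf / \<epsilon> powr \<gamma>X * r powr (\<gamma>X - 1) * exp (\<omega>A / \<epsilon> * r) * nrm E (p - q)"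
      using splitting_pos r by (simp add: powr_divide powr_diff)
    finally show ?thesis .
  qed
qed

lemma PF_diff: "PF (x - y) = PF x - PF y" and PS_diff: "PS (x - y) = PS x - PS y"
  by (simp_all add: linear_simps[OF PF_bl] linear_simps[OF PS_bl])

sublocale LF: smoothing_convolution "lev Y 1" QY "semi Y" E
  "\<lambda>p. PF (g (joined p))" "CF * Lg" \<delta>Y "NF + \<omega>A / \<zeta>" \<eta>
proof
  show "normed_nspace E" by (rule normed_E)
  show "PF (g (joined 0)) = 0" by (simp add: joined_0 g_zero linear_0[OF bounded_linear.linear[OF PF_bl]])
  show "0 \<le> CF * Lg" using splitting_pos Lg_pos by simp
  show "0 < \<delta>Y" by (rule \<delta>Y)
  show "NF + \<omega>A / \<zeta> < \<eta>" by (rule exponent_gaps)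
  show "semi Y r (PF (g (joined p))) \<in> carr (lev Y 1)" if "0 < r" "p \<in> carr E" for r p
    using fast_bound[OF that(1)] fast_Lipschitz[OF that(2) zero_E]
    by (simp add: op_bound_def nsub_def joined_0 g_zero)
  show "nrm (lev Y 1) (semi Y r (PF (g (joined p))) - semi Y r (PF (g (joined q))))
      \<le> CF * Lg * r powr (\<delta>Y - 1) * exp ((NF + \<omega>A / \<zeta>) * r) * nrm E (p - q)"
    if r: "0 < r" and p: "p \<in> carr E" and q: "q \<in> carr E" for r p q
  proof -
    have "semi Y r (PF (g (joined p))) - semi Y r (PF (g (joined q))) = semi Y r (PF (g (joined p) - g (joined q)))"
      using r by (simp add: PF_diff linear_simps[OF YG.T_bl])
    also have "nrm (lev Y 1) \<dots> \<le> CF * r powr (\<delta>Y - 1) * exp ((NF + \<omega>A / \<zeta>) * r)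
        * nrm (lev Y \<delta>Y) (PF (g (joined p) - g (joined q)))"
      using fast_bound[OF r] fast_Lipschitz[OF p q] by (simp add: op_bound_def nsub_def)
    also have "\<dots> \<le> CF * r powr (\<delta>Y - 1) * exp ((NF + \<omega>A / \<zeta>) * r) * (Lg * nrm E (p - q))"
      using fast_Lipschitz[OF p q] splitting_pos by (intro mult_left_mono) auto
    finally show ?thesis by (simp add: mult_ac)
  qed
qed

sublocale LS: slow_convolution "lev Y 1" QY slow_back E
  "\<lambda>p. PS (g (joined p))" "Ms * Lg * \<zeta> powr (\<delta>Y - 1)" "NS + \<omega>A / \<zeta>" \<eta>
proof
  have diff: "PS (g (joined p)) - PS (g (joined q)) = PS (g (joined p) - g (joined q))" for p q
    by (simp add: PS_diff)
  show "normed_nspace E" by (rule normed_E)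
  show "0 \<le> Ms * Lg * \<zeta> powr (\<delta>Y - 1)" using splitting_pos Lg_pos by simp
  show "\<eta> < NS + \<omega>A / \<zeta>" by (rule exponent_gaps)
  show "PS (g (joined 0)) = 0" by (simp add: joined_0 g_zero linear_0[OF bounded_linear.linear[OF PS_bl]])
  show "PS (g (joined p)) \<in> carr (lev Y 1)" if "p \<in> carr E" for p
    using slow_Lipschitz[OF that zero_E] by (simp add: joined_0 g_zero)
  show "\<exists>C. \<forall>p\<in>carr E. \<forall>q\<in>carr E. nrm (lev Y 1) (PS (g (joined p)) - PS (g (joined q))) \<le> C * nrm E (p - q)"
    using slow_Lipschitz unfolding diff by blast
  show "nrm (lev Y 1) (slow_back r (PS (g (joined p))) - slow_back r (PS (g (joined q))))
      \<le> Ms * Lg * \<zeta> powr (\<delta>Y - 1) * exp (- (NS + \<omega>A / \<zeta>) * r) * nrm E (p - q)"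
    if r: "0 \<le> r" and p: "p \<in> carr E" and q: "q \<in> carr E" for r p q
  proof -
    note L = slow_Lipschitz[OF p q]
    have "slow_back r (PS (g (joined p))) - slow_back r (PS (g (joined q)))
        = slow_back r (PS (g (joined p) - g (joined q)))"
      by (simp add: PS_diff linear_simps[OF slow_back_bl])
    also have "nrm (lev Y 1) \<dots> \<le> Ms * exp (- (NS + \<omega>A / \<zeta>) * r) * nrm (lev Y 1) (PS (g (joined p) - g (joined q)))"
      using L by (intro slow_back_nrm r) (auto simp: carr_Y1)
    also have "\<dots> \<le> Ms * exp (- (NS + \<omega>A / \<zeta>) * r) * (Lg * \<zeta> powr (\<delta>Y - 1) * nrm E (p - q))"
      using L splitting_pos by (intro mult_left_mono) auto
    finally show ?thesis by (simp add: mult_ac)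
  qed
qed

text \<open>
  The gap condition says that the operator is a contraction. Its third summand carries a factor
  \<open>Gamma \<delta>Y \<ge> 1\<close> that the estimate of the slow component does not need.
\<close>

lemma contraction_gap: "LX.contraction + LF.contraction + LS.contraction < 1"
proof -
  define b where "b = 2 * \<epsilon> * (\<eta> - \<omega>A / \<epsilon>)"
  have b: "b > 0" using exponent_gaps(1) splitting_pos by (simp add: b_def)
  have g: "2 powr \<gamma>X * Lf * CA * Gamma \<gamma>X / b powr \<gamma>X + 2 powr \<delta>Y * Lg * CF * Gamma \<delta>Y / (NS - NF) powr \<delta>Y
     + 2 * \<zeta> powr (\<delta>Y - 1) * Lg * Ms * Gamma \<delta>Y / (NS - NF) < 1"
    using gap_cond unfolding gap_condition_def exponent_gaps(4) b_def by simp
  have "b powr \<gamma>X = 2 powr \<gamma>X * (\<epsilon> powr \<gamma>X * (\<eta> - \<omega>A / \<epsilon>) powr \<gamma>X)"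
    using splitting_pos exponent_gaps(1) by (simp add: b_def powr_mult mult.assoc)
  then have 1: "LX.contraction = 2 powr \<gamma>X * Lf * CA * Gamma \<gamma>X / b powr \<gamma>X"
    by (simp add: LX.contraction_def)
  have e: "\<eta> - (NF + \<omega>A / \<zeta>) = (NS - NF) / 2" "NS + \<omega>A / \<zeta> - \<eta> = (NS - NF) / 2"
    by (simp_all add: eta_def field_simps)
  have "((NS - NF) / 2) powr \<delta>Y = (NS - NF) powr \<delta>Y / 2 powr \<delta>Y"
    using exponents by (simp add: powr_divide)
  then have 2: "LF.contraction = 2 powr \<delta>Y * Lg * CF * Gamma \<delta>Y / (NS - NF) powr \<delta>Y"
    unfolding LF.contraction_def e by simp
  have "LS.contraction = 2 * \<zeta> powr (\<delta>Y - 1) * Lg * Ms * 1 / (NS - NF)"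
    unfolding LS.contraction_def e by simp
  also have "\<dots> \<le> 2 * \<zeta> powr (\<delta>Y - 1) * Lg * Ms * Gamma \<delta>Y / (NS - NF)"
    using exponents splitting_pos Lg_pos Gamma_ge_1[OF \<delta>Y(1,2)]
    by (intro divide_right_mono mult_left_mono) auto
  finally show ?thesis using g 1 2 by simp
qed

sublocale LP: lyapunov_perron "lev X 1" "oper X" "\<lambda>r. semi X (r / \<epsilon>)" "lev Y 1" QY "semi Y" slow_back E
  "\<lambda>p. (1 / \<epsilon>) *\<^sub>R f (joined p)" "\<lambda>p. PF (g (joined p))" "\<lambda>p. PS (g (joined p))"
  "CA * Lf / \<epsilon> powr \<gamma>X" \<gamma>X "\<omega>A / \<epsilon>" "CF * Lg" \<delta>Y "NF + \<omega>A / \<zeta>"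
  "Ms * Lg * \<zeta> powr (\<delta>Y - 1)" "NS + \<omega>A / \<zeta>" \<eta> F S Ms
proof
  show "E = lev X 1 \<times>\<^sub>n nsub (lev Y 1) F \<times>\<^sub>n nsub (lev Y 1) S" by (simp add: split_space_def)
  show "subspace F" "subspace S" "closed F" "closed S" by (rule subspaces)+
  show "semi Y r (PF (g (joined p))) \<in> F" if "0 \<le> r" for r p by (rule semi_F[OF that]) simp
  show "nrm (lev Y 1) (slow_back r y) \<le> Ms * exp (- (NS + \<omega>A / \<zeta>) * r) * nrm (lev Y 1) y"
    if "0 \<le> r" "y \<in> S \<inter> carr (lev Y 1)" for r y
    using that by (intro slow_back_nrm) (auto simp: carr_Y1)
qed (use contraction_gap in simp_all)

end

section \<open>Variation of constants\<close>

context smoothing_convolution begin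

lemma conv_cong:
  assumes "\<And>s. s < t \<Longrightarrow> w s = v s"
  shows "conv w t = conv v t"
  unfolding conv_def
  by (rule integral_spike[of "{t}"]) (use assms in auto)

lemma conv_split:
  assumes w: "w \<in> weighted_paths E p \<eta>" and t: "t1 \<le> t2" "t2 \<le> 0"
  shows "conv w t2 = T (t2 - t1) (conv w t1) + integral {t1..t2} (\<lambda>r. T (t2 - r) (\<phi> (w r)))"
proof -
  let ?k = "\<lambda>r. T (t2 - r) (\<phi> (w r))"
  have t1: "t1 \<le> 0" and d: "0 \<le> t2 - t1" using t by auto
  have int: "?k integrable_on {..t2}" by (rule conv_basic(1)[OF w t(2)])
  have "((\<lambda>r. T (t2 - t1) (T (t1 - r) (\<phi> (w r)))) has_integral T (t2 - t1) (conv w t1)) {..t1}"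
    using has_integral_linear[OF integrable_integral[OF conv_basic(1)[OF w t1]] T_bl[OF d]]
    by (simp add: o_def conv_def)
  then have 1: "(?k has_integral T (t2 - t1) (conv w t1)) {..t1}"
    by (rule has_integral_eq[rotated]) (use d in \<open>simp flip: T_add\<close>)
  have un: "{..t1} \<union> {t1..t2} = {..t2}" using t by auto
  have 2: "?k integrable_on {t1..t2}"
    by (rule integrable_on_subinterval[OF int]) auto
  have "(?k has_integral (T (t2 - t1) (conv w t1) + integral {t1..t2} ?k)) ({..t1} \<union> {t1..t2})"
    by (rule has_integral_Un[OF 1 integrable_integral[OF 2]])
       (rule negligible_subset[of "{t1}"], auto)
  then show ?thesis unfolding un conv_def by (simp add: integral_unique)
qed

text \<open>
  A solution of the inhomogeneous equation on \<open>[a, 0]\<close> differs from the convolution over \<open>(-\<infinity>, s]\<close> by the orbit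
  of the difference that the two have at time \<open>a\<close>.
\<close>

lemma conv_jump:
  assumes w: "w \<in> weighted_paths E p \<eta>"
    and v: "\<And>r. r \<in> {a..0} \<Longrightarrow> (v has_vector_derivative v' r) (at r within {a..0})"
    and gen: "\<And>r. r \<in> {a..0} \<Longrightarrow> ((\<lambda>h. (T h (v r) - T 0 (v r)) /\<^sub>R h) \<longlongrightarrow> d r) (at_right 0)"
    and eq: "\<And>r. r \<in> {a..0} \<Longrightarrow> v' r = d r + \<phi> (w r)"
    and T0: "\<And>x. T 0 x = x" and s: "s \<in> {a..0}"
  shows "v s - conv w s = T (s - a) (v a - conv w a)"
proof -
  have "((\<lambda>r. T (s - r) (v' r + (-1) *\<^sub>R d r)) has_integral T (s - s) (v s) - T (s - a) (v a)) {a..s}"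
  proof (rule moving_integral)
    show "(v has_vector_derivative v' r) (at r within {a..s})" if "r \<in> {a..s}" for r
      by (rule has_vector_derivative_within_subset[OF v]) (use that s in auto)
    show "s - q = s + (-1) * q" for q by simp
  qed (use gen s in auto)
  then have "((\<lambda>r. T (s - r) (\<phi> (w r))) has_integral v s - T (s - a) (v a)) {a..s}"
    by (rule has_integral_eq[rotated, THEN has_integral_eq_rhs]) (use eq s T0 in auto)
  then have "integral {a..s} (\<lambda>r. T (s - r) (\<phi> (w r))) = v s - T (s - a) (v a)" by (rule integral_unique)
  moreover have "conv w s = T (s - a) (conv w a) + integral {a..s} (\<lambda>r. T (s - r) (\<phi> (w r)))"
    by (rule conv_split[OF w]) (use s in auto)
  ultimately show ?thesis using s by (simp add: linear_diff[OF T_linear])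
qed

end

context slow_convolution begin

lemma conv_split:
  assumes w: "w \<in> weighted_paths E p \<eta>" and t: "t1 \<le> t2" "t2 \<le> 0"
  shows "conv w t1 = G (t2 - t1) (conv w t2) + integral {t1..t2} (\<lambda>r. G (r - t1) (\<psi> (w r)))"
proof -
  let ?k = "\<lambda>r. G (r - t1) (\<psi> (w r))"
  have t1: "t1 \<le> 0" and d: "0 \<le> t2 - t1" using t by auto
  have "((\<lambda>r. G (t2 - t1) (G (r - t2) (\<psi> (w r)))) has_integral G (t2 - t1) (conv w t2)) {t2..0}"
    using has_integral_linear[OF integrable_integral[OF conv_basic(1)[OF w t(2)]] T_bl[OF d]]
    by (simp add: o_def conv_def)
  then have 1: "(?k has_integral G (t2 - t1) (conv w t2)) {t2..0}"
    by (rule has_integral_eq[rotated]) (use d in \<open>simp flip: T_add\<close>)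
  have "?k integrable_on {t1..t2}"
    by (rule integrable_subinterval_real[OF conv_basic(1)[OF w t1]]) (use t in auto)
  from has_integral_combine[OF t integrable_integral[OF this] 1]
  show ?thesis unfolding conv_def by (simp add: integral_unique add.commute)
qed

lemma conv_shift:
  assumes "\<And>r. r < a \<Longrightarrow> w r = v (r - a)"
  shows "integral {a + s..a} (\<lambda>r. G (r - (a + s)) (\<psi> (w r))) = conv v s"
proof -
  have vim: "(\<lambda>r. r + - a) -` {s..0} = {a + s..a}" by auto
  have "integral {a + s..a} (\<lambda>r. G (r - (a + s)) (\<psi> (w r))) = integral {a + s..a} (\<lambda>r. G (r + - a - s) (\<psi> (v (r + - a))))"
    by (rule integral_spike[of "{a}"]) (use assms in \<open>auto simp: algebra_simps\<close>)
  also have "\<dots> = conv v s"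
    using integral_translate[of "- a" "{s..0}" "\<lambda>r. G (r - s) (\<psi> (v r))"] unfolding vim conv_def .
  finally show ?thesis .
qed

text \<open>
  The backward variation of constants formula on \<open>[a, 0]\<close>.
\<close>

lemma conv_backward:
  assumes w: "w \<in> weighted_paths E p \<eta>" and a: "a \<le> 0"
    and v: "\<And>r. r \<in> {a..0} \<Longrightarrow> (v has_vector_derivative v' r) (at r within {a..0})"
    and gen: "\<And>r. r \<in> {a..0} \<Longrightarrow> ((\<lambda>h. (G h (v r) - G 0 (v r)) /\<^sub>R h) \<longlongrightarrow> d r) (at_right 0)"
    and eq: "\<And>r. r \<in> {a..0} \<Longrightarrow> v' r + d r = \<psi> (w r)"
    and G0: "\<And>r. r \<in> {a..0} \<Longrightarrow> G 0 (v r) = v r" and s: "s \<in> {a..0}"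
  shows "v s = G (- s) (v 0) - conv w s"
proof -
  have "((\<lambda>r. G (r - s) (v' r + 1 *\<^sub>R d r)) has_integral G (0 - s) (v 0) - G (s - s) (v s)) {s..0}"
  proof (rule moving_integral)
    show "(v has_vector_derivative v' r) (at r within {s..0})" if "r \<in> {s..0}" for r
      by (rule has_vector_derivative_within_subset[OF v]) (use that s in auto)
    show "q - s = - s + 1 * q" for q by simp
  qed (use gen s in auto)
  then have "((\<lambda>r. G (r - s) (\<psi> (w r))) has_integral G (- s) (v 0) - v s) {s..0}"
    by (rule has_integral_eq[rotated, THEN has_integral_eq_rhs]) (use eq s G0 in auto)
  then show ?thesis unfolding conv_def by (simp add: integral_unique)
qed

end

lemma continuous_on_ray_bounded:
  fixes k :: "real \<Rightarrow> 'a::real_normed_vector"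
  assumes "continuous_on {0..} k"
  shows "\<exists>B. \<forall>s\<in>{0..t}. norm (k s) \<le> B"
proof -
  have "compact (k ` {0..t})" by (intro compact_continuous_image continuous_on_subset[OF assms]) auto
  then have "bounded (k ` {0..t})" by (rule compact_imp_bounded)
  then show ?thesis unfolding bounded_iff by simp
qed

section \<open>Attraction to the slow manifold\<close>

context split_fast_slow begin

lemma C_eta_iff: "w \<in> C_eta X Y F S \<eta> \<longleftrightarrow> w \<in> extensional {..0} \<and> w \<in> weighted_paths E 1 \<eta>"
proof -
  have set: "{..0} - {1} = {..0::real}" by auto
  have *: "exp (- (\<eta> * t)) * x \<le> M \<longleftrightarrow> x \<le> M * exp (\<eta> * t)" for t x M :: real
  proof -
    have "exp (- (\<eta> * t)) * x = x / exp (\<eta> * t)" by (simp add: exp_minus divide_inverse mult.commute)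
    then show ?thesis by (simp add: divide_le_eq)
  qed
  show ?thesis
    unfolding C_eta_def weighted_paths_def set bdd_above_def
    by (auto simp: * continuous_map_ntop_iff[OF normed_E])
qed

lemma LP_operator_eq:
  assumes y: "y \<in> S" and t: "t \<le> 0"
  shows "LP_operator X Y f g F S \<epsilon> y w t = LP.LP y w t"
proof -
  have 1: "(1 / \<epsilon>) *\<^sub>R integral {..t} (\<lambda>s. semi X ((t - s) / \<epsilon>) (f (joined (w s)))) = LX.conv w t"
    unfolding LX.conv_def integral_cmul[symmetric]
  proof (rule integral_cong)
    fix s assume "s \<in> {..t}"
    then have "0 \<le> (t - s) / \<epsilon>" using splitting_pos by simp
    from linear_scale[OF XG.T_linear[OF this]]
    show "(1 / \<epsilon>) *\<^sub>R semi X ((t - s) / \<epsilon>) (f (joined (w s))) = semi X ((t - s) / \<epsilon>) ((1 / \<epsilon>) *\<^sub>R f (joined (w s)))"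
      by simp
  qed
  have 2: "slow_group Y S t y = slow_back (- t) y" using y by (simp add: slow_back_def PS_id)
  have 3: "integral {t..0} (\<lambda>s. slow_group Y S (t - s) (PS (g (joined (w s))))) = LS.conv w t"
    unfolding LS.conv_def by (simp add: slow_back_def PS_id)
  show ?thesis using t unfolding LP_operator_def LP.LP_def by (simp add: 1 2 3 LF.conv_def)
qed

lemma LP_cong:
  assumes "\<And>s. s \<le> 0 \<Longrightarrow> w s = v s" "t \<le> 0"
  shows "LP.LP y w t = LP.LP y v t"
proof -
  have "LX.conv w t = LX.conv v t" "LF.conv w t = LF.conv v t"
    using assms by (auto intro!: LX.conv_cong LF.conv_cong)
  moreover have "LS.conv w t = LS.conv v t"
    unfolding LS.conv_def by (rule integral_cong) (use assms in auto)
  ultimately show ?thesis by (simp add: LP.LP_def)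
qed

abbreviation orbit :: "'y \<Rightarrow> real \<Rightarrow> 'x \<times> 'y \<times> 'y" where
  "orbit \<equiv> slow_orbit X Y f g F S \<epsilon> \<eta>"

text \<open>
  The description of \<^const>\<open>slow_orbit\<close> is proper: fixed points exist by contraction and are unique.
\<close>

lemma slow_orbit_fixed_point:
  assumes y: "y \<in> S \<inter> opdom Y"
  shows "orbit y \<in> weighted_paths E 1 \<eta>"
    and "\<And>t. t \<le> 0 \<Longrightarrow> LP.LP y (orbit y) t = orbit y t"
proof -
  have y': "y \<in> S \<inter> carr (lev Y 1)" and yS: "y \<in> S" using y by (auto simp: carr_Y1)
  obtain w where w: "w \<in> weighted_paths E 1 \<eta>" "\<forall>t\<le>0. LP.LP y w t = w t" using LP.LP_fixed_point[OF y'] by blast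
  define v where "v = restrict w {..0}"
  have vw: "v t = w t" if "t \<le> 0" for t using that by (simp add: v_def)
  have v: "v \<in> weighted_paths E 1 \<eta>"
  proof -
    have "continuous_map (top_of_set ({..0} - {1})) (ntop E) v"
      by (rule continuous_map_eq[of _ _ w]) (use w vw in \<open>auto simp: weighted_paths_def\<close>)
    then show ?thesis using w by (auto simp: weighted_paths_def vw)
  qed
  have vfix: "\<forall>t\<le>0. LP.LP y v t = v t" using w(2) LP_cong[OF vw] vw by simp
  have ex: "v \<in> C_eta X Y F S \<eta> \<and> LP_operator X Y f g F S \<epsilon> y v = v"
  proof
    show "v \<in> C_eta X Y F S \<eta>" using v by (simp add: C_eta_iff v_def)
    show "LP_operator X Y f g F S \<epsilon> y v = v"
    proof (rule extensionalityI[of _ "{..0}"])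
      show "LP_operator X Y f g F S \<epsilon> y v \<in> extensional {..0}" by (simp add: LP_operator_def)
      show "v \<in> extensional {..0}" by (simp add: v_def)
      show "LP_operator X Y f g F S \<epsilon> y v t = v t" if "t \<in> {..0}" for t
        using that vfix LP_operator_eq[OF yS] by simp
    qed
  qed
  have uniq: "u = v" if u: "u \<in> C_eta X Y F S \<eta> \<and> LP_operator X Y f g F S \<epsilon> y u = u" for u
  proof (rule extensionalityI[of _ "{..0}"])
    show "u \<in> extensional {..0}" "v \<in> extensional {..0}" using u by (auto simp: C_eta_iff v_def)
    have uw: "u \<in> weighted_paths E 1 \<eta>" using u by (simp add: C_eta_iff)
    fix t :: real assume "t \<in> {..0}"
    then have t: "t \<le> 0" by simp
    have ufix: "\<forall>s\<le>0. LP.LP y u s = u s" using u LP_operator_eq[OF yS, of _ u] by metis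
    have "\<forall>s\<le>0. nrm E (u s - LP.LP y u s) \<le> 0 * exp (\<eta> * s)"
      using ufix normed_nspaceD(3)[OF normed_E] by simp
    from LP.LP_perturbation[OF y' uw v vfix this t] have "nrm E (u t - v t) \<le> 0" by simp
    moreover have d: "u t - v t \<in> carr E"
      by (intro normed_nspaceD(9)[OF normed_E] weighted_paths_mem[OF uw t] weighted_paths_mem[OF v t])
    ultimately have "u t - v t = 0" using normed_nspaceD(4,5)[OF normed_E d] by linarith
    then show "u t = v t" by simp
  qed
  have eq: "orbit y = v"
    unfolding slow_orbit_def by (rule the_equality, rule ex, rule uniq)
  show "orbit y \<in> weighted_paths E 1 \<eta>" unfolding eq by (rule v)
  show "LP.LP y (orbit y) t = orbit y t" if "t \<le> 0" for t
    unfolding eq using vfix that by simp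
qed

lemma continuous_map_E:
  fixes T :: "real set"
  shows "continuous_map (top_of_set T) (ntop E) w \<longleftrightarrow> (\<forall>s\<in>T. w s \<in> carr E) \<and>
    continuous_on T (\<lambda>s. oper X (fst (w s))) \<and> continuous_on T (\<lambda>s. QY (fst (snd (w s)))) \<and>
    continuous_on T (\<lambda>s. QY (snd (snd (w s))))"
proof -
  have c: "p \<in> carr E \<longleftrightarrow> fst p \<in> opdom X \<and> fst (snd p) \<in> F \<and> fst (snd p) \<in> opdom Y \<and>
      snd (snd p) \<in> S \<and> snd (snd p) \<in> opdom Y" for p
    using carr_split by (cases p) simp
  show ?thesis
    unfolding c unfolding split_space_def continuous_map_ntop_nprod[OF XG.normed LP.normed_parts(3)]
      continuous_map_ntop_nprod[OF LP.normed_parts(1,2)]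
      continuous_map_ntop_nsub[OF YG.normed subspaces(1)] continuous_map_ntop_nsub[OF YG.normed subspaces(2)]
      XG.continuous_map_iff YG.continuous_map_iff carr_X1 carr_Y1
    by blast
qed

text \<open>
  A strict solution is continuous in the graph norm of the sum of its slow components; the components are
  recovered by the projections, which are bounded and commute with \<open>B\<close>.
\<close>

lemma strict_solution_continuous:
  assumes sol: "strict_split_solution X Y f g F S \<epsilon> u vF vS"
  shows "continuous_map (top_of_set {0..}) (ntop E) (\<lambda>t. (u t, vF t, vS t))"
proof -
  have mem: "(u t, vF t, vS t) \<in> carr E" if "0 \<le> t" for t
    using sol that by (simp add: strict_split_solution_def)
  note m = mem[unfolded carr_split]
  have "continuous_map (top_of_set {0..}) (ntop (lev X 1 \<times>\<^sub>n lev Y 1)) (\<lambda>t. (u t, vF t + vS t))"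
    using sol by (simp add: strict_split_solution_def)
  then have cu: "continuous_on {0..} (\<lambda>t. oper X (u t))" and cv: "continuous_on {0..} (\<lambda>t. QY (vF t + vS t))"
    unfolding continuous_map_ntop_nprod[OF XG.normed YG.normed] XG.continuous_map_iff YG.continuous_map_iff by auto
  have F: "QY (vF t) = PF (QY (vF t + vS t))" and S: "QY (vS t) = PS (QY (vF t + vS t))" if "t \<in> {0..}" for t
  proof -
    have t: "0 \<le> t" using that by simp
    have D: "vF t + vS t \<in> opdom Y" using m[OF t] YG.nD(8) by (simp add: carr_Y1)
    have "PF (vF t + vS t) = vF t" "PS (vF t + vS t) = vS t"
      using m[OF t] by (simp_all add: linear_simps[OF PF_bl] linear_simps[OF PS_bl] PF_id PS_id PF_S PS_F)
    then show "QY (vF t) = PF (QY (vF t + vS t))" "QY (vS t) = PS (QY (vF t + vS t))"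
      using QY_PF[OF D] QY_PS[OF D] by simp_all
  qed
  have "continuous_on {0..} (\<lambda>t. QY (vF t))"
    by (rule continuous_on_eq[OF bounded_linear.continuous_on[OF PF_bl cv]]) (simp add: F)
  moreover have "continuous_on {0..} (\<lambda>t. QY (vS t))"
    by (rule continuous_on_eq[OF bounded_linear.continuous_on[OF PS_bl cv]]) (simp add: S)
  ultimately show ?thesis unfolding continuous_map_E using mem cu by simp
qed

text \<open>
  For times \<open>r \<ge> 1\<close> the smoothing bound on \<open>F\<close> is used together with the embedding of the domain into the level
  \<open>\<delta>Y\<close>; for \<open>r < 1\<close> that bound is singular, and the bound of the semigroup on the domain is used instead.
\<close>

lemma fast_decay:
  obtains K where "K > 0" "\<And>r y. 0 \<le> r \<Longrightarrow> y \<in> F \<Longrightarrow> y \<in> opdom Y \<Longrightarrow>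
    nrm (lev Y 1) (semi Y r y) \<le> K * exp (\<eta> * r) * nrm (lev Y 1) y"
proof -
  obtain K1 where K1: "\<And>y. y \<in> opdom Y \<Longrightarrow> y \<in> carr (lev Y \<delta>Y) \<and> nrm (lev Y \<delta>Y) y \<le> K1 * norm (QY y)"
    using YS.level_embedding[OF \<delta>Y(1,2)] unfolding lev_def by blast
  obtain L where L: "L > 0" "\<And>y. y \<in> opdom Y \<Longrightarrow> norm (QY y) \<le> L * nrm (lev Y 1) y"
    using YG.Q_bound unfolding carr_Y1 by blast
  have emb: "nrm (lev Y \<delta>Y) y \<le> \<bar>K1\<bar> * L * nrm (lev Y 1) y" if y: "y \<in> opdom Y" for y
  proof -
    have "nrm (lev Y \<delta>Y) y \<le> \<bar>K1\<bar> * norm (QY y)"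
      using K1[OF y] mult_right_mono[OF abs_ge_self[of K1], of "norm (QY y)"] by simp
    also have "\<dots> \<le> \<bar>K1\<bar> * (L * nrm (lev Y 1) y)" using L(2)[OF y] by (rule mult_left_mono) simp
    finally show ?thesis by (simp add: mult.assoc)
  qed
  \<comment> \<open>The three summands serve \<open>r = 0\<close>, \<open>r < 1\<close> and \<open>r \<ge> 1\<close>.\<close>
  define K where "K = 1 + MB * exp (\<bar>\<omega>B\<bar> + \<bar>\<eta>\<bar>) + CF * (\<bar>K1\<bar> * L)"
  have parts: "0 \<le> MB * exp (\<bar>\<omega>B\<bar> + \<bar>\<eta>\<bar>)" "0 \<le> CF * (\<bar>K1\<bar> * L)"
    using constants_pos splitting_pos L(1) by simp_all
  show ?thesis
  proof (rule that[of K])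
    show "K > 0" using parts by (simp add: K_def)
    fix r :: real and y assume r: "0 \<le> r" and y: "y \<in> F" "y \<in> opdom Y"
    have n: "0 \<le> nrm (lev Y 1) y" using YG.nD(4) y by (simp add: carr_Y1)
    have up: "A * exp (\<eta> * r) * nrm (lev Y 1) y \<le> K * exp (\<eta> * r) * nrm (lev Y 1) y" if "A \<le> K" for A
      using that n by (intro mult_right_mono) auto
    consider "r = 0" | "0 < r" "r < 1" | "1 \<le> r" using r by linarith
    then show "nrm (lev Y 1) (semi Y r y) \<le> K * exp (\<eta> * r) * nrm (lev Y 1) y"
    proof cases
      case 1
      then show ?thesis using up[of 1] parts by (simp add: semi_0 K_def)
    next
      case 2
      have "nrm (lev Y 1) (semi Y r y) \<le> MB * exp (\<omega>B * r) * nrm (lev Y 1) y"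
        using B_bound[OF 2(1)] y by (simp add: op_bound_def carr_Y1)
      also have "\<dots> \<le> MB * (exp (\<bar>\<omega>B\<bar> + \<bar>\<eta>\<bar>) * exp (\<eta> * r)) * nrm (lev Y 1) y"
      proof (intro mult_right_mono mult_left_mono n)
        have "\<bar>\<omega>B\<bar> * r \<le> \<bar>\<omega>B\<bar>" "\<bar>\<eta>\<bar> * r \<le> \<bar>\<eta>\<bar>" using 2 by (auto intro: mult_left_le)
        moreover have "\<omega>B * r \<le> \<bar>\<omega>B\<bar> * r" "- \<eta> * r \<le> \<bar>\<eta>\<bar> * r"
          using 2 mult_right_mono[OF abs_ge_self[of \<omega>B], of r] mult_right_mono[OF abs_ge_minus_self[of \<eta>], of r]
          by simp_all
        ultimately have "\<omega>B * r \<le> \<bar>\<omega>B\<bar> + \<bar>\<eta>\<bar> + \<eta> * r" by simp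
        then show "exp (\<omega>B * r) \<le> exp (\<bar>\<omega>B\<bar> + \<bar>\<eta>\<bar>) * exp (\<eta> * r)" by (simp flip: exp_add)
      qed (use constants_pos in simp)
      also have "\<dots> = (MB * exp (\<bar>\<omega>B\<bar> + \<bar>\<eta>\<bar>)) * exp (\<eta> * r) * nrm (lev Y 1) y" by simp
      also have "\<dots> \<le> K * exp (\<eta> * r) * nrm (lev Y 1) y" by (rule up) (use parts in \<open>simp add: K_def\<close>)
      finally show ?thesis .
    next
      case 3
      then have r0: "0 < r" by simp
      have "nrm (lev Y 1) (semi Y r y) \<le> CF * r powr (\<delta>Y - 1) * exp ((NF + \<omega>A / \<zeta>) * r) * nrm (lev Y \<delta>Y) y"
        using fast_bound[OF r0] y K1[OF y(2)] by (simp add: op_bound_def nsub_def)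
      also have "\<dots> \<le> CF * 1 * exp (\<eta> * r) * (\<bar>K1\<bar> * L * nrm (lev Y 1) y)"
      proof (intro mult_mono emb[OF y(2)])
        show "r powr (\<delta>Y - 1) \<le> 1" using 3 \<delta>Y powr_mono[of "\<delta>Y - 1" 0 r] by simp
        show "exp ((NF + \<omega>A / \<zeta>) * r) \<le> exp (\<eta> * r)"
          using exponent_gaps(2) r0 by (simp add: mult_right_mono)
        show "0 \<le> nrm (lev Y \<delta>Y) y" using normed_nspaceD(4)[OF normed_lev_Y] \<delta>Y K1[OF y(2)] by simp
      qed (use splitting_pos in auto)
      also have "\<dots> = (CF * (\<bar>K1\<bar> * L)) * exp (\<eta> * r) * nrm (lev Y 1) y" by simp
      also have "\<dots> \<le> K * exp (\<eta> * r) * nrm (lev Y 1) y" by (rule up) (use parts in \<open>simp add: K_def\<close>)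
      finally show ?thesis .
    qed
  qed
qed

lemma X_decay:
  assumes "0 \<le> r" "x \<in> opdom X"
  shows "nrm (lev X 1) (semi X (r / \<epsilon>) x) \<le> (1 + MA) * exp (\<eta> * r) * nrm (lev X 1) x"
proof -
  have n: "0 \<le> nrm (lev X 1) x" using XG.nD(4) assms by (simp add: carr_X1)
  show ?thesis
  proof (cases "r = 0")
    case True
    then show ?thesis using n constants_pos by (simp add: semi_0 distrib_right)
  next
    case False
    then have r: "0 < r / \<epsilon>" using assms splitting_pos by simp
    have "nrm (lev X 1) (semi X (r / \<epsilon>) x) \<le> MA * exp (\<omega>A * (r / \<epsilon>)) * nrm (lev X 1) x"
      using A_bound[OF r] assms by (simp add: op_bound_def carr_X1)
    also have "\<dots> \<le> (1 + MA) * exp (\<eta> * r) * nrm (lev X 1) x"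
    proof (intro mult_mono n)
      have "\<omega>A / \<epsilon> * r \<le> \<eta> * r" using exponent_gaps(1) assms by (intro mult_right_mono) auto
      then show "exp (\<omega>A * (r / \<epsilon>)) \<le> exp (\<eta> * r)" by simp
    qed (use constants_pos in auto)
    finally show ?thesis .
  qed
qed

text \<open>
  The past of \<open>W\<close> before time \<open>-t\<close> is a weighted path, and its restriction to \<open>[-t, 0]\<close> is bounded. The two
  pieces need not fit together at \<open>-t\<close>.
\<close>

lemma glued_path_weighted:
  assumes w: "continuous_map (top_of_set {0..}) (ntop E) w" and v: "v \<in> weighted_paths E 1 \<eta>" and t: "0 \<le> t"
  defines "W \<equiv> \<lambda>s. if - t \<le> s then w (t + s) else v (t + s)"
  shows "W \<in> weighted_paths E (- t) \<eta>"
proof -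
  have set: "{..0} - {1} = {..0::real}" by auto
  have wm: "w s \<in> carr E" if "0 \<le> s" for s using w that unfolding continuous_map_E by simp
  have vm: "v s \<in> carr E" if "s \<le> 0" for s by (rule weighted_paths_mem[OF v that])
  have Wm: "W s \<in> carr E" if "s \<le> 0" for s using that t wm vm by (auto simp: W_def)
  have cw: "\<exists>d>0. \<forall>r\<in>{0..}. dist r s < d \<longrightarrow> nrm E (w r - w s) < e" if "s \<in> {0..}" "e > 0" for s e
    using w that unfolding continuous_map_ntop_iff[OF normed_E] by blast
  have cv: "\<exists>d>0. \<forall>r\<in>{..0}. dist r s < d \<longrightarrow> nrm E (v r - v s) < e" if "s \<in> {..0}" "e > 0" for s e
    using v that unfolding weighted_paths_def set continuous_map_ntop_iff[OF normed_E] by blast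
  have cont: "continuous_map (top_of_set ({..0} - {- t})) (ntop E) W"
    unfolding continuous_map_ntop_iff[OF normed_E]
  proof (intro conjI ballI allI impI)
    fix s e :: real assume s: "s \<in> {..0} - {- t}" and e: "e > 0"
    show "\<exists>d>0. \<forall>r\<in>{..0} - {- t}. dist r s < d \<longrightarrow> nrm E (W r - W s) < e"
    proof (cases "s < - t")
      case True
      obtain d where d: "d > 0" "\<forall>r\<in>{..0}. dist r (t + s) < d \<longrightarrow> nrm E (v r - v (t + s)) < e"
        using cv[of "t + s" e] True e by auto
      have "nrm E (W r - W s) < e" if "r \<in> {..0} - {- t}" "dist r s < min d (- t - s)" for r
      proof -
        have r: "r < - t" using that True by (auto simp: dist_real_def)
        have "dist (t + r) (t + s) < d" using that by (simp add: dist_real_def)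
        then show ?thesis using d(2) r True by (simp add: W_def)
      qed
      then show ?thesis using d(1) True by (intro exI[of _ "min d (- t - s)"]) simp
    next
      case False
      then have s': "- t < s" using s by auto
      obtain d where d: "d > 0" "\<forall>r\<in>{0..}. dist r (t + s) < d \<longrightarrow> nrm E (w r - w (t + s)) < e"
        using cw[of "t + s" e] s' e by auto
      have "nrm E (W r - W s) < e" if "r \<in> {..0} - {- t}" "dist r s < min d (t + s)" for r
      proof -
        have r: "- t < r" using that s' by (auto simp: dist_real_def)
        have "dist (t + r) (t + s) < d" using that by (simp add: dist_real_def)
        then show ?thesis using d(2) r s' by (simp add: W_def)
      qed
      then show ?thesis using d(1) s' by (intro exI[of _ "min d (t + s)"]) simp
    qed
  qed (use Wm in auto)
  have bw: "\<exists>B. \<forall>s\<in>{0..t}. nrm E (w s) \<le> B"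
  proof -
    have c: "continuous_on {0..} (\<lambda>s. oper X (fst (w s)))" "continuous_on {0..} (\<lambda>s. QY (fst (snd (w s))))"
      "continuous_on {0..} (\<lambda>s. QY (snd (snd (w s))))"
      using w unfolding continuous_map_E by simp_all
    obtain B1 where B1: "\<forall>s\<in>{0..t}. norm (oper X (fst (w s))) \<le> B1" using continuous_on_ray_bounded[OF c(1)] by (rule exE)
    obtain B2 where B2: "\<forall>s\<in>{0..t}. norm (QY (fst (snd (w s)))) \<le> B2" using continuous_on_ray_bounded[OF c(2)] by (rule exE)
    obtain B3 where B3: "\<forall>s\<in>{0..t}. norm (QY (snd (snd (w s)))) \<le> B3" using continuous_on_ray_bounded[OF c(3)] by (rule exE)
    obtain K1 where K1: "K1 > 0" "\<And>x. x \<in> carr (lev X 1) \<Longrightarrow> nrm (lev X 1) x \<le> K1 * norm (oper X x)"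
      using XG.nrm_bound by blast
    obtain K2 where K2: "K2 > 0" "\<And>x. x \<in> carr (lev Y 1) \<Longrightarrow> nrm (lev Y 1) x \<le> K2 * norm (QY x)"
      using YG.nrm_bound by blast
    have "nrm E (w s) \<le> K1 * B1 + K2 * B2 + K2 * B3" if s: "s \<in> {0..t}" for s
    proof -
      obtain x a b where eq: "w s = (x, a, b)" by (metis prod_cases3)
      have m: "x \<in> carr (lev X 1)" "a \<in> carr (lev Y 1)" "b \<in> carr (lev Y 1)"
        using wm[of s] s by (auto simp: eq carr_split carr_X1 carr_Y1)
      have "norm (oper X x) \<le> B1" "norm (QY a) \<le> B2" "norm (QY b) \<le> B3" using bspec[OF B1 s] bspec[OF B2 s] bspec[OF B3 s] by (simp_all add: eq)
      then show ?thesis using order_trans[OF K1(2)[OF m(1)] mult_left_mono] order_trans[OF K2(2)[OF m(2)] mult_left_mono]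
          order_trans[OF K2(2)[OF m(3)] mult_left_mono] K1(1) K2(1)
        unfolding eq nrm_split by (intro add_mono) auto
    qed
    then show ?thesis by blast
  qed
  then obtain B where B: "\<And>s. s \<in> {0..t} \<Longrightarrow> nrm E (w s) \<le> B" by blast
  obtain M where M: "\<And>s. s \<le> 0 \<Longrightarrow> nrm E (v s) \<le> M * exp (\<eta> * s)" using v unfolding weighted_paths_def by blast
  have M0: "0 \<le> M" using M[of 0] normed_nspaceD(4)[OF normed_E vm[of 0]] by simp
  have B0: "0 \<le> B" using B[of 0] normed_nspaceD(4)[OF normed_E wm[of 0]] t by simp
  have "nrm E (W s) \<le> (B * exp (\<bar>\<eta>\<bar> * t) + M * exp (\<eta> * t)) * exp (\<eta> * s)" if s: "s \<le> 0" for s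
  proof (cases "- t \<le> s")
    case True
    have "\<bar>\<eta> * s\<bar> \<le> \<bar>\<eta>\<bar> * t"
      using True s mult_left_mono[of "- s" t "\<bar>\<eta>\<bar>"] by (simp add: abs_mult)
    then have "1 \<le> exp (\<bar>\<eta>\<bar> * t) * exp (\<eta> * s)" by (simp flip: exp_add)
    then have "B * 1 \<le> B * (exp (\<bar>\<eta>\<bar> * t) * exp (\<eta> * s))" using B0 by (rule mult_left_mono)
    moreover have "nrm E (W s) \<le> B" using B[of "t + s"] True s by (simp add: W_def)
    ultimately have "nrm E (W s) \<le> B * exp (\<bar>\<eta>\<bar> * t) * exp (\<eta> * s)" by (simp add: mult.assoc)
    moreover have "0 \<le> M * exp (\<eta> * t) * exp (\<eta> * s)" using M0 by simp
    ultimately show ?thesis by (simp add: distrib_right)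
  next
    case False
    then have "nrm E (W s) \<le> M * exp (\<eta> * t) * exp (\<eta> * s)"
      using M[of "t + s"] by (simp add: W_def exp_add distrib_left mult.assoc)
    moreover have "0 \<le> B * exp (\<bar>\<eta>\<bar> * t) * exp (\<eta> * s)" using B0 by simp
    ultimately show ?thesis by (simp add: distrib_right)
  qed
  then show ?thesis using Wm cont unfolding weighted_paths_def by blast
qed

lemma X_generator:
  assumes "x \<in> opdom X"
  shows "((\<lambda>h. (semi X (h / \<epsilon>) x - semi X (0 / \<epsilon>) x) /\<^sub>R h) \<longlongrightarrow> (1 / \<epsilon>) *\<^sub>R oper X x) (at_right 0)"
proof -
  have \<epsilon>: "filterlim (\<lambda>h. h / \<epsilon>) (at_right 0) (at_right 0)"
    unfolding filterlim_at using splitting_pos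
    by (auto intro!: tendsto_eq_intros simp: eventually_at_filter zero_less_divide_iff)
  have "((\<lambda>h. (semi X h x - x) /\<^sub>R h) \<longlongrightarrow> oper X x) (at_right 0)"
    using A_generates assms unfolding generates_semigroup_def by auto
  from tendsto_scaleR[OF tendsto_const[of "1 / \<epsilon>"] filterlim_compose[OF this \<epsilon>]]
  have "((\<lambda>h. (1 / \<epsilon>) *\<^sub>R ((semi X (h / \<epsilon>) x - x) /\<^sub>R (h / \<epsilon>))) \<longlongrightarrow> (1 / \<epsilon>) *\<^sub>R oper X x) (at_right 0)" .
  moreover have "(1 / \<epsilon>) *\<^sub>R ((semi X (h / \<epsilon>) x - x) /\<^sub>R (h / \<epsilon>)) = (semi X (h / \<epsilon>) x - semi X (0 / \<epsilon>) x) /\<^sub>R h" for h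
    using splitting_pos by (simp add: semi_0 divide_inverse)
  ultimately show ?thesis by simp
qed

lemma has_vector_derivative_shift_Icc:
  assumes "(v has_vector_derivative v') (at (t + r) within {0..})" "r \<in> {- t..0}"
  shows "((\<lambda>r. v (t + r)) has_vector_derivative v') (at r within {- t..0::real})"
proof -
  have 1: "((\<lambda>r. t + r) has_vector_derivative 1) (at r within {- t..0})"
    unfolding has_real_derivative_iff_has_vector_derivative[symmetric] by (auto intro!: derivative_eq_intros)
  have "(v has_vector_derivative v') (at (t + r) within (\<lambda>r. t + r) ` {- t..0})"
    by (rule has_vector_derivative_within_subset[OF assms(1)]) auto
  from vector_diff_chain_within[OF 1 this] show ?thesis by (simp add: o_def)
qed

text \<open>
  The comparison of the glued path with the slow orbit through \<open>vS t\<close>. The rate is \<open>c = - \<eta>\<close>.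
\<close>

lemma attraction:
  assumes neg: "\<eta> < 0"
  shows "let h = slow_map X Y f g F S \<epsilon> \<eta> in
    \<exists>C>0. \<exists>c>0. \<forall>u vF vS. strict_split_solution X Y f g F S \<epsilon> u vF vS \<longrightarrow>
      (\<forall>t\<ge>0. nrm (lev X 1 \<times>\<^sub>n lev Y 1) (u t - fst (h (vS t)), vF t - snd (h (vS t)))
        \<le> C * exp (- c * t) * nrm (lev X 1 \<times>\<^sub>n lev Y 1) (u 0 - fst (h (vS 0)), vF 0 - snd (h (vS 0))))"
proof -
  obtain K where K: "K > 0" "\<And>r y. 0 \<le> r \<Longrightarrow> y \<in> F \<Longrightarrow> y \<in> opdom Y \<Longrightarrow>
    nrm (lev Y 1) (semi Y r y) \<le> K * exp (\<eta> * r) * nrm (lev Y 1) y" using fast_decay by blast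
  \<comment> \<open>A common constant for the decay of both components of the jump, at rate \<open>\<eta>\<close>.\<close>
  define K' where "K' = max K (1 + MA)"
  have K': "K' > 0" using K(1) by (simp add: K'_def)
  have k1: "0 < 1 - LP.\<kappa>" using contraction_gap by simp
  let ?h = "slow_map X Y f g F S \<epsilon> \<eta>"
  have decay: "nrm (lev X 1 \<times>\<^sub>n lev Y 1) (u t - fst (?h (vS t)), vF t - snd (?h (vS t)))
      \<le> K' / (1 - LP.\<kappa>) * exp (- (- \<eta>) * t) *
        nrm (lev X 1 \<times>\<^sub>n lev Y 1) (u 0 - fst (?h (vS 0)), vF 0 - snd (?h (vS 0)))"
    if sol: "strict_split_solution X Y f g F S \<epsilon> u vF vS" and t: "0 \<le> t" for u vF vS and t :: real
  proof -
    have mem: "(u s, vF s, vS s) \<in> carr E" if "0 \<le> s" for s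
      using sol that by (simp add: strict_split_solution_def)
    note m = mem[unfolded carr_split]
    obtain u' vF' vS' where der: "\<And>s. 0 \<le> s \<Longrightarrow> (u has_vector_derivative u' s) (at s within {0..})"
        "\<And>s. 0 \<le> s \<Longrightarrow> (vF has_vector_derivative vF' s) (at s within {0..})"
        "\<And>s. 0 \<le> s \<Longrightarrow> (vS has_vector_derivative vS' s) (at s within {0..})"
      and ode: "\<And>s. 0 \<le> s \<Longrightarrow> \<epsilon> *\<^sub>R u' s = oper X (u s) + f (u s, vF s + vS s)"
        "\<And>s. 0 \<le> s \<Longrightarrow> vF' s = oper Y (vF s) + PF (g (u s, vF s + vS s))"
        "\<And>s. 0 \<le> s \<Longrightarrow> vS' s = oper Y (vS s) + PS (g (u s, vF s + vS s))"
      using sol unfolding strict_split_solution_def by blast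
    have slowS: "vS s \<in> S \<inter> opdom Y" if "0 \<le> s" for s using m[OF that] by simp
    note o0 = slow_orbit_fixed_point[OF slowS[OF order_refl]] and ot = slow_orbit_fixed_point[OF slowS[OF t]]
    define w where "w s = (u s, vF s, vS s)" for s
    \<comment> \<open>The solution, preceded by the slow orbit through \<open>vS 0\<close>, with time shifted so that \<open>t\<close> becomes \<open>0\<close>.\<close>
    define W where "W s = (if - t \<le> s then w (t + s) else orbit (vS 0) (t + s))" for s
    have W: "W \<in> weighted_paths E (- t) \<eta>"
      unfolding W_def w_def by (rule glued_path_weighted[OF strict_solution_continuous[OF sol] o0(1) t])
    have Wr: "W r = (u (t + r), vF (t + r), vS (t + r))" if "r \<in> {- t..0}" for r
      using that by (simp add: W_def w_def)
    have jW: "joined (W r) = (u (t + r), vF (t + r) + vS (t + r))" if "r \<in> {- t..0}" for r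
      by (simp add: Wr[OF that] joined_def)
    have tr: "0 \<le> t + r" if "r \<in> {- t..0}" for r using that by simp
    obtain x0 a0 b0 where o00: "orbit (vS 0) 0 = (x0, a0, b0)" by (metis prod_cases3)
    have past: "W s = orbit (vS 0) (t + s)" if "s < - t" for s using that by (simp add: W_def)
    have convX: "LX.conv W s = fst (orbit (vS 0) (t + s))" and convF: "LF.conv W s = fst (snd (orbit (vS 0) (t + s)))"
      if "s \<le> - t" for s
    proof -
      have "LP.LP (vS 0) (orbit (vS 0)) (t + s) = orbit (vS 0) (t + s)" using o0(2) that by simp
      moreover have "LX.conv W s = LX.conv (\<lambda>r. orbit (vS 0) (t + r)) s" "LF.conv W s = LF.conv (\<lambda>r. orbit (vS 0) (t + r)) s"
        using that past by (auto intro!: LX.conv_cong LF.conv_cong)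
      ultimately show "LX.conv W s = fst (orbit (vS 0) (t + s))" "LF.conv W s = fst (snd (orbit (vS 0) (t + s)))"
        unfolding LP.LP_def by (metis LX.conv_shift fst_conv, metis LF.conv_shift fst_conv snd_conv)
    qed
    \<comment> \<open>The jump of \<open>W\<close> at \<open>-t\<close>; its slow component vanishes.\<close>
    define jX where "jX = u 0 - x0"
    define jF where "jF = vF 0 - a0"
    have X: "u (t + s) - LX.conv W s = semi X ((s + t) / \<epsilon>) jX" if s: "s \<in> {- t..0}" for s
    proof -
      have "u (t + s) - LX.conv W s = semi X ((s - - t) / \<epsilon>) (u (t + - t) - LX.conv W (- t))"
      proof (rule LX.conv_jump[OF W])
        show "((\<lambda>r. u (t + r)) has_vector_derivative u' (t + r)) (at r within {- t..0})" if "r \<in> {- t..0}" for r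
          by (rule has_vector_derivative_shift_Icc[OF der(1)[OF tr[OF that]] that])
        show "((\<lambda>h. (semi X (h / \<epsilon>) (u (t + r)) - semi X (0 / \<epsilon>) (u (t + r))) /\<^sub>R h) \<longlongrightarrow> (1 / \<epsilon>) *\<^sub>R oper X (u (t + r))) (at_right 0)"
          if "r \<in> {- t..0}" for r using m[OF tr[OF that]] by (intro X_generator) simp
        show "u' (t + r) = (1 / \<epsilon>) *\<^sub>R oper X (u (t + r)) + (1 / \<epsilon>) *\<^sub>R f (joined (W r))" if "r \<in> {- t..0}" for r
        proof -
          have "u' (t + r) = (1 / \<epsilon>) *\<^sub>R (\<epsilon> *\<^sub>R u' (t + r))" using splitting_pos by simp
          then show ?thesis unfolding ode(1)[OF tr[OF that]] by (simp add: scaleR_add_right jW[OF that])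
        qed
      qed (use s in \<open>auto simp: semi_0\<close>)
      then show ?thesis using convX[of "- t"] by (simp add: jX_def o00)
    qed
    have Fc: "vF (t + s) - LF.conv W s = semi Y (s + t) jF" if s: "s \<in> {- t..0}" for s
    proof -
      have "vF (t + s) - LF.conv W s = semi Y (s - - t) (vF (t + - t) - LF.conv W (- t))"
      proof (rule LF.conv_jump[OF W])
        show "((\<lambda>r. vF (t + r)) has_vector_derivative vF' (t + r)) (at r within {- t..0})" if "r \<in> {- t..0}" for r
          by (rule has_vector_derivative_shift_Icc[OF der(2)[OF tr[OF that]] that])
        show "((\<lambda>h. (semi Y h (vF (t + r)) - semi Y 0 (vF (t + r))) /\<^sub>R h) \<longlongrightarrow> oper Y (vF (t + r))) (at_right 0)"
          if "r \<in> {- t..0}" for r using m[OF tr[OF that]] by (intro semi_generator) simp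
        show "vF' (t + r) = oper Y (vF (t + r)) + PF (g (joined (W r)))" if "r \<in> {- t..0}" for r
          using ode(2)[OF tr[OF that]] by (simp add: jW[OF that])
      qed (use s in \<open>auto simp: semi_0\<close>)
      then show ?thesis using convF[of "- t"] by (simp add: jF_def o00)
    qed
    have Sc: "vS (t + s) = slow_back (- s) (vS t) - LS.conv W s" if s: "s \<in> {- t..0}" for s
    proof -
      have "vS (t + s) = slow_back (- s) (vS (t + 0)) - LS.conv W s"
      proof (rule LS.conv_backward[OF W])
        show "((\<lambda>r. vS (t + r)) has_vector_derivative vS' (t + r)) (at r within {- t..0})" if "r \<in> {- t..0}" for r
          by (rule has_vector_derivative_shift_Icc[OF der(3)[OF tr[OF that]] that])
        show "((\<lambda>h. (slow_back h (vS (t + r)) - slow_back 0 (vS (t + r))) /\<^sub>R h) \<longlongrightarrow> - PS (oper Y (vS (t + r)))) (at_right 0)"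
          if "r \<in> {- t..0}" for r using m[OF tr[OF that]] by (intro slow_back_generator) simp
        show "vS' (t + r) + - PS (oper Y (vS (t + r))) = PS (g (joined (W r)))" if "r \<in> {- t..0}" for r
          using ode(3)[OF tr[OF that]] m[OF tr[OF that]] by (simp add: jW[OF that] PS_id oper_S)
        show "slow_back 0 (vS (t + r)) = vS (t + r)" if "r \<in> {- t..0}" for r
          using m[OF tr[OF that]] by (simp add: slow_back_0 PS_id)
      qed (use s t in auto)
      then show ?thesis by simp
    qed
    \<comment> \<open>Before \<open>-t\<close>, the equation of the orbit through \<open>vS 0\<close> is rewritten in terms of the end value \<open>vS t\<close>.\<close>
    have Sp: "snd (snd (orbit (vS 0) (t + s))) = slow_back (- s) (vS t) - LS.conv W s" if s: "s < - t" for s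
    proof -
      have neg: "t + s \<le> 0" using s by simp
      have e1: "snd (snd (orbit (vS 0) (t + s))) = slow_back (- (t + s)) (vS 0) - LS.conv (orbit (vS 0)) (t + s)"
        using o0(2)[OF neg] unfolding LP.LP_def by (metis snd_conv)
      have "vS 0 = slow_back t (vS t) - LS.conv W (- t)" using Sc[of "- t"] t by simp
      then have "slow_back (- (t + s)) (vS 0) = slow_back (- (t + s)) (slow_back t (vS t) - LS.conv W (- t))"
        by (rule arg_cong)
      then have e2: "slow_back (- (t + s)) (vS 0) = slow_back (- s) (vS t) - slow_back (- (t + s)) (LS.conv W (- t))"
        by (simp add: linear_simps[OF slow_back_bl] flip: slow_back_add)
      have e3: "LS.conv (orbit (vS 0)) (t + s) = integral {s..- t} (\<lambda>r. slow_back (r - s) (PS (g (joined (W r)))))"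
        using LS.conv_shift[of "- t" W "orbit (vS 0)" "t + s"] past by (simp add: add.commute)
      have a: "- t - s = - (t + s)" by simp
      show ?thesis
        using LS.conv_split[OF W, of s "- t", unfolded a] s t unfolding e1 e2 e3 by simp
    qed
    have x0: "x0 \<in> opdom X" "a0 \<in> F" "a0 \<in> opdom Y"
      using weighted_paths_mem[OF o0(1) order_refl] by (auto simp: o00 carr_split)
    have jXm: "jX \<in> opdom X" and jFm: "jF \<in> F" "jF \<in> opdom Y"
      using m[OF order_refl] x0 XG.nD(9) YG.nD(9) subspace_diff[OF subspaces(1)]
      by (auto simp: jX_def jF_def carr_X1 carr_Y1)
    define J where "J = nrm (lev X 1) jX + nrm (lev Y 1) jF"
    have J0: "0 \<le> nrm (lev X 1) jX" "0 \<le> nrm (lev Y 1) jF"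
      using XG.nD(4) YG.nD(4) jXm jFm by (auto simp: carr_X1 carr_Y1)
    \<comment> \<open>\<open>W\<close> solves the fixed point equation up to the orbit of the jump.\<close>
    have near: "\<forall>s\<le>0. nrm E (W s - LP.LP (vS t) W s) \<le> K' * exp (\<eta> * t) * J * exp (\<eta> * s)"
    proof (intro allI impI)
      fix s :: real assume s: "s \<le> 0"
      show "nrm E (W s - LP.LP (vS t) W s) \<le> K' * exp (\<eta> * t) * J * exp (\<eta> * s)"
      proof (cases "- t \<le> s")
        case True
        then have s': "s \<in> {- t..0}" using s by simp
        have st: "0 \<le> s + t" using True by simp
        have "W s - LP.LP (vS t) W s = (semi X ((s + t) / \<epsilon>) jX, semi Y (s + t) jF, 0)"
          using X[OF s'] Fc[OF s'] Sc[OF s'] by (simp add: Wr[OF s'] LP.LP_def)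
        then have "nrm E (W s - LP.LP (vS t) W s) = nrm (lev X 1) (semi X ((s + t) / \<epsilon>) jX) + nrm (lev Y 1) (semi Y (s + t) jF)"
          by (simp add: nrm_split YG.nD)
        also have "\<dots> \<le> (1 + MA) * exp (\<eta> * (s + t)) * nrm (lev X 1) jX + K * exp (\<eta> * (s + t)) * nrm (lev Y 1) jF"
          by (intro add_mono X_decay K st jXm jFm)
        also have "\<dots> \<le> K' * exp (\<eta> * (s + t)) * nrm (lev X 1) jX + K' * exp (\<eta> * (s + t)) * nrm (lev Y 1) jF"
          using J0 by (intro add_mono mult_right_mono) (auto simp: K'_def)
        also have "\<dots> = K' * exp (\<eta> * t) * J * exp (\<eta> * s)"
          by (simp add: J_def exp_add algebra_simps)
        finally show ?thesis .
      next
        case False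
        have "W s = (LX.conv W s, LF.conv W s, slow_back (- s) (vS t) - LS.conv W s)"
          using convX[of s] convF[of s] Sp[of s] past[of s] False by (simp add: prod_eq_iff)
        then have "W s - LP.LP (vS t) W s = 0" by (simp add: LP.LP_def)
        then show ?thesis using J0 K' normed_nspaceD(3)[OF normed_E] by (simp add: J_def)
      qed
    qed
    have vSt: "vS t \<in> S \<inter> carr (lev Y 1)" using slowS[OF t] by (simp add: carr_Y1)
    have "nrm E (W 0 - orbit (vS t) 0) \<le> K' * exp (\<eta> * t) * J / (1 - LP.\<kappa>) * exp (\<eta> * 0)"
      by (rule LP.LP_perturbation[OF vSt W weighted_paths_continuous[OF ot(1)] _ near order_refl])
         (use ot(2) in simp)
    then have main: "nrm E (W 0 - orbit (vS t) 0) \<le> K' / (1 - LP.\<kappa>) * exp (\<eta> * t) * J" by (simp add: mult_ac)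
    obtain x1 a1 b1 where o1: "orbit (vS t) 0 = (x1, a1, b1)" by (metis prod_cases3)
    have h: "?h (vS t) = (x1, a1)" "?h (vS 0) = (x0, a0)"
      by (simp_all add: slow_map_def o1 o00)
    have W0: "W 0 = (u t, vF t, vS t)" using Wr[of 0] t by simp
    have "vS t - b1 \<in> carr (lev Y 1)"
      using weighted_paths_mem[OF ot(1) order_refl] slowS[OF t] YG.nD(9) by (auto simp: o1 carr_split carr_Y1)
    then have "0 \<le> nrm (lev Y 1) (vS t - b1)" by (rule YG.nD)
    then show ?thesis
      using main unfolding h W0 o1 by (simp add: nprod_def nrm_split J_def jX_def jF_def)
  qed
  show ?thesis
    unfolding Let_def
    by (rule exI[of _ "K' / (1 - LP.\<kappa>)"], intro conjI exI[of _ "- \<eta>"] allI impI decay)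
      (use K' k1 neg in auto)
qed

end

theorem proposition5p5:
  fixes X :: "('x::banach, 'xm::banach) scaled_semigroup"
    and Y :: "('y::banach, 'ym::banach) scaled_semigroup"
    and \<gamma>X \<delta>X \<delta>Y Lf Lg MA CA MB CB \<omega>A \<omega>B \<omega>f CF Ms \<zeta>1 :: real
    and f :: "'x \<times> 'y \<Rightarrow> 'x" and g :: "'x \<times> 'y \<Rightarrow> 'y"
    and F S :: "real \<Rightarrow> 'y set"
    and NF NS :: "real \<Rightarrow> real"
  assumes setting: "fast_slow X Y \<gamma>X \<delta>X \<delta>Y f g Lf Lg MA CA MB CB \<omega>A \<omega>B \<omega>f"
    and splitting_constants: "0 < CF" "0 < Ms" "0 < \<zeta>1"
    and splitting: "\<And>\<zeta>. 0 < \<zeta> \<Longrightarrow> \<zeta> < \<zeta>1 \<Longrightarrow>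
        slow_splitting X Y \<delta>Y g Lg \<omega>A CF Ms \<zeta> (F \<zeta>) (S \<zeta>) (NF \<zeta>) (NS \<zeta>)"
    and fast_Lipschitz: "\<And>\<zeta> p q. 0 < \<zeta> \<Longrightarrow> \<zeta> < \<zeta>1 \<Longrightarrow>
        p \<in> carr (split_space X Y (F \<zeta>) (S \<zeta>)) \<Longrightarrow> q \<in> carr (split_space X Y (F \<zeta>) (S \<zeta>)) \<Longrightarrow>
        proj (F \<zeta>) (S \<zeta>) (g (joined p) - g (joined q)) \<in> carr (lev Y \<delta>Y) \<and>
        nrm (lev Y \<delta>Y) (proj (F \<zeta>) (S \<zeta>) (g (joined p) - g (joined q)))
          \<le> Lg * nrm (split_space X Y (F \<zeta>) (S \<zeta>)) (p - q)"
    and f_diff: "\<exists>Df. C1_map (lev X 1 \<times>\<^sub>n lev Y 1) (lev X \<gamma>X) f Df \<and>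
        (\<forall>p\<in>carr (lev X 1 \<times>\<^sub>n lev Y 1). op_bound (lev X 1 \<times>\<^sub>n lev Y 1) (lev X \<gamma>X) (Df p) Lf)"
    and g_diff: "\<exists>Dg. C1_map (lev X 1 \<times>\<^sub>n lev Y 1) (lev Y \<delta>Y) g Dg \<and>
        (\<forall>p\<in>carr (lev X 1 \<times>\<^sub>n lev Y 1). op_bound (lev X 1 \<times>\<^sub>n lev Y 1) (lev Y \<delta>Y) (Dg p) Lg)"
  shows "\<exists>\<zeta>0>0. \<exists>\<epsilon>0>0. \<forall>\<zeta> \<epsilon>. 0 < \<zeta> \<and> \<zeta> < \<zeta>0 \<and> \<zeta> < \<zeta>1 \<and> 0 < \<epsilon> \<and> \<epsilon> < \<epsilon>0 \<and>
      gap_condition \<gamma>X \<delta>Y Lf Lg CA CF Ms \<omega>A (NF \<zeta>) (NS \<zeta>) \<epsilon> \<zeta> \<and>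
      eta \<omega>A \<zeta> (NF \<zeta>) (NS \<zeta>) < 0 \<longrightarrow>
      (let h = slow_map X Y f g (F \<zeta>) (S \<zeta>) \<epsilon> (eta \<omega>A \<zeta> (NF \<zeta>) (NS \<zeta>)) in
       \<exists>C>0. \<exists>c>0. \<forall>u vF vS. strict_split_solution X Y f g (F \<zeta>) (S \<zeta>) \<epsilon> u vF vS \<longrightarrow>
         (\<forall>t\<ge>0.
            nrm (lev X 1 \<times>\<^sub>n lev Y 1) (u t - fst (h (vS t)), vF t - snd (h (vS t)))
            \<le> C * exp (- c * t) *
              nrm (lev X 1 \<times>\<^sub>n lev Y 1) (u 0 - fst (h (vS 0)), vF 0 - snd (h (vS 0)))))"
proof (rule exI[of _ 1], rule conjI[OF zero_less_one], rule exI[of _ 1], rule conjI[OF zero_less_one],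
    intro allI impI, elim conjE)
  \<comment> \<open>The bounds \<open>1\<close> for \<open>\<zeta>\<close> and \<open>\<epsilon>\<close> are arbitrary: the gap condition and \<open>\<eta> < 0\<close> suffice.\<close>
  fix \<zeta> \<epsilon> :: real
  assume pos: "0 < \<zeta>" "\<zeta> < \<zeta>1" "0 < \<epsilon>"
    and gap: "gap_condition \<gamma>X \<delta>Y Lf Lg CA CF Ms \<omega>A (NF \<zeta>) (NS \<zeta>) \<epsilon> \<zeta>"
    and neg: "eta \<omega>A \<zeta> (NF \<zeta>) (NS \<zeta>) < 0"
  interpret split_fast_slow X Y \<gamma>X \<delta>X \<delta>Y f g Lf Lg MA CA MB CB \<omega>A \<omega>B \<omega>f CF Ms \<zeta> "F \<zeta>" "S \<zeta>" "NF \<zeta>" "NS \<zeta>" \<epsilon>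
    using pos splitting_constants
    by (intro split_fast_slow.intro split_fast_slow_axioms.intro setting splitting fast_Lipschitz gap)
  show "let h = slow_map X Y f g (F \<zeta>) (S \<zeta>) \<epsilon> (eta \<omega>A \<zeta> (NF \<zeta>) (NS \<zeta>)) in
       \<exists>C>0. \<exists>c>0. \<forall>u vF vS. strict_split_solution X Y f g (F \<zeta>) (S \<zeta>) \<epsilon> u vF vS \<longrightarrow>
         (\<forall>t\<ge>0.
            nrm (lev X 1 \<times>\<^sub>n lev Y 1) (u t - fst (h (vS t)), vF t - snd (h (vS t)))
            \<le> C * exp (- c * t) *
              nrm (lev X 1 \<times>\<^sub>n lev Y 1) (u 0 - fst (h (vS 0)), vF 0 - snd (h (vS 0))))"
    by (rule attraction[OF neg])
qed

end
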